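(* Assume $\mathrm{non}(\mathcal N)=\aleph_1$ (in particular, this holds if CH holds). Then an infinite compact Hausdorff Abelian group $G$ is determined if and only if $w(G)=\omega$.
   Context: All groups are Abelian. $\mathbb T$ is the circle group, $(-\tfrac12,\tfrac12]$ with addition mod $1$ and its usual compact metrizable topology. For a topological Abelian group $G$, $\widehat G$ is the group of continuous homomorphisms $G\to\mathbb T$ with the compact-open topology. A dense subgroup $D$ of $G$ determines $G$ if the restriction map $\widehat G\to\widehat D$, $h\mapsto h|D$ (which is always a continuous group isomorphism) is a homeomorphism. $G$ is determined if every dense subgroup of $G$ determines $G$. $w(G)$ is the weight of $G$ (least cardinality of a base of the topology). $\mathrm{non}(\mathcal N)$ is the least cardinality of a subset of $\mathbb T$ that does not have Haar (Lebesgue) measure zero, i.e. that has positive outer Haar measure. *)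

theory Defs
  imports "HOL-Analysis.Analysis"
begin

unbundle cardinal_syntax

section \<open>The circle group\<close>

typedef circle = "{- (1 / 2) <.. 1 / 2 :: real}"
  morphisms rep_circle abs_circle
  by (rule exI[of _ 0]) simp

setup_lifting type_definition_circle

text \<open>The representative in \<open>(-1/2, 1/2]\<close> of the class of \<open>t\<close> modulo 1.\<close>

definition red :: "real \<Rightarrow> real" where
  "red t = t - of_int \<lceil>t - 1 / 2\<rceil>"

lemma red_bounds: "- (1 / 2) < red t" "red t \<le> 1 / 2"
  unfolding red_def by linarith+

lemma red_in: "red t \<in> {- (1 / 2) <.. 1 / 2}"
  using red_bounds[of t] by simp

lemma red_add_int: "red (t + of_int n) = red t"
  unfolding red_def by (simp add: algebra_simps ceiling_add_of_int[symmetric])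
    (metis (no_types, opaque_lifting) add.commute add_diff_eq ceiling_add_of_int of_int_add)

lemma red_id: "t \<in> {- (1 / 2) <.. 1 / 2} \<Longrightarrow> red t = t"
proof -
  assume "t \<in> {- (1 / 2) <.. 1 / 2}"
  then have "\<lceil>t - 1 / 2\<rceil> = 0" by (simp add: ceiling_eq_iff)
  then show ?thesis by (simp add: red_def)
qed

lemma red_eq_int: "\<exists>n. red t = t + of_int n"
  unfolding red_def by (rule exI[of _ "- \<lceil>t - 1 / 2\<rceil>"]) simp

lemma red_add_red [simp]: "red (red s + t) = red (s + t)" "red (t + red s) = red (t + s)"
  using red_eq_int[of s] red_add_int[of "s + t"]
  by (auto simp: ac_simps)

lemma red_uminus_red [simp]: "red (- red s) = red (- s)"
proof -
  obtain n where "red s = s + of_int n" using red_eq_int by blast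
  then have "- red s = - s + of_int (- n)" by simp
  then show ?thesis by (metis red_add_int)
qed

lemma abs_red_le: "\<bar>red t\<bar> \<le> \<bar>t\<bar>"
proof (cases "t \<in> {- (1 / 2) <.. 1 / 2}")
  case True
  then show ?thesis by (simp add: red_id)
next
  case False
  then have "1 / 2 \<le> \<bar>t\<bar>" by (auto simp: abs_if)
  with red_bounds[of t] show ?thesis by linarith
qed

instantiation circle :: ab_group_add
begin

lift_definition zero_circle :: circle is 0 by simp

lift_definition plus_circle :: "circle \<Rightarrow> circle \<Rightarrow> circle" is "\<lambda>x y. red (x + y)"
  by (rule red_in)

lift_definition uminus_circle :: "circle \<Rightarrow> circle" is "\<lambda>x. red (- x)"
  by (rule red_in)

definition minus_circle :: "circle \<Rightarrow> circle \<Rightarrow> circle" where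
  "minus_circle x y = x + (- y)"

instance
proof
  fix a b c :: circle
  show "a + b + c = a + (b + c)" by transfer (simp add: ac_simps)
  show "a + b = b + a" by transfer (simp add: ac_simps)
  show "0 + a = a" by transfer (simp add: red_id)
  show "- a + a = 0" by transfer (simp add: red_id)
  show "a - b = a + - b" by (simp add: minus_circle_def)
qed

end

lemma rep_circle_bounds: "- (1 / 2) < rep_circle x" "rep_circle x \<le> 1 / 2"
  using rep_circle[of x] by simp_all

lemma rep_circle_zero [simp]: "rep_circle 0 = 0"
  by (rule zero_circle.rep_eq)

lemma abs_rep_circle_add: "\<bar>rep_circle (x + y)\<bar> \<le> \<bar>rep_circle x\<bar> + \<bar>rep_circle y\<bar>"
  unfolding plus_circle.rep_eq
  by (rule order_trans[OF abs_red_le abs_triangle_ineq])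

lemma abs_rep_circle_uminus: "\<bar>rep_circle (- x)\<bar> = \<bar>rep_circle x\<bar>"
proof (rule antisym)
  have le: "\<bar>rep_circle (- y)\<bar> \<le> \<bar>rep_circle y\<bar>" for y
    unfolding uminus_circle.rep_eq using abs_red_le[of "- rep_circle y"] by simp
  show "\<bar>rep_circle (- x)\<bar> \<le> \<bar>rep_circle x\<bar>" by (rule le)
  show "\<bar>rep_circle x\<bar> \<le> \<bar>rep_circle (- x)\<bar>" using le[of "- x"] by simp
qed

text \<open>The usual topology is given by the arc length metric: the distance of \<open>x\<close> and \<open>y\<close> is the
  distance of the real number \<open>x - y\<close> to the nearest integer.\<close>

instantiation circle :: metric_space
begin

definition dist_circle :: "circle \<Rightarrow> circle \<Rightarrow> real" where
  "dist_circle x y = \<bar>rep_circle (x - y)\<bar>"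

definition uniformity_circle :: "(circle \<times> circle) filter" where
  "uniformity_circle = (INF e\<in>{0<..}. principal {(x, y). dist x y < e})"

definition open_circle :: "circle set \<Rightarrow> bool" where
  "open_circle U \<longleftrightarrow> (\<forall>x\<in>U. eventually (\<lambda>(x', y). x' = x \<longrightarrow> y \<in> U) uniformity)"

instance
proof
  fix x y z :: circle
  show "dist x y = 0 \<longleftrightarrow> x = y"
    unfolding dist_circle_def
    by (metis abs_eq_0 eq_iff_diff_eq_0 rep_circle_inject rep_circle_zero)
  have "x - y = (x - z) + - (y - z)" by simp
  then show "dist x y \<le> dist x z + dist y z"
    unfolding dist_circle_def by (metis abs_rep_circle_add abs_rep_circle_uminus)
qed (simp_all add: uniformity_circle_def open_circle_def)

end

lemma dist_circle_add: "dist (a + b) (c + d) \<le> dist a c + dist (b :: circle) d"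
proof -
  have "(a + b) - (c + d) = (a - c) + (b - d)" by simp
  then show ?thesis unfolding dist_circle_def by (metis abs_rep_circle_add)
qed

lemma dist_circle_uminus: "dist (- a) (- b) = dist a (b :: circle)"
proof -
  have "- a - - b = - (a - b)" by simp
  then show ?thesis unfolding dist_circle_def by (metis abs_rep_circle_uminus)
qed

instance circle :: topological_ab_group_add
proof
  fix a b :: circle
  show "((\<lambda>x. fst x + snd x) \<longlongrightarrow> a + b) (nhds a \<times>\<^sub>F nhds b)"
  proof (rule tendstoI)
    fix e :: real
    assume "0 < e"
    have "eventually (\<lambda>x. dist x a < e / 2) (nhds a)" "eventually (\<lambda>x. dist x b < e / 2) (nhds b)"
      using \<open>0 < e\<close> by (auto simp: eventually_nhds_metric intro: exI[of _ "e / 2"])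
    then have "eventually (\<lambda>x. dist (fst x) a < e / 2 \<and> dist (snd x) b < e / 2) (nhds a \<times>\<^sub>F nhds b)"
      unfolding eventually_prod_filter by (intro exI conjI) auto
    then show "eventually (\<lambda>x. dist (fst x + snd x) (a + b) < e) (nhds a \<times>\<^sub>F nhds b)"
    proof eventually_elim
      case (elim x)
      then show ?case using dist_circle_add[of "fst x" "snd x" a b] by linarith
    qed
  qed
  show "(uminus \<longlongrightarrow> - a) (nhds a)"
    by (rule tendstoI) (auto simp: dist_circle_uminus eventually_nhds_metric)
qed


section \<open>Dual groups and determining subgroups\<close>

text \<open>Subgroups \<open>H\<close> of a topological group are given by their carrier set and carry the subspace
  topology; the whole group is \<^term>\<open>UNIV\<close>.\<close>

definition add_subgroup :: "'a::group_add set \<Rightarrow> bool" where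
  "add_subgroup H \<longleftrightarrow> 0 \<in> H \<and> (\<forall>x\<in>H. \<forall>y\<in>H. x + y \<in> H) \<and> (\<forall>x\<in>H. - x \<in> H)"

text \<open>Characters are extensional, so that a character of \<open>H\<close> is determined by its values on \<open>H\<close>.\<close>

definition characters :: "'a::topological_ab_group_add set \<Rightarrow> ('a \<Rightarrow> circle) set" where
  "characters H =
     {h \<in> extensional H. continuous_on H h \<and> (\<forall>x\<in>H. \<forall>y\<in>H. h (x + y) = h x + h y)}"

text \<open>The underlying space of the dual group of \<open>H\<close>. Taking \<open>K\<close> empty shows that the sets below
  cover \<^term>\<open>characters H\<close>.\<close>

definition dual :: "'a::topological_ab_group_add set \<Rightarrow> ('a \<Rightarrow> circle) topology" where
  "dual H =
     topology_generated_by {{h \<in> characters H. h ` K \<subseteq> U} | K U. K \<subseteq> H \<and> compact K \<and> open U}"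

lemma topspace_dual: "topspace (dual H) = characters H"
proof -
  have "{h \<in> characters H. h ` {} \<subseteq> {}} \<in>
      {{h \<in> characters H. h ` K \<subseteq> U} | K U. K \<subseteq> H \<and> compact K \<and> open U}"
    by blast
  then show ?thesis
    unfolding dual_def topology_generated_by_topspace by blast
qed

definition determines :: "'a::topological_ab_group_add set \<Rightarrow> 'a set \<Rightarrow> bool" where
  "determines D G \<longleftrightarrow> homeomorphic_map (dual G) (dual D) (\<lambda>h. restrict h D)"

definition determined :: "'a::topological_ab_group_add set \<Rightarrow> bool" where
  "determined G \<longleftrightarrow>
     (\<forall>D. add_subgroup D \<and> D \<subseteq> G \<and> G \<subseteq> closure D \<longrightarrow> determines D G)"


section \<open>Cardinal invariants\<close>

definition least_card :: "'a set set \<Rightarrow> 'a rel" where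
  "least_card F = |SOME A. A \<in> F \<and> (\<forall>B\<in>F. |A| \<le>o |B| )|"

lemma least_card:
  assumes "F \<noteq> {}"
  shows "\<exists>A\<in>F. least_card F = |A| \<and> (\<forall>B\<in>F. |A| \<le>o |B| )"
proof -
  have "\<exists>r\<in>card_of ` F. \<forall>r'\<in>card_of ` F. r \<le>o r'"
    using assms by (intro exists_minim_Card_order) (auto simp: card_of_Card_order)
  then have "\<exists>A. A \<in> F \<and> (\<forall>B\<in>F. |A| \<le>o |B| )" by blast
  from someI_ex[OF this] show ?thesis unfolding least_card_def by blast
qed

definition weight :: "'a::topological_space itself \<Rightarrow> 'a set rel" where
  "weight _ = least_card {B :: 'a set set. topological_basis B}"

text \<open>Haar measure on the circle is Lebesgue measure on \<open>(-1/2, 1/2]\<close>; since \<^term>\<open>lebesgue\<close> is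
  complete, the sets outside \<^term>\<open>null_sets lebesgue\<close> are those of positive outer measure.\<close>

definition non_null :: "circle rel" where
  "non_null = least_card {A :: circle set. rep_circle ` A \<notin> null_sets lebesgue}"

abbreviation aleph1 :: "nat set rel" where
  "aleph1 \<equiv> cardSuc natLeq"

end

theory Submission
  imports Defs "HOL-Library.Function_Algebras"
begin

text \<open>
Characters separate the points of a compact group \<open>G\<close>, so \<open>G\<close> has a countable base exactly when
it has only countably many characters. The proof therefore compares two situations.

\<^emph>\<open>Countable base.\<close> Let \<open>D\<close> be a dense subgroup and \<open>V\<^sub>n\<close> a sequence of neighbourhoods shrinking
to \<open>0\<close>. Only finitely many characters stay within distance \<open>1/4\<close> of \<open>0\<close> on \<open>V\<^sub>n\<close>; for each of them
that does not yet do so on the larger set \<open>V\<^sub>n\<^sub>-\<^sub>1\<close>, pick a witness in \<open>V\<^sub>n\<^sub>-\<^sub>1 \<inter> D\<close>. The witnesses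
converge to \<open>0\<close>, so together with \<open>0\<close> they form a compact subset of \<open>D\<close>, and no nonzero character is
small on it (\<open>compact_test_set\<close>). Hence the dual of \<open>D\<close> is discrete like that of \<open>G\<close>, and
the restriction map is bijective because characters of \<open>D\<close> extend to \<open>G\<close> (\<open>character_extends\<close>).

\<^emph>\<open>Uncountably many characters.\<close> The dual of \<open>G\<close> contains an uncountable set \<open>Z\<close> that is independent
over the integers or over the field with \<open>p\<close> elements (\<open>uncountable_indep\<close>). Take a countable group
\<open>D\<close> of functions on the circle: all \<open>t \<mapsto> k t\<close> in the first case, all combinations of base \<open>p\<close>
digits in the second. Its members are orthogonal as functions into the unit circle, so the set of points at
which an injective sequence from \<open>D\<close> tends to \<open>0\<close> has measure zero (\<open>convergence_set_null\<close>).
Consequently no injective sequence from \<open>D\<close> tends to \<open>0\<close> on a given non-null set, and this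
remains true on a suitable independent subset \<open>Y\<close> of it (\<open>nonnull_selection\<close>). If
\<open>non(\<N>) = \<aleph>\<^sub>1\<close>, then \<open>Y\<close> can be chosen so small that it injects into \<open>Z\<close>; this gives a homomorphism
\<open>G \<rightarrow> T\<^sup>Y\<close>. By independence and compactness, its image contains every function of \<open>D\<close> restricted to
\<open>Y\<close>, and the preimage \<open>E\<close> of \<open>D\<close> is dense in \<open>G\<close>; both facts rest on a form of
Kronecker's approximation theorem (\<open>Kronecker_independent\<close>). A compact subset \<open>K\<close> of \<open>E\<close> involves only
finitely many members of \<open>D\<close>, as otherwise they would contain a nontrivial convergent sequence
(\<open>compact_finite\<close>). So \<open>K\<close> cannot tell apart infinitely many characters up to a given error: some nonzero
character of \<open>G\<close> is small on \<open>K\<close>. Thus the dual of \<open>E\<close> is not discrete, and \<open>E\<close> does not determine \<open>G\<close>.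

\<^emph>\<open>Separation of points\<close> (\<open>characters_separate_0\<close>) is obtained from Fourier analysis on the finite groups
\<open>(\<int>/N)\<^sup>S\<close>, where \<open>S\<close> is a finite subset of \<open>G\<close>. Parseval's identity provides a character of \<open>(\<int>/N)\<^sup>S\<close>
that is an approximate character on \<open>S\<close>, nontrivial at a prescribed point and with a
modulus of continuity that does not depend on \<open>S\<close>; a limit along larger and larger \<open>S\<close> exists by
Tychonoff's theorem and is a continuous character.
\<close>

section \<open>Integer multiples in Abelian groups\<close>

text \<open>Writing \<open>k\<close> as the difference of its positive and its negative part makes the multiple additive in
\<open>x\<close> for both signs at once.\<close>

definition zmul :: "int \<Rightarrow> 'a::ab_group_add \<Rightarrow> 'a"  (infixr "\<odot>" 75) where
  "k \<odot> x = (\<Sum>i<nat k. x) - (\<Sum>i<nat (- k). x)"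

lemma zmul_diff: "int m - int n = k \<Longrightarrow> k \<odot> x = (\<Sum>i<m. x) - (\<Sum>i<n. x)"
proof -
  have add: "(\<Sum>i<a + b. x) = (\<Sum>i<a. x) + (\<Sum>i<b. x)" for a b :: nat
    by (induction b) (simp_all add: add.assoc)
  assume k: "int m - int n = k"
  then have "nat k + n = m + nat (- k)" by linarith
  then have "(\<Sum>i<nat k. x) + (\<Sum>i<n. x) = (\<Sum>i<m. x) + (\<Sum>i<nat (- k). x)"
    by (metis add)
  then show ?thesis unfolding zmul_def by (simp add: algebra_simps)
qed

lemma zmul_0_left [simp]: "0 \<odot> x = 0" and zmul_1 [simp]: "1 \<odot> x = x"
  unfolding zmul_def by simp_all

lemma zmul_add_right: "k \<odot> (x + y) = k \<odot> x + k \<odot> y"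
  unfolding zmul_def by (simp add: sum.distrib)

lemma zmul_add_left: "(k + l) \<odot> x = k \<odot> x + l \<odot> x"
proof -
  have add: "(\<Sum>i<a + b. x) = (\<Sum>i<a. x) + (\<Sum>i<b. x)" for a b :: nat
    by (induction b) (simp_all add: add.assoc)
  have "int (nat k + nat l) - int (nat (- k) + nat (- l)) = k + l" by simp
  from zmul_diff[OF this, of x] show ?thesis
    by (simp add: zmul_def add algebra_simps)
qed

lemma zmul_0_right [simp]: "k \<odot> (0 :: 'a::ab_group_add) = 0"
  by (simp add: zmul_def)

lemma zmul_minus_left [simp]: "(- k) \<odot> x = - (k \<odot> x)"
  unfolding zmul_def by simp

lemma zmul_minus_right [simp]: "k \<odot> (- x) = - (k \<odot> x)"
  using zmul_add_right[of k x "- x"] by (simp add: eq_neg_iff_add_eq_0 add.commute)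

lemma zmul_assoc: "k \<odot> (l \<odot> x) = (k * l) \<odot> x"
proof -
  have nat: "int n \<odot> (l \<odot> x) = (int n * l) \<odot> x" for n
    by (induction n) (simp_all add: zmul_add_left algebra_simps)
  show ?thesis
  proof (cases "0 \<le> k")
    case True
    then show ?thesis using nat[of "nat k"] by simp
  next
    case False
    then have "(- k) \<odot> (l \<odot> x) = (- k * l) \<odot> x" using nat[of "nat (- k)"] by simp
    then show ?thesis by simp
  qed
qed

interpretation Z: module zmul
  by standard (simp_all add: zmul_add_left zmul_add_right zmul_assoc)

lemma zmul_fun_apply [simp]: "(k \<odot> f) x = k \<odot> f x"
proof -
  have "(\<Sum>i<n. f) x = (\<Sum>i<n. f x)" for n :: nat by (induction n) simp_all
  then show ?thesis by (simp add: zmul_def)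
qed

lemma zmul_hom:
  assumes A: "add_subgroup A" and h: "\<And>x y. x \<in> A \<Longrightarrow> y \<in> A \<Longrightarrow> h (x + y) = h x + h y" and x: "x \<in> A"
  shows "k \<odot> x \<in> A \<and> h (k \<odot> x) = k \<odot> h x"
proof -
  have 0: "0 \<in> A" "h 0 = 0" using A h[of 0 0] by (auto simp: add_subgroup_def)
  have nat: "int n \<odot> x \<in> A \<and> h (int n \<odot> x) = int n \<odot> h x" for n
    using A 0 x by (induction n) (auto simp: zmul_add_left h add_subgroup_def)
  have neg: "- y \<in> A \<and> h (- y) = - h y" if "y \<in> A" for y
    using A 0 that h[of y "- y"] by (auto simp: add_subgroup_def eq_neg_iff_add_eq_0 add.commute)
  show ?thesis
  proof (cases "0 \<le> k")
    case True
    then show ?thesis using nat[of "nat k"] by simp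
  next
    case False
    then show ?thesis using neg[of "(- k) \<odot> x"] nat[of "nat (- k)"] by simp
  qed
qed

lemma add_subgroup_span: "add_subgroup (Z.span B)"
  by (auto simp: add_subgroup_def Z.span_zero Z.span_add Z.span_neg)

lemma span_subset_subgroup:
  assumes "add_subgroup A" "B \<subseteq> A" shows "Z.span B \<subseteq> A"
proof -
  have "Z.subspace A"
    using assms(1) zmul_hom[OF assms(1), of "\<lambda>x. x"] by (auto simp: Z.subspace_def add_subgroup_def)
  then show ?thesis using assms(2) by (rule Z.span_minimal[rotated])
qed

lemma countable_span:
  assumes "countable B" shows "countable (Z.span B)"
proof -
  define S where "S = lists (UNIV \<times> B :: (int \<times> _) set)"
  have "countable S" unfolding S_def using assms by (intro countable_lists) auto
  moreover have "Z.span B \<subseteq> (\<lambda>xs. \<Sum>(k, x)\<leftarrow>xs. k \<odot> x) ` S"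
  proof (rule Z.span_minimal)
    show "B \<subseteq> (\<lambda>xs. \<Sum>(k, x)\<leftarrow>xs. k \<odot> x) ` S"
    proof
      fix b assume "b \<in> B"
      then show "b \<in> (\<lambda>xs. \<Sum>(k, x)\<leftarrow>xs. k \<odot> x) ` S"
        by (intro image_eqI[of _ _ "[(1, b)]"]) (auto simp: S_def)
    qed
    show "Z.subspace ((\<lambda>xs. \<Sum>(k, x)\<leftarrow>xs. k \<odot> x) ` S)"
      unfolding Z.subspace_def
    proof (intro conjI ballI allI)
      show "0 \<in> (\<lambda>xs. \<Sum>(k, x)\<leftarrow>xs. k \<odot> x) ` S"
        by (intro image_eqI[of _ _ "[]"]) (auto simp: S_def)
      fix x y assume "x \<in> (\<lambda>xs. \<Sum>(k, x)\<leftarrow>xs. k \<odot> x) ` S" "y \<in> (\<lambda>xs. \<Sum>(k, x)\<leftarrow>xs. k \<odot> x) ` S"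
      then obtain xs ys where "xs \<in> S" "ys \<in> S" "x = (\<Sum>(k, x)\<leftarrow>xs. k \<odot> x)" "y = (\<Sum>(k, x)\<leftarrow>ys. k \<odot> x)" by blast
      then show "x + y \<in> (\<lambda>xs. \<Sum>(k, x)\<leftarrow>xs. k \<odot> x) ` S"
        by (intro image_eqI[of _ _ "xs @ ys"]) (auto simp: S_def)
    next
      fix c :: int and x assume "x \<in> (\<lambda>xs. \<Sum>(k, x)\<leftarrow>xs. k \<odot> x) ` S"
      then obtain xs where xs: "xs \<in> S" "x = (\<Sum>(k, x)\<leftarrow>xs. k \<odot> x)" by blast
      have "c \<odot> (\<Sum>(k, x)\<leftarrow>xs. k \<odot> x) = (\<Sum>(k, x)\<leftarrow>map (\<lambda>(k, x). (c * k, x)) xs. k \<odot> x)" for xs :: "(int \<times> 'a) list"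
        by (induction xs) (auto simp: zmul_add_right zmul_assoc)
      with xs show "c \<odot> x \<in> (\<lambda>xs. \<Sum>(k, x)\<leftarrow>xs. k \<odot> x) ` S"
        by (intro image_eqI[of _ _ "map (\<lambda>(k, x). (c * k, x)) xs"]) (auto simp: S_def)
    qed
  qed
  ultimately show ?thesis by (metis countable_image countable_subset)
qed

section \<open>The circle as the unit circle of the complex plane\<close>

definition to_circle :: "real \<Rightarrow> circle" where
  "to_circle t = abs_circle (red t)"

lemma rep_to_circle: "rep_circle (to_circle t) = red t"
  unfolding to_circle_def using red_in by (simp add: abs_circle_inverse)

lemma to_circle_rep [simp]: "to_circle (rep_circle x) = x"
  using rep_circle[of x] by (simp add: to_circle_def red_id rep_circle_inverse)

lemma to_circle_add: "to_circle (s + t) = to_circle s + to_circle t"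
  by (simp add: rep_circle_inject[symmetric] plus_circle.rep_eq rep_to_circle)

lemma to_circle_eq_0_iff: "to_circle t = 0 \<longleftrightarrow> t \<in> \<int>"
proof -
  have "to_circle t = 0 \<longleftrightarrow> red t = 0" by (metis rep_circle_inject rep_circle_zero rep_to_circle)
  also have "\<dots> \<longleftrightarrow> t \<in> \<int>"
  proof
    assume "red t = 0"
    then show "t \<in> \<int>" unfolding red_def by (metis Ints_of_int eq_iff_diff_eq_0)
  next
    assume "t \<in> \<int>"
    then obtain n where "t = of_int n" by (auto elim: Ints_cases)
    then show "red t = 0" using red_add_int[of 0 n] by (simp add: red_id)
  qed
  finally show ?thesis .
qed

lemma to_circle_0 [simp]: "to_circle 0 = 0"
  by (simp add: to_circle_eq_0_iff)

lemma to_circle_minus: "to_circle (- t) = - to_circle t"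
  using to_circle_add[of t "- t"] by (simp add: eq_neg_iff_add_eq_0 add.commute)

lemma to_circle_diff: "to_circle (s - t) = to_circle s - to_circle t"
  using to_circle_add[of s "- t"] by (simp add: to_circle_minus)

lemma to_circle_zmul: "to_circle (of_int k * t) = k \<odot> to_circle t"
proof -
  have "add_subgroup (UNIV :: real set)" by (simp add: add_subgroup_def)
  from zmul_hom[OF this, of to_circle t k] have "to_circle (k \<odot> t) = k \<odot> to_circle t"
    by (simp add: to_circle_add)
  moreover have "k \<odot> t = of_int k * t" by (cases "0 \<le> k") (simp_all add: zmul_def)
  ultimately show ?thesis by simp
qed

lemma to_circle_add_int [simp]: "to_circle (t + of_int n) = to_circle t"
  by (simp add: to_circle_def red_add_int)

lemma dist_circle_0: "dist x (0 :: circle) = \<bar>rep_circle x\<bar>"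
  by (simp add: dist_circle_def)

lemma dist_circle_diff: "dist x y = dist (x - y) (0 :: circle)"
  by (simp add: dist_circle_def)

lemma dist_to_circle: "dist (to_circle s) (to_circle t) \<le> \<bar>s - t\<bar>"
  using abs_red_le[of "s - t"] by (simp add: dist_circle_def to_circle_diff[symmetric] rep_to_circle)

lemma continuous_to_circle: "continuous_on A to_circle"
  unfolding continuous_on_iff
  by (metis dist_real_def dist_to_circle order_le_less_trans)

lemma compact_circle: "compact (UNIV :: circle set)"
proof -
  have "x \<in> to_circle ` {- (1 / 2) .. 1 / 2}" for x
    using rep_circle_bounds[of x] by (intro image_eqI[of _ _ "rep_circle x"]) auto
  then have "UNIV = to_circle ` {- (1 / 2) .. 1 / 2}" by blast
  then show ?thesis
    by (metis compact_continuous_image compact_Icc continuous_to_circle)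
qed

definition e_circle :: "circle \<Rightarrow> complex" where
  "e_circle x = cis (2 * pi * rep_circle x)"

lemma cis_int: "cis (2 * pi * of_int n) = 1"
  by (metis cis_multiple_2pi Ints_of_int)

lemma e_to_circle: "e_circle (to_circle t) = cis (2 * pi * t)"
proof -
  obtain n where "red t = t + of_int n" using red_eq_int by blast
  then show ?thesis by (simp add: e_circle_def rep_to_circle distrib_left cis_mult[symmetric] cis_int)
qed

lemma e_add: "e_circle (x + y) = e_circle x * e_circle y"
proof -
  have "e_circle (to_circle (rep_circle x + rep_circle y)) = e_circle x * e_circle y"
    by (simp only: e_to_circle) (simp add: e_circle_def cis_mult distrib_left)
  then show ?thesis by (simp add: to_circle_add)
qed

lemma norm_e [simp]: "norm (e_circle x) = 1"
  by (simp add: e_circle_def)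

lemma e_0 [simp]: "e_circle 0 = 1"
  by (simp add: e_circle_def)

lemma e_minus: "e_circle (- x) = cnj (e_circle x)"
proof -
  have "e_circle (- x) * e_circle x = 1" using e_add[of "- x" x] by simp
  moreover have "cnj (e_circle x) * e_circle x = 1"
    using complex_norm_square[of "e_circle x"] by (simp add: mult.commute)
  ultimately show ?thesis by (metis mult_cancel_right norm_e norm_zero zero_neq_one)
qed

lemma e_diff: "e_circle (x - y) = e_circle x * cnj (e_circle y)"
  using e_add[of x "- y"] by (simp add: e_minus)

lemma e_eq_1_iff: "e_circle x = 1 \<longleftrightarrow> x = 0"
proof
  assume "e_circle x = 1"
  then have "cos (2 * pi * rep_circle x) = 1" by (simp add: e_circle_def complex_eq_iff)
  then obtain n :: int where "2 * pi * rep_circle x = of_int n * 2 * pi"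
    using cos_one_2pi_int by blast
  then have "rep_circle x = of_int n" by simp
  with rep_circle_bounds[of x] have "n = 0" by linarith
  with \<open>rep_circle x = of_int n\<close> show "x = 0" by (metis of_int_0 rep_circle_inject rep_circle_zero)
qed simp

lemma e_inject: "e_circle x = e_circle y \<longleftrightarrow> x = y"
proof -
  have "e_circle x = e_circle y \<longleftrightarrow> e_circle (x - y) = 1"
  proof
    assume "e_circle (x - y) = 1"
    then show "e_circle x = e_circle y" using e_add[of "x - y" y] by simp
  next
    assume "e_circle x = e_circle y"
    then show "e_circle (x - y) = 1" using e_diff[of y y] by (simp add: e_diff)
  qed
  then show ?thesis by (simp add: e_eq_1_iff)
qed

lemma e_sum: "e_circle (sum f I) = (\<Prod>i\<in>I. e_circle (f i))"
  by (induction I rule: infinite_finite_induct) (simp_all add: e_add)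

lemma e_of_nat: "e_circle (int n \<odot> x) = e_circle x ^ n"
  by (induction n) (simp_all add: zmul_add_left e_add)

lemma dist_e_le: "dist (e_circle x) (e_circle y) \<le> 2 * pi * dist x y"
proof -
  have "norm (e_circle x - e_circle y) = norm (e_circle (x - y) - 1)"
  proof -
    have "e_circle x - e_circle y = (e_circle (x - y) - 1) * e_circle y"
      using e_add[of "x - y" y] by (simp add: algebra_simps)
    then show ?thesis by (simp add: norm_mult)
  qed
  also have "\<dots> \<le> \<bar>2 * pi * rep_circle (x - y)\<bar>"
  proof -
    define t where "t = 2 * pi * rep_circle (x - y)"
    have "norm (cis t - 1) = 2 * \<bar>sin (t / 2)\<bar>"
    proof -
      have "(norm (cis t - 1))\<^sup>2 = (cos t - 1)\<^sup>2 + (sin t)\<^sup>2" by (simp add: cmod_power2)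
      also have "\<dots> = 2 - 2 * cos t"
        using sin_cos_squared_add[of t] by (simp add: power2_eq_square algebra_simps)
      also have "\<dots> = (2 * \<bar>sin (t / 2)\<bar>)\<^sup>2"
        using cos_double_sin[of "t / 2"] by (simp add: power_mult_distrib)
      finally have "(norm (cis t - 1))\<^sup>2 = (2 * \<bar>sin (t / 2)\<bar>)\<^sup>2" .
      then show ?thesis by (rule power2_eq_imp_eq) simp_all
    qed
    also have "\<dots> \<le> \<bar>t\<bar>" using abs_sin_x_le_abs_x[of "t / 2"] by simp
    finally show ?thesis by (simp add: t_def e_circle_def)
  qed
  also have "\<dots> = 2 * pi * dist x y" by (simp add: dist_circle_def abs_mult)
  finally show ?thesis by (simp add: dist_norm)
qed

lemma continuous_e: "continuous_on A e_circle"
  unfolding continuous_on_iff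
proof (intro ballI allI impI)
  fix x and \<epsilon> :: real assume "0 < \<epsilon>"
  then show "\<exists>d>0. \<forall>x'\<in>A. dist x' x < d \<longrightarrow> dist (e_circle x') (e_circle x) < \<epsilon>"
    by (intro exI[of _ "\<epsilon> / (2 * pi)"])
      (auto simp: field_simps intro!: order_le_less_trans[OF dist_e_le])
qed

text \<open>\<open>e_circle\<close> is a homeomorphism onto its image: on the compact set of points at distance at least
\<open>\<epsilon>\<close> from \<open>0\<close>, the distance of \<open>e_circle x\<close> to \<open>1\<close> is bounded away from zero.\<close>

lemma dist_0_small:
  assumes "0 < \<epsilon>"
  obtains \<delta> where "0 < \<delta>" "\<And>x. norm (e_circle x - 1) < \<delta> \<Longrightarrow> dist x 0 < \<epsilon>"
proof (cases "\<exists>x :: circle. \<epsilon> \<le> dist x 0")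
  case True
  define F where "F = {x :: circle. \<epsilon> \<le> dist x 0}"
  have "closed F" unfolding F_def by (intro closed_Collect_le continuous_intros)
  then have "compact F" using compact_Int_closed[OF compact_circle] by simp
  moreover have "continuous_on F (\<lambda>x. norm (e_circle x - 1))" by (intro continuous_intros continuous_e)
  ultimately obtain y where y: "y \<in> F" "\<And>x. x \<in> F \<Longrightarrow> norm (e_circle y - 1) \<le> norm (e_circle x - 1)"
    using continuous_attains_inf[of F "\<lambda>x. norm (e_circle x - 1)"] True by (auto simp: F_def)
  have "y \<noteq> 0" using y(1) assms by (auto simp: F_def)
  then have "0 < norm (e_circle y - 1)" by (simp add: e_eq_1_iff)
  then show ?thesis
    by (rule that) (use y(2) in \<open>force simp: F_def not_less[symmetric]\<close>)
next
  case False
  then show ?thesis by (intro that[of 1]) (auto simp: not_le)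
qed

lemma continuous_hom:
  fixes h :: "'a::topological_ab_group_add \<Rightarrow> circle"
  assumes hom: "\<And>x y. h (x + y) = h x + h y"
    and V: "\<And>\<epsilon>. 0 < \<epsilon> \<Longrightarrow> \<exists>V. open V \<and> 0 \<in> V \<and> (\<forall>v\<in>V. dist (h v) 0 < \<epsilon>)"
  shows "continuous_on UNIV h"
  unfolding continuous_on_topological
proof (intro ballI allI impI)
  fix x B assume "open B" "h x \<in> B"
  then obtain \<epsilon> where \<epsilon>: "0 < \<epsilon>" "\<And>y. dist y (h x) < \<epsilon> \<Longrightarrow> y \<in> B" unfolding open_dist by blast
  obtain V where V: "open V" "0 \<in> V" "\<And>v. v \<in> V \<Longrightarrow> dist (h v) 0 < \<epsilon>" using V[OF \<epsilon>(1)] by blast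
  have "open ((\<lambda>y. y - x) -` V)"
    by (intro continuous_open_vimage continuous_intros V(1))
  moreover have "h y \<in> B" if "y - x \<in> V" for y
  proof (rule \<epsilon>(2))
    have "h y - h x = h (y - x)" using hom[of "y - x" x] by simp
    then show "dist (h y) (h x) < \<epsilon>" using V(3)[OF that] by (metis dist_circle_diff)
  qed
  ultimately show "\<exists>A. open A \<and> x \<in> A \<and> (\<forall>y\<in>UNIV. y \<in> A \<longrightarrow> h y \<in> B)"
    using V(2) by (intro exI[of _ "(\<lambda>y. y - x) -` V"]) auto
qed

section \<open>Enough characters on a compact group\<close>

lemma compact_group_uniform:
  fixes f :: "'a::topological_ab_group_add \<Rightarrow> 'b::metric_space"
  assumes "compact (UNIV :: 'a set)" "continuous_on UNIV f" "0 < \<epsilon>"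
  obtains V where "open V" "0 \<in> V" "\<And>v z. v \<in> V \<Longrightarrow> dist (f (z + v)) (f z) \<le> \<epsilon>"
proof -
  have "continuous_on (UNIV \<times> UNIV) (\<lambda>(v, z). f (z + v))"
    unfolding split_beta by (intro continuous_on_compose2[OF assms(2)] continuous_intros) auto
  then obtain V where V: "0 \<in> V" "open V"
    and le: "\<forall>v\<in>V \<inter> UNIV. \<forall>z\<in>UNIV.
      dist ((\<lambda>(v, z). f (z + v)) (v, z)) ((\<lambda>(v, z). f (z + v)) (0, z)) \<le> \<epsilon>"
    by (rule continuous_on_prod_compactE[OF _ assms(1) UNIV_I assms(3)])
  show ?thesis
    by (rule that[OF V(2,1)]) (use le in simp)
qed

text \<open>A substitute for integration over \<open>G\<close>. Finitely many translates of \<open>{f > f z0 / 2}\<close> cover \<open>G\<close>,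
so the corresponding sums add up to at least \<open>card B * f z0 / 2\<close> and one of them is at least their
average. What matters is that \<open>c\<close> does not depend on \<open>B\<close>.\<close>

lemma translate_average_bound:
  fixes f :: "'a::topological_ab_group_add \<Rightarrow> real"
  assumes cpt: "compact (UNIV :: 'a set)" and f: "continuous_on UNIV f" "\<And>z. 0 \<le> f z" "0 < f z0"
  obtains c :: real where "0 < c"
    "\<And>(B :: ('a \<Rightarrow> nat) set) pos. finite B \<Longrightarrow> \<exists>\<tau>. c * card B \<le> (\<Sum>x\<in>B. f (pos x + \<tau>))"
proof -
  define O' where "O' \<tau> = {z. f z0 / 2 < f (z + \<tau>)}" for \<tau>
  have "open (O' \<tau>)" for \<tau>
    unfolding O'_def by (intro open_Collect_less continuous_on_compose2[OF f(1)] continuous_intros) auto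
  moreover have "UNIV \<subseteq> (\<Union>\<tau>. O' \<tau>)"
  proof
    fix z show "z \<in> (\<Union>\<tau>. O' \<tau>)"
      using f(3) by (intro UN_I[of "z0 - z"]) (auto simp: O'_def)
  qed
  ultimately obtain T where T: "finite T" "UNIV \<subseteq> (\<Union>\<tau>\<in>T. O' \<tau>)"
    using compactE_image[OF cpt, of UNIV O'] by auto
  then have card: "0 < card T" by (auto simp: card_gt_0_iff)
  define c where "c = f z0 / (2 * card T)"
  show ?thesis
  proof (rule that[of c])
    show "0 < c" using card f(3) by (simp add: c_def)
    fix B :: "('a \<Rightarrow> nat) set" and pos assume "finite B"
    show "\<exists>\<tau>. c * card B \<le> (\<Sum>x\<in>B. f (pos x + \<tau>))"
    proof (rule ccontr)
      assume "\<nexists>\<tau>. c * card B \<le> (\<Sum>x\<in>B. f (pos x + \<tau>))"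
      then have "(\<Sum>\<tau>\<in>T. \<Sum>x\<in>B. f (pos x + \<tau>)) < (\<Sum>\<tau>\<in>T. c * card B)"
        using T card by (intro sum_strict_mono) (auto simp: not_le)
      also have "\<dots> = (\<Sum>x\<in>B. f z0 / 2)" using card by (simp add: c_def)
      also have "\<dots> \<le> (\<Sum>x\<in>B. \<Sum>\<tau>\<in>T. f (pos x + \<tau>))"
      proof (rule sum_mono)
        fix x
        obtain \<tau> where "\<tau> \<in> T" "pos x \<in> O' \<tau>" using T(2) by blast
        then show "f z0 / 2 \<le> (\<Sum>\<tau>\<in>T. f (pos x + \<tau>))"
          using member_le_sum[of \<tau> T "\<lambda>\<tau>. f (pos x + \<tau>)"] f(2) T(1) by (auto simp: O'_def)
      qed
      also have "\<dots> = (\<Sum>\<tau>\<in>T. \<Sum>x\<in>B. f (pos x + \<tau>))" by (rule sum.swap)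
      finally show False by simp
    qed
  qed
qed

subsection \<open>Fourier analysis on a finite box\<close>

text \<open>The functions in \<open>grid S N\<close> represent both the group \<open>(\<int>/N)\<^sup>S\<close> and its dual, with \<open>pairing\<close> as the
duality between them; \<open>shift\<close> is translation in this group. The small boxes \<open>grid S m\<close> with \<open>m < N\<close>
serve as averaging sets.\<close>

definition grid :: "'s set \<Rightarrow> nat \<Rightarrow> ('s \<Rightarrow> nat) set" where
  "grid S N = (\<Pi>\<^sub>E s\<in>S. {..<N})"

definition pairing :: "'s set \<Rightarrow> nat \<Rightarrow> ('s \<Rightarrow> nat) \<Rightarrow> ('s \<Rightarrow> nat) \<Rightarrow> complex" where
  "pairing S N a k = e_circle (\<Sum>s\<in>S. to_circle (real (a s) * real (k s) / real N))"

definition unit_at :: "'s \<Rightarrow> 's \<Rightarrow> nat" where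
  "unit_at s = (\<lambda>t. if t = s then 1 else 0)"

definition shift :: "'s set \<Rightarrow> nat \<Rightarrow> ('s \<Rightarrow> nat) \<Rightarrow> ('s \<Rightarrow> nat) \<Rightarrow> ('s \<Rightarrow> nat)" where
  "shift S N h x = (\<lambda>s\<in>S. (x s + h s) mod N)"

lemma finite_grid: "finite S \<Longrightarrow> finite (grid S N)"
  unfolding grid_def by (rule finite_PiE) auto

lemma card_grid: "finite S \<Longrightarrow> card (grid S N) = N ^ card S"
  unfolding grid_def by (simp add: card_PiE)

lemma norm_pairing [simp]: "norm (pairing S N a k) = 1"
  by (simp add: pairing_def)

lemma pairing_add: "pairing S N a (k + l) = pairing S N a k * pairing S N a l"
  unfolding pairing_def e_add[symmetric] sum.distrib[symmetric] to_circle_add[symmetric]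
  by (simp add: add_divide_distrib distrib_left)

lemma pairing_unit_at:
  assumes "finite S" "s \<in> S"
  shows "pairing S N a (unit_at s) = e_circle (to_circle (real (a s) / real N))"
proof -
  have "(\<Sum>t\<in>S. to_circle (real (a t) * real (unit_at s t) / real N))
      = (\<Sum>t\<in>S. if t = s then to_circle (real (a t) / real N) else 0)"
    by (intro sum.cong) (auto simp: unit_at_def)
  with assms show ?thesis by (simp add: pairing_def)
qed

lemma pairing_shift:
  assumes "0 < N" shows "pairing S N a (shift S N h x) = pairing S N a h * pairing S N a x"
proof -
  have "to_circle (real (a s) * real ((x s + h s) mod N) / real N) =
      to_circle (real (a s) * real ((x + h) s) / real N)" for s
  proof -
    have "real (x s + h s) = real ((x s + h s) mod N) + real N * real ((x s + h s) div N)"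
      by (metis mod_mult_div_eq of_nat_add of_nat_mult)
    then have "real (a s) * real ((x + h) s) / real N =
        real (a s) * real ((x s + h s) mod N) / real N + of_int (int (a s * ((x s + h s) div N)))"
      using assms by (simp add: field_simps)
    then show ?thesis by (simp only: to_circle_add_int)
  qed
  then have "pairing S N a (shift S N h x) = pairing S N a (x + h)"
    unfolding pairing_def by (intro arg_cong[of _ _ e_circle] sum.cong) (auto simp: shift_def)
  then show ?thesis by (simp add: pairing_add mult.commute)
qed

lemma shift_bij:
  assumes S: "finite S" and N: "0 < N" shows "bij_betw (shift S N h) (grid S N) (grid S N)"
proof -
  have sub: "shift S N h ` grid S N \<subseteq> grid S N"
    using N by (auto simp: shift_def grid_def)
  have "inj_on (shift S N h) (grid S N)"
  proof (rule inj_onI)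
    fix x y assume xy: "x \<in> grid S N" "y \<in> grid S N" "shift S N h x = shift S N h y"
    show "x = y"
    proof (rule PiE_ext)
      show "x \<in> (\<Pi>\<^sub>E s\<in>S. {..<N})" "y \<in> (\<Pi>\<^sub>E s\<in>S. {..<N})" using xy by (auto simp: grid_def)
      fix s assume s: "s \<in> S"
      then have lt: "x s < N" "y s < N" using xy by (auto simp: grid_def)
      have "shift S N h x s = shift S N h y s" using xy(3) by simp
      then have eq: "(x s + h s) mod N = (y s + h s) mod N" using s by (simp add: shift_def)
      have cancel: "((n + h s) mod N + (N - h s mod N)) mod N = n" if "n < N" for n
      proof -
        have "((n + h s) mod N + (N - h s mod N)) mod N = (n + h s mod N + (N - h s mod N)) mod N"
          by (metis mod_add_left_eq mod_add_right_eq)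
        also have "n + h s mod N + (N - h s mod N) = n + N"
          using mod_less_divisor[OF N, of "h s"] by simp
        finally show ?thesis using that by simp
      qed
      show "x s = y s" using cancel[OF lt(1)] cancel[OF lt(2)] unfolding eq by (rule trans[OF sym])
    qed
  qed
  then show ?thesis
    unfolding bij_betw_def using endo_inj_surj[OF finite_grid[OF S] sub] by blast
qed

lemma sum_pairing_shift:
  assumes S: "finite S" and N: "0 < N"
  shows "(\<Sum>x\<in>grid S N. F (shift S N h x) * cnj (pairing S N a x)) =
    pairing S N a h * (\<Sum>x\<in>grid S N. F x * cnj (pairing S N a x))"
proof -
  have unit: "pairing S N a h * cnj (pairing S N a h) = 1"
    using complex_norm_square[of "pairing S N a h"] by simp
  have swap: "y * cnj x = pairing S N a h * (y * (cnj (pairing S N a h) * cnj x))" for x y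
  proof -
    have "pairing S N a h * (y * (cnj (pairing S N a h) * cnj x)) =
        (pairing S N a h * cnj (pairing S N a h)) * (y * cnj x)" by (simp only: mult_ac)
    with unit show ?thesis by simp
  qed
  have "(\<Sum>x\<in>grid S N. F (shift S N h x) * cnj (pairing S N a x)) =
      (\<Sum>x\<in>grid S N. pairing S N a h * (F (shift S N h x) * cnj (pairing S N a (shift S N h x))))"
    by (simp only: pairing_shift[OF N] complex_cnj_mult swap[symmetric])
  also have "\<dots> = pairing S N a h * (\<Sum>x\<in>grid S N. F (shift S N h x) * cnj (pairing S N a (shift S N h x)))"
    by (simp add: sum_distrib_left)
  also have "(\<Sum>x\<in>grid S N. F (shift S N h x) * cnj (pairing S N a (shift S N h x))) =
      (\<Sum>x\<in>grid S N. F x * cnj (pairing S N a x))"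
    by (rule sum.reindex_bij_betw[OF shift_bij[OF S N], of "\<lambda>y. F y * cnj (pairing S N a y)"])
  finally show ?thesis .
qed

lemma sum_roots_of_unity:
  fixes d :: int
  assumes "\<bar>d\<bar> < int N"
  shows "(\<Sum>j<N. e_circle (to_circle (real j * of_int d / real N))) = (if d = 0 then of_nat N else 0)"
proof (cases "d = 0")
  case False
  define z where "z = e_circle (to_circle (of_int d / real N))"
  have N: "0 < N" using assms by linarith
  have pow: "e_circle (to_circle (real j * of_int d / real N)) = z ^ j" for j
    using to_circle_zmul[of "int j" "of_int d / real N"] by (simp add: z_def e_of_nat[symmetric])
  have "z \<noteq> 1"
  proof
    assume "z = 1"
    then obtain n where n: "of_int d / real N = of_int n"
      by (auto simp: z_def e_eq_1_iff to_circle_eq_0_iff elim: Ints_cases)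
    then have "real_of_int d = of_int (n * int N)" using N by (simp add: field_simps)
    then have "d = n * int N" by (simp only: of_int_eq_iff)
    with assms False show False by (auto simp: abs_mult mult_less_cancel_right1)
  qed
  moreover have "z ^ N = 1"
  proof -
    have "z ^ N = e_circle (to_circle (of_int d))" using pow[of N] N by simp
    also have "to_circle (of_int d) = 0" by (simp add: to_circle_eq_0_iff)
    finally show ?thesis by simp
  qed
  ultimately show ?thesis using False by (simp add: pow geometric_sum)
qed simp

lemma pairing_orthogonal:
  assumes S: "finite S" and k: "k \<in> grid S N" "l \<in> grid S N"
  shows "(\<Sum>a\<in>grid S N. pairing S N a k * cnj (pairing S N a l)) = (if k = l then of_nat (N ^ card S) else 0)"
proof -
  have "(\<Sum>a\<in>grid S N. pairing S N a k * cnj (pairing S N a l)) =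
      (\<Sum>a\<in>grid S N. \<Prod>s\<in>S. e_circle (to_circle (real (a s) * of_int (int (k s) - int (l s)) / real N)))"
    unfolding pairing_def e_diff[symmetric] sum_subtractf[symmetric] to_circle_diff[symmetric]
    unfolding e_sum
    by (intro sum.cong prod.cong arg_cong[of _ _ e_circle] arg_cong[of _ _ to_circle])
      (auto simp: diff_divide_distrib right_diff_distrib)
  also have "\<dots> = (\<Prod>s\<in>S. \<Sum>j<N. e_circle (to_circle (real j * of_int (int (k s) - int (l s)) / real N)))"
    unfolding grid_def using S by (subst prod_sum_PiE) auto
  also have "\<dots> = (\<Prod>s\<in>S. if k s = l s then of_nat N else 0)"
  proof (intro prod.cong refl)
    fix s assume "s \<in> S"
    with k have "k s < N" "l s < N" by (auto simp: grid_def PiE_iff)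
    then have "\<bar>int (k s) - int (l s)\<bar> < int N" by linarith
    from sum_roots_of_unity[OF this]
    show "(\<Sum>j<N. e_circle (to_circle (real j * of_int (int (k s) - int (l s)) / real N))) =
        (if k s = l s then of_nat N else 0)" by simp
  qed
  also have "\<dots> = (if k = l then of_nat (N ^ card S) else 0)"
  proof (cases "k = l")
    case False
    then obtain s where "s \<in> S" "k s \<noteq> l s"
      using k PiE_ext[of k S "\<lambda>_. {..<N}" l] by (auto simp: grid_def)
    then show ?thesis using False S by (auto intro!: prod_zero)
  qed simp
  finally show ?thesis .
qed

lemma grid_Parseval:
  assumes S: "finite S"
  shows "(\<Sum>a\<in>grid S N. (norm (\<Sum>k\<in>grid S N. F k * cnj (pairing S N a k)))\<^sup>2) =
    N ^ card S * (\<Sum>k\<in>grid S N. (norm (F k))\<^sup>2)"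
proof -
  let ?B = "grid S N" and ?E = "pairing S N"
  have "complex_of_real (\<Sum>a\<in>?B. (norm (\<Sum>k\<in>?B. F k * cnj (?E a k)))\<^sup>2) =
      (\<Sum>a\<in>?B. \<Sum>k\<in>?B. \<Sum>l\<in>?B. F k * cnj (F l) * (?E a l * cnj (?E a k)))"
    unfolding of_real_sum complex_norm_square cnj_sum complex_cnj_mult complex_cnj_cnj sum_product
    by (intro sum.cong refl) (simp only: mult_ac)
  also have "\<dots> = (\<Sum>k\<in>?B. \<Sum>l\<in>?B. \<Sum>a\<in>?B. F k * cnj (F l) * (?E a l * cnj (?E a k)))"
    by (subst sum.swap) (intro sum.cong refl sum.swap)
  also have "\<dots> = (\<Sum>k\<in>?B. \<Sum>l\<in>?B. F k * cnj (F l) * (if l = k then of_nat (N ^ card S) else 0))"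
    by (intro sum.cong refl) (simp add: sum_distrib_left[symmetric] pairing_orthogonal[OF S])
  also have "\<dots> = (\<Sum>k\<in>?B. \<Sum>l\<in>?B. if l = k then F k * cnj (F k) * of_nat (N ^ card S) else 0)"
    by (intro sum.cong refl) auto
  also have "\<dots> = (\<Sum>k\<in>?B. F k * cnj (F k) * of_nat (N ^ card S))"
    using finite_grid[OF S] by simp
  also have "\<dots> = complex_of_real (N ^ card S * (\<Sum>k\<in>?B. (norm (F k))\<^sup>2))"
    unfolding of_real_mult of_real_sum complex_norm_square sum_distrib_left by (simp add: mult_ac)
  finally show ?thesis by (simp only: of_real_eq_iff of_nat_power)
qed

text \<open>As a function of \<open>x\<close>, the inner sum is a convolution of \<open>v\<close> with a difference of two translates of
\<open>W\<close>. Its Fourier coefficient at \<open>a\<close> is therefore the product of \<open>pairing S N a u - 1\<close>, the coefficient of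
\<open>v\<close> and the coefficient of \<open>W\<close>. By Parseval's identity the squares of the last factor have sum at most
\<open>N ^ (2 * card S)\<close>, so the product of the other two cannot be small for every \<open>a\<close>.\<close>

lemma large_Fourier_coefficient:
  fixes W v :: "('s \<Rightarrow> nat) \<Rightarrow> real"
  assumes S: "finite S" and N: "0 < N" and W: "\<And>k. k \<in> grid S N \<Longrightarrow> \<bar>W k\<bar> \<le> 1" and K: "0 < K"
    and big: "K * N ^ card S \<le>
      (\<Sum>x\<in>grid S N. (\<Sum>h\<in>grid S m. v h * (W (shift S N (h + u) x) - W (shift S N h x)))\<^sup>2)"
  obtains a where "K / 2 < (norm (pairing S N a u - 1))\<^sup>2 * (norm (\<Sum>h\<in>grid S m. v h * pairing S N a h))\<^sup>2"
proof -
  let ?B = "grid S N" and ?E = "pairing S N"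
  define U where "U x = complex_of_real (\<Sum>h\<in>grid S m. v h * (W (shift S N (h + u) x) - W (shift S N h x)))" for x
  define W' where "W' a = (\<Sum>x\<in>?B. complex_of_real (W x) * cnj (?E a x))" for a
  define V where "V a = (\<Sum>h\<in>grid S m. complex_of_real (v h) * ?E a h)" for a
  have FT: "(\<Sum>x\<in>?B. U x * cnj (?E a x)) = (?E a u - 1) * V a * W' a" for a
  proof -
    have "(\<Sum>x\<in>?B. U x * cnj (?E a x)) = (\<Sum>h\<in>grid S m. complex_of_real (v h) *
        ((\<Sum>x\<in>?B. complex_of_real (W (shift S N (h + u) x)) * cnj (?E a x)) -
         (\<Sum>x\<in>?B. complex_of_real (W (shift S N h x)) * cnj (?E a x))))"
      unfolding sum_subtractf[symmetric] sum_distrib_left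
      by (subst sum.swap) (simp add: U_def sum_distrib_right sum_distrib_left algebra_simps)
    also have "\<dots> = (\<Sum>h\<in>grid S m. complex_of_real (v h) * (?E a (h + u) * W' a - ?E a h * W' a))"
      unfolding sum_pairing_shift[OF S N, of "\<lambda>y. complex_of_real (W y)"] W'_def ..
    also have "\<dots> = (?E a u - 1) * V a * W' a"
      by (simp add: V_def pairing_add sum_distrib_left sum_distrib_right algebra_simps)
    finally show ?thesis .
  qed
  have "\<exists>a. K / 2 < (norm (?E a u - 1))\<^sup>2 * (norm (V a))\<^sup>2"
  proof (rule ccontr)
    assume "\<nexists>a. K / 2 < (norm (?E a u - 1))\<^sup>2 * (norm (V a))\<^sup>2"
    then have le: "(norm (?E a u - 1))\<^sup>2 * (norm (V a))\<^sup>2 \<le> K / 2" for a by (auto simp: not_less)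
    have W1: "(\<Sum>x\<in>?B. (W x)\<^sup>2) \<le> (\<Sum>x\<in>?B. 1 :: real)"
      using W by (intro sum_mono) (simp add: abs_square_le_1)
    have "N ^ card S * (K * N ^ card S) \<le> N ^ card S * (\<Sum>x\<in>?B. (norm (U x))\<^sup>2)"
      using big by (intro mult_left_mono) (auto simp: U_def norm_of_real simp del: of_real_sum of_real_mult of_real_diff)
    also have "\<dots> = (\<Sum>a\<in>?B. (norm ((?E a u - 1) * V a * W' a))\<^sup>2)"
      using grid_Parseval[OF S, where F = U and N = N] by (simp add: FT)
    also have "\<dots> \<le> (\<Sum>a\<in>?B. K / 2 * (norm (W' a))\<^sup>2)"
      unfolding norm_mult power_mult_distrib by (intro sum_mono mult_right_mono le) simp
    also have "\<dots> = K / 2 * (N ^ card S * (\<Sum>x\<in>?B. (W x)\<^sup>2))"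
      unfolding sum_distrib_left[symmetric] W'_def grid_Parseval[OF S] by simp
    also have "\<dots> \<le> K / 2 * (N ^ card S * (\<Sum>x\<in>?B. 1 :: real))"
      using K by (intro mult_left_mono[OF mult_left_mono[OF W1]]) auto
    also have "\<dots> = K / 2 * (N ^ card S * N ^ card S)" by (simp add: card_grid[OF S])
    finally show False using K N by simp
  qed
  then show ?thesis using that by (auto simp: V_def)
qed

text \<open>The two sums differ only in two faces of the box, each of which contains the fraction \<open>1 / m\<close> of its
points.\<close>

lemma grid_translate_sum:
  fixes F :: "('s \<Rightarrow> nat) \<Rightarrow> complex"
  assumes S: "finite S" "s \<in> S" and m: "0 < m" and F: "\<And>k. norm (F k) \<le> 1"
  shows "norm ((\<Sum>h\<in>grid S m. F (h + unit_at s)) - (\<Sum>h\<in>grid S m. F h)) \<le> 2 / real m * real m ^ card S"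
proof -
  define L where "L j = {h \<in> grid S m. h s = j}" for j
  have fin: "finite (grid S m)" "finite (L j)" for j
    using S by (auto simp: finite_grid L_def)
  have card_L: "real (card (L j)) = m ^ card S / m" if "j < m" for j
  proof -
    have "h \<in> L j \<longleftrightarrow> h \<in> (\<Pi>\<^sub>E t\<in>S. if t = s then {j} else {..<m})" for h
    proof
      assume h: "h \<in> L j"
      show "h \<in> (\<Pi>\<^sub>E t\<in>S. if t = s then {j} else {..<m})"
      proof (rule PiE_I)
        fix t assume "t \<in> S"
        with h show "h t \<in> (if t = s then {j} else {..<m})" by (auto simp: L_def grid_def)
      next
        fix t assume "t \<notin> S"
        with h show "h t = undefined" unfolding L_def grid_def by (blast intro: PiE_arb)
      qed
    next
      assume h: "h \<in> (\<Pi>\<^sub>E t\<in>S. if t = s then {j} else {..<m})"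
      have mem: "h t \<in> (if t = s then {j} else {..<m})" if "t \<in> S" for t
        using h that by (rule PiE_mem)
      have "h t \<in> {..<m}" if "t \<in> S" for t
        using mem[OF that] \<open>j < m\<close> by (cases "t = s") simp_all
      moreover have "h t = undefined" if "t \<notin> S" for t
        using h that by (rule PiE_arb)
      ultimately have "h \<in> grid S m" unfolding grid_def by (rule PiE_I)
      with mem[OF S(2)] show "h \<in> L j" by (simp add: L_def)
    qed
    then have "L j = (\<Pi>\<^sub>E t\<in>S. if t = s then {j} else {..<m})" by blast
    then have "card (L j) = (\<Prod>t\<in>S. card (if t = s then {j} else {..<m}))"
      using S by (simp add: card_PiE)
    also have "\<dots> = (\<Prod>t\<in>S - {s}. m)"
      using S by (subst prod.remove[of _ s]) (auto intro!: prod.cong)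
    also have "\<dots> = m ^ (card S - 1)" using S by simp
    finally have "card (L j) * m = m ^ card S"
      using S by (metis card_gt_0_iff empty_iff power_minus_mult)
    then have "real (card (L j)) * real m = real m ^ card S"
      by (metis of_nat_mult of_nat_power)
    with m show ?thesis by (simp add: field_simps)
  qed
  have "(\<Sum>h\<in>grid S m - L (m - 1). F (h + unit_at s)) = (\<Sum>h\<in>grid S m - L 0. F h)"
  proof (rule sum.reindex_bij_witness[of _ "\<lambda>h. h - unit_at s" "\<lambda>h. h + unit_at s"])
    fix h assume "h \<in> grid S m - L (m - 1)"
    then show "h + unit_at s - unit_at s = h" "h + unit_at s \<in> grid S m - L 0"
      using S by (auto simp: grid_def L_def unit_at_def PiE_iff extensional_def fun_eq_iff fun_diff_def)
  next
    fix h assume "h \<in> grid S m - L 0"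
    then show "h - unit_at s + unit_at s = h" "h - unit_at s \<in> grid S m - L (m - 1)"
      using S m by (auto simp: grid_def L_def unit_at_def PiE_iff extensional_def fun_eq_iff fun_diff_def)
  qed simp
  moreover have "(\<Sum>h\<in>grid S m. G h) = (\<Sum>h\<in>grid S m - L j. G h) + (\<Sum>h\<in>L j. G h)"
    for G :: "('s \<Rightarrow> nat) \<Rightarrow> complex" and j
    using fin by (intro sum.subset_diff) (auto simp: L_def)
  ultimately have "(\<Sum>h\<in>grid S m. F (h + unit_at s)) - (\<Sum>h\<in>grid S m. F h) =
      (\<Sum>h\<in>L (m - 1). F (h + unit_at s)) - (\<Sum>h\<in>L 0. F h)"
    by (metis (no_types, lifting) add_diff_cancel_left)
  also have "norm \<dots> \<le> norm (\<Sum>h\<in>L (m - 1). F (h + unit_at s)) + norm (\<Sum>h\<in>L 0. F h)"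
    by (rule norm_triangle_ineq4)
  also have "\<dots> \<le> real (card (L (m - 1))) + real (card (L 0))"
    using F by (intro add_mono sum_norm_bound[where K = 1, simplified]) auto
  also have "\<dots> = 2 / real m * real m ^ card S" using m by (simp add: card_L)
  finally show ?thesis .
qed

subsection \<open>Separation of points\<close>

text \<open>Up to errors of order \<open>1 / m\<close>, \<open>\<theta>\<close> is multiplicative on \<open>S\<close> and has the modulus of continuity of \<open>v\<close>.\<close>

definition near_character :: "('a::ab_group_add \<Rightarrow> real) \<Rightarrow> real \<Rightarrow> 'a set \<Rightarrow> nat \<Rightarrow> ('a \<Rightarrow> circle) \<Rightarrow> bool" where
  "near_character v c S m \<theta> \<longleftrightarrow>
    (\<forall>s\<in>S. \<forall>t\<in>S. s + t \<in> S \<longrightarrow>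
      c * norm (e_circle (\<theta> s) * e_circle (\<theta> t) - e_circle (\<theta> (s + t))) \<le> 6 / real m) \<and>
    (\<forall>s\<in>S. \<forall>\<delta>. (\<forall>z. \<bar>v (z - s) - v z\<bar> \<le> \<delta>) \<longrightarrow> c * norm (e_circle (\<theta> s) - 1) \<le> \<delta> + 2 / real m)"

text \<open>Let \<open>w\<close> separate \<open>g\<close> from \<open>0\<close>, put \<open>u z = w (z + g) - w z\<close>, and let \<open>v0\<close> be a bump function whose
support \<open>V\<close> is so small that translation by elements of \<open>V\<close> changes \<open>u\<close> by at most \<open>1/4\<close>. Pull \<open>w\<close>
and \<open>v0\<close> back along \<open>pos : \<int>\<^sup>S \<rightarrow> G\<close>, after translations for which neither the average of \<open>v0\<close> nor
the mean square of \<open>u\<close> is small. Averaging the difference of two translates of \<open>w\<close> against \<open>v0\<close> then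
does not lose it, and \<open>large_Fourier_coefficient\<close> yields a frequency \<open>a\<close> that is nontrivial at \<open>g\<close> and
correlates with \<open>v0\<close>. Since translating \<open>v0\<close> by \<open>s\<close> multiplies this correlation almost by the value of
\<open>a\<close> at \<open>s\<close>, these values are nearly multiplicative and inherit the modulus of continuity of \<open>v0\<close>.\<close>

lemma approximate_character:
  fixes g :: "'a::{topological_ab_group_add, t2_space}"
  assumes cpt: "compact (UNIV :: 'a set)" and g: "g \<noteq> 0"
  obtains v0 :: "'a \<Rightarrow> real" and c :: real where "continuous_on UNIV v0" "0 < c"
    "\<And>S m. finite S \<Longrightarrow> g \<in> S \<Longrightarrow> 0 < m \<Longrightarrow> \<exists>\<theta> :: 'a \<Rightarrow> circle.
       c \<le> norm (e_circle (\<theta> g) - 1) \<and> near_character v0 c S m \<theta>"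
proof -
  have normal: "normal_space (euclidean :: 'a topology)"
  proof (rule compact_Hausdorff_or_regular_imp_normal_space)
    show "compact_space (euclidean :: 'a topology)" using cpt by (simp add: compact_space_def)
    have "Hausdorff_space (euclidean :: 'a topology)"
      unfolding Hausdorff_space_def
    proof (intro allI impI)
      fix x y :: 'a assume "x \<in> topspace euclidean \<and> y \<in> topspace euclidean \<and> x \<noteq> y"
      then obtain U V where "open U" "open V" "x \<in> U" "y \<in> V" "U \<inter> V = {}"
        using hausdorff[of x y] by blast
      then show "\<exists>U V. openin euclidean U \<and> openin euclidean V \<and> x \<in> U \<and> y \<in> V \<and> disjnt U V"
        by (intro exI[of _ U] exI[of _ V]) (simp add: disjnt_def)
    qed
    then show "Hausdorff_space (euclidean :: 'a topology) \<or> regular_space (euclidean :: 'a topology)" ..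
  qed
  have Urysohn: "\<exists>f :: 'a \<Rightarrow> real. continuous_on UNIV f \<and> (\<forall>z. 0 \<le> f z \<and> f z \<le> 1) \<and> (\<forall>z\<in>S. f z = 0) \<and> (\<forall>z\<in>T. f z = 1)"
    if "closed S" "closed T" "S \<inter> T = {}" for S T :: "'a set"
  proof -
    have "disjnt S T" using that by (simp add: disjnt_def)
    from Urysohn_lemma[OF normal _ _ this zero_le_one[where 'a = real]] that
    obtain f where f: "continuous_map euclidean (top_of_set {0..1::real}) f" "f ` S \<subseteq> {0}" "f ` T \<subseteq> {1}"
      by (auto simp: closed_closedin[symmetric])
    then show ?thesis
      by (intro exI[of _ f]) (auto simp: continuous_map_in_subtopology image_subset_iff)
  qed
  obtain w :: "'a \<Rightarrow> real" where w: "continuous_on UNIV w" "\<And>z. 0 \<le> w z" "\<And>z. w z \<le> 1" "w 0 = 0" "w g = 1"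
    using Urysohn[of "{0}" "{g}"] g by auto
  define u where "u z = w (z + g) - w z" for z
  have u: "continuous_on UNIV u"
    unfolding u_def by (intro continuous_intros continuous_on_compose2[OF w(1)]) auto
  have quarter: "0 < (1 / 4 :: real)" by simp
  obtain V where V: "open V" "0 \<in> V" "\<And>v z. v \<in> V \<Longrightarrow> dist (u (z + v)) (u z) \<le> 1 / 4"
    using quarter by (rule compact_group_uniform[OF cpt u]) (blast intro: that)
  obtain v0 :: "'a \<Rightarrow> real" where v0: "continuous_on UNIV v0" "\<And>z. 0 \<le> v0 z" "\<And>z. v0 z \<le> 1"
      "\<And>z. z \<notin> V \<Longrightarrow> v0 z = 0" "v0 0 = 1"
  proof -
    have "closed (- V)" "closed {0 :: 'a}" "- V \<inter> {0} = {}" using V(1,2) by auto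
    from Urysohn[OF this] show ?thesis using that by auto
  qed
  define q where "q z = max 0 (\<bar>u z\<bar> - 1 / 4)" for z
  have q: "continuous_on UNIV (\<lambda>z. (q z)\<^sup>2)"
    unfolding q_def by (intro continuous_intros u)
  have "0 < v0 0" by (simp add: v0(5))
  then obtain c3 :: real where c3: "0 < c3"
    "\<And>(B :: ('a \<Rightarrow> nat) set) pos. finite B \<Longrightarrow> \<exists>\<tau>. c3 * card B \<le> (\<Sum>x\<in>B. v0 (pos x + \<tau>))"
    by (rule translate_average_bound[OF cpt v0(1,2)]) (blast intro: that)
  have "0 < (q 0)\<^sup>2" using w(4,5) by (simp add: q_def u_def)
  then obtain c4 :: real where c4: "0 < c4"
    "\<And>(B :: ('a \<Rightarrow> nat) set) pos. finite B \<Longrightarrow> \<exists>\<tau>. c4 * card B \<le> (\<Sum>x\<in>B. (q (pos x + \<tau>))\<^sup>2)"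
    by (rule translate_average_bound[OF cpt q zero_le_power2]) (blast intro: that)
  define c where "c = c3 * sqrt c4 / 4"
  show thesis
  proof (rule that[OF v0(1), of c])
    show "0 < c" using c3 c4 by (simp add: c_def)
    fix S :: "'a set" and m :: nat
    assume S: "finite S" "g \<in> S" and m: "0 < m"
    define n where "n = card S"
    have n: "0 < n" using S by (auto simp: n_def card_gt_0_iff)
    \<comment> \<open>With this \<open>N\<close>, by Bernoulli's inequality at least half of the points of \<open>grid S N\<close> lie in
\<open>grid S (N - m)\<close>, where adding an element of \<open>grid S m\<close> does not wrap around.\<close>
    define N where "N = 2 * n * m"
    have N: "0 < N" using n m by (simp add: N_def)
    define M where "M = real m ^ n"
    have M: "0 < M" using m by (simp add: M_def)
    define pos :: "('a \<Rightarrow> nat) \<Rightarrow> 'a" where "pos h = (\<Sum>s\<in>S. int (h s) \<odot> s)" for h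
    have pos_add: "pos (h + k) = pos h + pos k" for h k
      by (simp add: pos_def zmul_add_left sum.distrib)
    have pos_unit: "pos (unit_at s) = s" if "s \<in> S" for s
    proof -
      have "pos (unit_at s) = (\<Sum>t\<in>S. if t = s then t else 0)"
        unfolding pos_def by (intro sum.cong) (auto simp: unit_at_def)
      with that S(1) show ?thesis by simp
    qed
    obtain \<sigma> where \<sigma>: "c3 * card (grid S m) \<le> (\<Sum>h\<in>grid S m. v0 (pos h + \<sigma>))"
      using c3(2)[OF finite_grid[OF S(1)]] by blast
    obtain \<tau> where \<tau>: "c4 * card (grid S (N - m)) \<le> (\<Sum>x\<in>grid S (N - m). (q (pos x + \<tau>))\<^sup>2)"
      using c4(2)[OF finite_grid[OF S(1)]] by blast
    define W where "W k = w (pos k + \<tau> + \<sigma>)" for k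
    define v where "v h = v0 (pos h + \<sigma>)" for h
    define A where "A = (\<Sum>h\<in>grid S m. v h)"
    have A: "c3 * M \<le> A" "0 \<le> A"
      using \<sigma> v0(2) by (auto simp: A_def v_def M_def n_def card_grid[OF S(1)] intro: sum_nonneg)
    have point: "(A * q (pos x + \<tau>))\<^sup>2 \<le>
        (\<Sum>h\<in>grid S m. v h * (W (shift S N (h + unit_at g) x) - W (shift S N h x)))\<^sup>2"
      if x: "x \<in> grid S (N - m)" for x
    proof -
      have Wu: "W (shift S N (h + unit_at g) x) - W (shift S N h x) = u (pos x + \<tau> + (pos h + \<sigma>))"
        if h: "h \<in> grid S m" for h
      proof -
        have lt: "x s < N - m" "h s < m" if "s \<in> S" for s using x h that by (auto simp: grid_def)
        have "pos (shift S N k x) = pos x + pos k" if "\<And>s. s \<in> S \<Longrightarrow> x s + k s < N" for k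
        proof -
          have "pos (shift S N k x) = pos (x + k)"
            unfolding pos_def using that by (intro sum.cong) (auto simp: shift_def)
          then show ?thesis by (simp add: pos_add)
        qed
        moreover have "x s + h s < N" "x s + (h + unit_at g) s < N" if "s \<in> S" for s
          using lt[OF that] by (auto simp: unit_at_def)
        ultimately have "pos (shift S N h x) = pos x + pos h"
            "pos (shift S N (h + unit_at g) x) = pos x + pos h + g"
          using S(2) by (auto simp: pos_add pos_unit algebra_simps)
        then show ?thesis by (simp add: W_def u_def algebra_simps)
      qed
      define u0 where "u0 = u (pos x + \<tau>)"
      have near: "v h * \<bar>u (pos x + \<tau> + (pos h + \<sigma>)) - u0\<bar> \<le> v h * (1 / 4)" for h
      proof (cases "pos h + \<sigma> \<in> V")
        case True
        then show ?thesis using V(3)[OF True, of "pos x + \<tau>"] v0(2)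
          by (intro mult_left_mono) (auto simp: u0_def dist_real_def v_def)
      qed (simp add: v_def v0(4))
      have "\<bar>(\<Sum>h\<in>grid S m. v h * u (pos x + \<tau> + (pos h + \<sigma>))) - A * u0\<bar> \<le> A * (1 / 4)"
      proof -
        have "(\<Sum>h\<in>grid S m. v h * u (pos x + \<tau> + (pos h + \<sigma>))) - A * u0 =
            (\<Sum>h\<in>grid S m. v h * (u (pos x + \<tau> + (pos h + \<sigma>)) - u0))"
          by (simp add: A_def sum_distrib_right sum_subtractf right_diff_distrib)
        also have "\<bar>\<dots>\<bar> \<le> (\<Sum>h\<in>grid S m. v h * \<bar>u (pos x + \<tau> + (pos h + \<sigma>)) - u0\<bar>)"
          using v0(2) by (intro order_trans[OF sum_abs] sum_mono) (auto simp: abs_mult v_def)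
        also have "\<dots> \<le> (\<Sum>h\<in>grid S m. v h * (1 / 4))" by (intro sum_mono near)
        also have "\<dots> = A * (1 / 4)" by (simp only: A_def sum_distrib_right)
        finally show ?thesis .
      qed
      moreover have A_u0: "A * \<bar>u0\<bar> = \<bar>A * u0\<bar>" using A(2) by (simp add: abs_mult)
      ultimately have "A * \<bar>u0\<bar> - A * (1 / 4) \<le> \<bar>\<Sum>h\<in>grid S m. v h * u (pos x + \<tau> + (pos h + \<sigma>))\<bar>"
        using A_u0 by linarith
      then have "A * q (pos x + \<tau>) \<le> \<bar>\<Sum>h\<in>grid S m. v h * u (pos x + \<tau> + (pos h + \<sigma>))\<bar>"
        by (simp add: q_def u0_def max_def right_diff_distrib)
      moreover have "0 \<le> A * q (pos x + \<tau>)" using A(2) by (simp add: q_def)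
      ultimately have "(A * q (pos x + \<tau>))\<^sup>2 \<le> \<bar>\<Sum>h\<in>grid S m. v h * u (pos x + \<tau> + (pos h + \<sigma>))\<bar>\<^sup>2"
        by (rule power_mono)
      also have "\<dots> = (\<Sum>h\<in>grid S m. v h * (W (shift S N (h + unit_at g) x) - W (shift S N h x)))\<^sup>2"
        using Wu by simp
      finally show ?thesis .
    qed
    define K where "K = (c3 * M)\<^sup>2 * c4 / 2"
    have "K * real N ^ card S \<le> (c3 * M)\<^sup>2 * (c4 * card (grid S (N - m)))"
    proof -
      have mN: "real (N - m) = real N * (1 - 1 / (2 * real n))"
        using n m by (simp add: N_def of_nat_diff field_simps)
      have "1 / 2 = 1 + real n * (- (1 / (2 * real n)))" using n by (simp add: field_simps)
      also have "\<dots> \<le> (1 + - (1 / (2 * real n))) ^ n"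
        using n by (intro Bernoulli_inequality) (auto simp: field_simps)
      finally have "real N ^ n * (1 / 2) \<le> real N ^ n * (1 - 1 / (2 * real n)) ^ n"
        by (intro mult_left_mono) auto
      then have "real N ^ n / 2 \<le> real (N - m) ^ n" by (simp add: mN power_mult_distrib)
      then have "(c3 * M)\<^sup>2 * c4 * (real N ^ n / 2) \<le> (c3 * M)\<^sup>2 * c4 * real (N - m) ^ n"
        using c4(1) by (intro mult_left_mono) auto
      then show ?thesis by (simp add: K_def card_grid[OF S(1)] n_def mult_ac)
    qed
    also have "\<dots> \<le> A\<^sup>2 * (\<Sum>x\<in>grid S (N - m). (q (pos x + \<tau>))\<^sup>2)"
      using A c3(1) c4(1) M \<tau> by (intro mult_mono power_mono) auto
    also have "\<dots> = (\<Sum>x\<in>grid S (N - m). (A * q (pos x + \<tau>))\<^sup>2)"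
      by (simp add: sum_distrib_left power_mult_distrib)
    also have "\<dots> \<le> (\<Sum>x\<in>grid S (N - m).
        (\<Sum>h\<in>grid S m. v h * (W (shift S N (h + unit_at g) x) - W (shift S N h x)))\<^sup>2)"
      by (intro sum_mono point)
    also have "\<dots> \<le> (\<Sum>x\<in>grid S N.
        (\<Sum>h\<in>grid S m. v h * (W (shift S N (h + unit_at g) x) - W (shift S N h x)))\<^sup>2)"
    proof (rule sum_mono2[OF finite_grid[OF S(1)]])
      show "grid S (N - m) \<subseteq> grid S N" unfolding grid_def by (rule PiE_mono) auto
    qed simp
    finally have big: "K * real N ^ card S \<le> (\<Sum>x\<in>grid S N.
        (\<Sum>h\<in>grid S m. v h * (W (shift S N (h + unit_at g) x) - W (shift S N h x)))\<^sup>2)" .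
    have K: "0 < K" using c3 c4 M by (simp add: K_def)
    have W: "\<bar>W k\<bar> \<le> 1" for k using w(2,3) by (simp add: W_def)
    obtain a where a: "K / 2 < (norm (pairing S N a (unit_at g) - 1))\<^sup>2 *
        (norm (\<Sum>h\<in>grid S m. v h * pairing S N a h))\<^sup>2"
      using large_Fourier_coefficient[OF S(1) N W K big] by blast
    define E where "E = pairing S N a"
    define T where "T \<rho> = (\<Sum>h\<in>grid S m. complex_of_real (v0 (pos h + \<rho>)) * E h)" for \<rho>
    have T_le: "norm (T \<sigma>) \<le> M"
    proof -
      have "norm (T \<sigma>) \<le> (\<Sum>h\<in>grid S m. 1)"
        unfolding T_def using v0(2,3)
        by (intro order_trans[OF norm_sum] sum_mono) (auto simp: norm_mult E_def)
      then show ?thesis by (simp add: card_grid[OF S(1)] M_def n_def)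
    qed
    have E_le: "norm (E (unit_at g) - 1) \<le> 2"
      using norm_triangle_ineq4[of "E (unit_at g)" 1] by (simp add: E_def)
    have prod: "(2 * c * M)\<^sup>2 < (norm (E (unit_at g) - 1) * norm (T \<sigma>))\<^sup>2"
    proof -
      have "(2 * c * M)\<^sup>2 = K / 2" using c4(1) by (simp add: c_def K_def power_mult_distrib power_divide)
      with a show ?thesis by (simp add: E_def T_def v_def power_mult_distrib)
    qed
    then have prod: "2 * c * M < norm (E (unit_at g) - 1) * norm (T \<sigma>)"
      by (rule power2_less_imp_less) simp
    have Eg: "c \<le> norm (E (unit_at g) - 1)"
    proof -
      have "2 * c * M < norm (E (unit_at g) - 1) * M"
        using prod mult_left_mono[OF T_le, of "norm (E (unit_at g) - 1)"] by simp
      then have "2 * c < norm (E (unit_at g) - 1)" using M by simp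
      with \<open>0 < c\<close> show ?thesis by simp
    qed
    have T_ge: "c * M \<le> norm (T \<sigma>)"
      using prod mult_right_mono[OF E_le, of "norm (T \<sigma>)"] by simp
    have step: "norm (E (unit_at s) * T \<rho> - T (\<rho> - s)) \<le> 2 / real m * M" if s: "s \<in> S" for s \<rho>
    proof -
      define F where "F k = complex_of_real (v0 (pos k + (\<rho> - s))) * E k" for k
      have "E (unit_at s) * T \<rho> = (\<Sum>h\<in>grid S m. F (h + unit_at s))"
        unfolding T_def sum_distrib_left F_def pos_add pos_unit[OF s] E_def pairing_add
        by (intro sum.cong refl) (simp add: algebra_simps)
      moreover have "T (\<rho> - s) = (\<Sum>h\<in>grid S m. F h)" by (simp add: T_def F_def)
      moreover have "norm (F k) \<le> 1" for k using v0(2,3) by (simp add: F_def norm_mult E_def)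
      ultimately show ?thesis using grid_translate_sum[OF S(1) s m, of F] by (simp add: M_def n_def)
    qed
    define \<theta> where "\<theta> s = to_circle (real (a s) / real N)" for s
    have \<theta>: "e_circle (\<theta> s) = E (unit_at s)" if "s \<in> S" for s
      using pairing_unit_at[OF S(1) that] by (simp add: E_def \<theta>_def)
    \<comment> \<open>Passes from the unnormalised correlation \<open>T \<sigma>\<close> to the constant \<open>c\<close>.\<close>
    have bound: "c * r \<le> d" if "r * norm (T \<sigma>) \<le> d * M" "0 \<le> r" for r d
    proof -
      have "(c * r) * M \<le> r * norm (T \<sigma>)" using mult_left_mono[OF T_ge that(2)] by (simp add: mult_ac)
      also note that(1)
      finally show ?thesis using M by simp
    qed
    show "\<exists>\<theta> :: 'a \<Rightarrow> circle. c \<le> norm (e_circle (\<theta> g) - 1) \<and> near_character v0 c S m \<theta>"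
      unfolding near_character_def
    proof (intro exI[of _ \<theta>] conjI ballI allI impI)
      show "c \<le> norm (e_circle (\<theta> g) - 1)" using Eg \<theta>[OF S(2)] by simp
    next
      fix s t assume st: "s \<in> S" "t \<in> S" "s + t \<in> S"
      let ?D = "E (unit_at s) * E (unit_at t) - E (unit_at (s + t))"
      have "?D * T \<sigma> = E (unit_at s) * (E (unit_at t) * T \<sigma> - T (\<sigma> - t)) +
          (E (unit_at s) * T (\<sigma> - t) - T (\<sigma> - t - s)) - (E (unit_at (s + t)) * T \<sigma> - T (\<sigma> - (s + t)))"
        by (simp add: algebra_simps)
      also have "norm \<dots> \<le> norm (E (unit_at s) * (E (unit_at t) * T \<sigma> - T (\<sigma> - t))) +
          norm (E (unit_at s) * T (\<sigma> - t) - T (\<sigma> - t - s)) + norm (E (unit_at (s + t)) * T \<sigma> - T (\<sigma> - (s + t)))"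
        by (intro order_trans[OF norm_triangle_ineq4] add_mono norm_triangle_ineq order_refl)
      also have "\<dots> \<le> 2 / real m * M + 2 / real m * M + 2 / real m * M"
        using step[OF st(2), of \<sigma>] by (intro add_mono step st) (simp_all add: norm_mult E_def)
      finally have "norm ?D * norm (T \<sigma>) \<le> 6 / real m * M" by (simp add: norm_mult)
      from bound[OF this] show "c * norm (e_circle (\<theta> s) * e_circle (\<theta> t) - e_circle (\<theta> (s + t))) \<le> 6 / real m"
        using st by (simp add: \<theta>)
    next
      fix s \<delta> assume s: "s \<in> S" and \<delta>: "\<forall>z. \<bar>v0 (z - s) - v0 z\<bar> \<le> \<delta>"
      have "norm (T (\<sigma> - s) - T \<sigma>) \<le> (\<Sum>h\<in>grid S m. \<delta>)"
      proof -
        have "T (\<sigma> - s) - T \<sigma> = (\<Sum>h\<in>grid S m. complex_of_real (v0 (pos h + \<sigma> - s) - v0 (pos h + \<sigma>)) * E h)"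
          by (simp add: T_def sum_subtractf left_diff_distrib add_diff_eq)
        also have "norm \<dots> \<le> (\<Sum>h\<in>grid S m. \<bar>v0 (pos h + \<sigma> - s) - v0 (pos h + \<sigma>)\<bar>)"
          by (rule order_trans[OF norm_sum]) (simp add: norm_mult E_def del: of_real_diff)
        also have "\<dots> \<le> (\<Sum>h\<in>grid S m. \<delta>)" using \<delta> by (intro sum_mono) auto
        finally show ?thesis .
      qed
      then have T\<delta>: "norm (T (\<sigma> - s) - T \<sigma>) \<le> \<delta> * M" by (simp add: card_grid[OF S(1)] M_def n_def mult.commute)
      have "(E (unit_at s) - 1) * T \<sigma> = (E (unit_at s) * T \<sigma> - T (\<sigma> - s)) + (T (\<sigma> - s) - T \<sigma>)"
        by (simp add: algebra_simps)
      also have "norm \<dots> \<le> 2 / real m * M + \<delta> * M"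
        by (intro order_trans[OF norm_triangle_ineq] add_mono step s T\<delta>)
      finally have "norm (E (unit_at s) - 1) * norm (T \<sigma>) \<le> (\<delta> + 2 / real m) * M"
        by (simp add: norm_mult distrib_right)
      from bound[OF this] show "c * norm (e_circle (\<theta> s) - 1) \<le> \<delta> + 2 / real m"
        using s by (simp add: \<theta>)
    qed
  qed
qed

lemma compact_fun_space:
  assumes "compact (UNIV :: 'b::topological_space set)"
  shows "compact (UNIV :: ('a \<Rightarrow> 'b) set)"
proof -
  have "compact_space (product_topology (\<lambda>i::'a. euclidean :: 'b topology) UNIV)"
    using assms by (subst compact_space_product_topology) (simp add: compact_space_def)
  then show ?thesis by (simp add: euclidean_product_topology compact_space_def)
qed

lemma continuous_e_coordinate: "continuous_on A (\<lambda>\<theta> :: 'a \<Rightarrow> circle. e_circle (\<theta> x))"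
proof -
  have "continuous_on UNIV (\<lambda>\<theta> :: 'a \<Rightarrow> circle. e_circle (\<theta> x))"
    by (rule continuous_on_compose2[OF continuous_e[of UNIV] continuous_on_product_coordinates]) simp
  then show ?thesis by (rule continuous_on_subset) simp
qed

text \<open>Each requirement on \<open>\<theta>\<close> describes a closed set in the compact space of all functions \<open>G \<rightarrow> T\<close>, and
\<open>approximate_character\<close> says that these sets have the finite intersection property. In the limit the
error terms vanish.\<close>

theorem characters_separate_0:
  fixes g :: "'a::{topological_ab_group_add, t2_space}"
  assumes cpt: "compact (UNIV :: 'a set)" and g: "g \<noteq> 0"
  obtains h where "h \<in> characters (UNIV :: 'a set)" "h g \<noteq> 0"
proof -
  obtain v0 :: "'a \<Rightarrow> real" and c :: real where v0: "continuous_on UNIV v0" and c: "0 < c"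
    and app: "\<And>S m. finite S \<Longrightarrow> g \<in> S \<Longrightarrow> 0 < m \<Longrightarrow> \<exists>\<theta> :: 'a \<Rightarrow> circle.
       c \<le> norm (e_circle (\<theta> g) - 1) \<and> near_character v0 c S m \<theta>"
    using approximate_character[OF cpt g] by blast
  define C :: "'a \<times> 'a \<times> nat \<Rightarrow> ('a \<Rightarrow> circle) set" where "C = (\<lambda>(s, t, m).
      {\<theta>. c \<le> norm (e_circle (\<theta> g) - 1)} \<inter>
      {\<theta>. c * norm (e_circle (\<theta> s) * e_circle (\<theta> t) - e_circle (\<theta> (s + t))) \<le> 6 / real m} \<inter>
      {\<theta>. \<forall>\<delta>. (\<forall>z. \<bar>v0 (z - s) - v0 z\<bar> \<le> \<delta>) \<longrightarrow> c * norm (e_circle (\<theta> s) - 1) \<le> \<delta> + 2 / real m})"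
  define I where "I = (UNIV :: 'a set) \<times> (UNIV :: 'a set) \<times> {0::nat<..}"
  have "UNIV \<inter> (\<Inter>i\<in>I. C i) \<noteq> {}"
  proof (rule compact_imp_fip_image[OF compact_fun_space[OF compact_circle]])
    fix i :: "'a \<times> 'a \<times> nat"
    obtain s t m where i: "i = (s, t, m)" by (cases i) auto
    show "closed (C i)" unfolding C_def i prod.case
      by (intro closed_Int closed_Collect_le closed_Collect_all closed_Collect_imp continuous_intros
          continuous_e_coordinate open_Collect_const)
  next
    fix I' assume I': "finite I'" "I' \<subseteq> I"
    define S where "S = insert g (\<Union>(s, t, m)\<in>I'. {s, t, s + t})"
    define m where "m = Max (insert 1 ((\<lambda>(s, t, m). m) ` I'))"
    have m: "k \<le> m" if "(s, t, k) \<in> I'" for s t k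
      unfolding m_def using I' that by (intro Max_ge) (auto intro!: rev_image_eqI)
    have "1 \<le> m" unfolding m_def using I' by (intro Max_ge) auto
    then have "0 < m" by simp
    moreover have "finite S" "g \<in> S" using I' by (auto simp: S_def)
    ultimately have "\<exists>\<theta> :: 'a \<Rightarrow> circle. c \<le> norm (e_circle (\<theta> g) - 1) \<and> near_character v0 c S m \<theta>"
      by (intro app)
    then obtain \<theta> :: "'a \<Rightarrow> circle" where \<theta>_all: "c \<le> norm (e_circle (\<theta> g) - 1) \<and> near_character v0 c S m \<theta>"
      by (rule exE)
    note \<theta> = \<theta>_all[unfolded near_character_def, THEN conjunct1]
      \<theta>_all[unfolded near_character_def, THEN conjunct2, THEN conjunct1, rule_format]
    have "\<theta> \<in> C i" if "i \<in> I'" for i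
    proof -
      obtain s t k where i: "i = (s, t, k)" by (cases i) auto
      have I'_i: "(s, t, k) \<in> I'" using that i by simp
      then have "(s, t, k) \<in> I" using I'(2) by blast
      then have k: "0 < k" "k \<le> m" using m[OF I'_i] by (simp_all add: I_def)
      then have le: "6 / real m \<le> 6 / real k" "2 / real m \<le> 2 / real k"
        by (simp_all add: divide_left_mono)
      have S: "s \<in> S" "t \<in> S" "s + t \<in> S" unfolding S_def using I'_i by blast+
      show ?thesis unfolding C_def i prod.case
      proof (intro IntI CollectI allI impI)
        fix \<delta> assume "\<forall>z. \<bar>v0 (z - s) - v0 z\<bar> \<le> \<delta>"
        then have "c * norm (e_circle (\<theta> s) - 1) \<le> \<delta> + 2 / real m" using \<theta>_all S(1) by (simp add: near_character_def)
        with le(2) show "c * norm (e_circle (\<theta> s) - 1) \<le> \<delta> + 2 / real k"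
          by linarith
      qed (use \<theta>(1) order_trans[OF \<theta>(2)[OF S] le(1)] in auto)
    qed
    then show "UNIV \<inter> (\<Inter>i\<in>I'. C i) \<noteq> {}" by blast
  qed
  then obtain \<theta> where all: "\<theta> \<in> (\<Inter>i\<in>I. C i)" by blast
  have \<theta>: "\<theta> \<in> C (s, t, m)" if "0 < m" for s t m
    using all that by (simp add: I_def)
  have le_0: "r \<le> \<delta>" if "\<And>m. 0 < m \<Longrightarrow> r \<le> \<delta> + d / real m" for r d \<delta> :: real
  proof (rule LIMSEQ_le_const)
    show "(\<lambda>m. \<delta> + d / real m) \<longlonglongrightarrow> \<delta>"
      using tendsto_add[OF tendsto_const lim_const_over_n[of d]] by simp
  qed (use that in \<open>auto intro!: exI[of _ 1]\<close>)
  have hom: "\<theta> (s + t) = \<theta> s + \<theta> t" for s t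
  proof -
    have "c * norm (e_circle (\<theta> s) * e_circle (\<theta> t) - e_circle (\<theta> (s + t))) \<le> 0"
    proof (rule le_0)
      fix m :: nat assume "0 < m"
      from \<theta>[OF this, of s t]
      show "c * norm (e_circle (\<theta> s) * e_circle (\<theta> t) - e_circle (\<theta> (s + t))) \<le> 0 + 6 / real m"
        unfolding C_def prod.case by simp
    qed
    then have "norm (e_circle (\<theta> s) * e_circle (\<theta> t) - e_circle (\<theta> (s + t))) \<le> 0"
      using c by (simp add: mult_le_0_iff)
    then have "e_circle (\<theta> (s + t)) = e_circle (\<theta> s + \<theta> t)" by (simp add: e_add)
    then show ?thesis by (simp add: e_inject)
  qed
  have small: "c * norm (e_circle (\<theta> s) - 1) \<le> \<delta>" if "\<And>z. \<bar>v0 (z - s) - v0 z\<bar> \<le> \<delta>" for s \<delta>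
  proof (rule le_0)
    fix m :: nat assume "0 < m"
    from \<theta>[OF this, of s] have "\<theta> \<in> {\<theta>. \<forall>\<delta>. (\<forall>z. \<bar>v0 (z - s) - v0 z\<bar> \<le> \<delta>) \<longrightarrow>
        c * norm (e_circle (\<theta> s) - 1) \<le> \<delta> + 2 / real m}"
      unfolding C_def prod.case by blast
    with that show "c * norm (e_circle (\<theta> s) - 1) \<le> \<delta> + 2 / real m" by simp
  qed
  have diff: "\<theta> (x - y) = \<theta> x - \<theta> y" for x y using hom[of "x - y" y] by simp
  have cont: "continuous_on UNIV \<theta>"
  proof (rule continuous_hom[OF hom])
    fix \<epsilon> :: real assume "0 < \<epsilon>"
    then obtain \<delta> where \<delta>: "0 < \<delta>" "\<And>x. norm (e_circle x - 1) < \<delta> \<Longrightarrow> dist x 0 < \<epsilon>"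
      by (rule dist_0_small) (blast intro: that)
    have "0 < c * \<delta> / 2" using c \<delta>(1) by simp
    then obtain V where V: "open V" "0 \<in> V" "\<And>v z. v \<in> V \<Longrightarrow> dist (v0 (z + v)) (v0 z) \<le> c * \<delta> / 2"
      by (rule compact_group_uniform[OF cpt v0]) (blast intro: that)
    have "dist (\<theta> v) 0 < \<epsilon>" if "v \<in> V" for v
    proof (rule \<delta>(2))
      have "\<bar>v0 (z - v) - v0 z\<bar> \<le> c * \<delta> / 2" for z
        using V(3)[OF that, of "z - v"] by (simp add: dist_real_def abs_minus_commute)
      from small[OF this] have "c * norm (e_circle (\<theta> v) - 1) < c * \<delta>"
        using c \<delta>(1) by (smt (verit) mult_pos_pos field_sum_of_halves)
      then show "norm (e_circle (\<theta> v) - 1) < \<delta>" using c by simp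
    qed
    then show "\<exists>V. open V \<and> 0 \<in> V \<and> (\<forall>v\<in>V. dist (\<theta> v) 0 < \<epsilon>)" using V by blast
  qed
  show thesis
  proof (rule that)
    show "\<theta> \<in> characters UNIV" using cont hom by (simp add: characters_def)
    show "\<theta> g \<noteq> 0" using \<theta>[of 1 g g] c by (auto simp: C_def)
  qed
qed

section \<open>Independence modulo p\<close>

text \<open>For \<open>p = 0\<close> this is linear independence over the integers. If \<open>p\<close> is prime and annihilates all
\<open>v y\<close>, it is linear independence over the field with \<open>p\<close> elements. Families are used because
evaluation at distinct points may give equal vectors.\<close>

definition indep_mod :: "nat \<Rightarrow> 'i set \<Rightarrow> ('i \<Rightarrow> 'g::ab_group_add) \<Rightarrow> bool" where
  "indep_mod p Y v \<longleftrightarrow>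
    (\<forall>F k. finite F \<longrightarrow> F \<subseteq> Y \<longrightarrow> (\<Sum>y\<in>F. k y \<odot> v y) = 0 \<longrightarrow> (\<forall>y\<in>F. int p dvd k y))"

lemma indep_modD:
  "indep_mod p Y v \<Longrightarrow> finite F \<Longrightarrow> F \<subseteq> Y \<Longrightarrow> (\<Sum>y\<in>F. k y \<odot> v y) = 0 \<Longrightarrow> y \<in> F \<Longrightarrow> int p dvd k y"
  unfolding indep_mod_def by blast

text \<open>For \<open>p = 0\<close> a maximal independent family need not generate the group, but each \<open>x\<close> has a nonzero multiple
in its span.\<close>

lemma maximal_indep:
  assumes p: "p \<noteq> 1" and v: "\<And>x. x \<in> X \<Longrightarrow> int p \<odot> v x = 0"
  obtains Y where "Y \<subseteq> X" "indep_mod p Y v"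
    "\<And>x. x \<in> X \<Longrightarrow> \<exists>m. \<not> int p dvd m \<and> m \<odot> v x \<in> Z.span (v ` Y)"
proof -
  define \<A> where "\<A> = {Y. Y \<subseteq> X \<and> indep_mod p Y v}"
  have "{} \<in> \<A>" by (auto simp: \<A>_def indep_mod_def)
  moreover have "\<Union>C \<in> \<A>" if C: "C \<noteq> {}" "subset.chain \<A> C" for C
  proof -
    have sub: "C \<subseteq> \<A>" using C(2) by (auto simp: subset.chain_def)
    have "indep_mod p (\<Union>C) v"
      unfolding indep_mod_def
    proof (intro allI impI)
      fix F k assume F: "finite F" "F \<subseteq> \<Union>C" "(\<Sum>y\<in>F. k y \<odot> v y) = 0"
      obtain Y where "Y \<in> C" "F \<subseteq> Y"
        using finite_subset_Union_chain[OF F(1,2) C] by blast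
      then show "\<forall>y\<in>F. int p dvd k y" using F sub by (auto simp: \<A>_def intro: indep_modD)
    qed
    with sub show ?thesis by (auto simp: \<A>_def)
  qed
  ultimately obtain Y where Y: "Y \<in> \<A>" and max: "\<And>Y'. Y' \<in> \<A> \<Longrightarrow> Y \<subseteq> Y' \<Longrightarrow> Y' = Y"
    using subset_Zorn_nonempty[of \<A>] by blast
  show ?thesis
  proof (rule that)
    show Y': "Y \<subseteq> X" "indep_mod p Y v" using Y by (auto simp: \<A>_def)
    fix x assume x: "x \<in> X"
    show "\<exists>m. \<not> int p dvd m \<and> m \<odot> v x \<in> Z.span (v ` Y)"
    proof (cases "x \<in> Y")
      case True
      then show ?thesis using p by (intro exI[of _ 1]) (auto intro: Z.span_base)
    next
      case False
      then have "insert x Y \<notin> \<A>" using max by blast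
      then obtain F k y where F: "finite F" "F \<subseteq> insert x Y" "(\<Sum>y\<in>F. k y \<odot> v y) = 0"
        and y: "y \<in> F" "\<not> int p dvd k y"
        using x Y' by (auto simp: \<A>_def indep_mod_def)
      have xF: "x \<in> F" using F y Y' indep_modD[OF Y'(2) F(1), of k] by blast
      have eq: "k x \<odot> v x + (\<Sum>y\<in>F - {x}. k y \<odot> v y) = 0"
        using F(3) sum.remove[OF F(1) xF, of "\<lambda>y. k y \<odot> v y"] by simp
      have "\<not> int p dvd k x"
      proof
        assume dvd: "int p dvd k x"
        then obtain j where "k x = j * int p" by (metis dvdE mult.commute)
        then have "k x \<odot> v x = 0" using v[OF x] by (simp add: zmul_assoc[symmetric])
        with eq have "(\<Sum>y\<in>F - {x}. k y \<odot> v y) = 0" by simp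
        then have "int p dvd k z" if "z \<in> F - {x}" for z
          using indep_modD[OF Y'(2), of "F - {x}" k z] F that by auto
        with dvd y show False by blast
      qed
      moreover have "k x \<odot> v x = - (\<Sum>y\<in>F - {x}. k y \<odot> v y)"
        using eq by (simp add: eq_neg_iff_add_eq_0)
      moreover have "(\<Sum>y\<in>F - {x}. k y \<odot> v y) \<in> Z.span (v ` Y)"
        using F(2) by (intro Z.span_sum Z.span_scale Z.span_base) auto
      ultimately show ?thesis by (intro exI[of _ "k x"]) (simp add: Z.span_neg)
    qed
  qed
qed

lemma zmul_cancel_prime:
  assumes p: "prime p" "\<not> int p dvd m" "int p \<odot> x = 0" and x: "m \<odot> x \<in> Z.span B"
  shows "x \<in> Z.span B"
proof -
  have "coprime m (int p)"
    using p(1,2) prime_imp_coprime[of "int p" m] by (simp add: coprime_commute)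
  then obtain a b where "a * m + b * int p = 1" using bezout_int[of m "int p"] by (auto simp: coprime_iff_gcd_eq_1)
  then have "x = a \<odot> (m \<odot> x) + b \<odot> (int p \<odot> x)"
    by (metis zmul_1 zmul_add_left zmul_assoc)
  with p(3) have "x = a \<odot> (m \<odot> x)" by simp
  then show ?thesis using x by (metis Z.span_scale)
qed

lemma countable_zmul_preimage:
  fixes \<Gamma> :: "'g::ab_group_add set"
  assumes \<Gamma>: "add_subgroup \<Gamma>" and B: "countable B" and T: "countable {x \<in> \<Gamma>. k \<odot> x = 0}"
  shows "countable {x \<in> \<Gamma>. k \<odot> x \<in> B}"
proof -
  have "countable {x \<in> \<Gamma>. k \<odot> x = y}" for y
  proof (cases "\<exists>x0\<in>\<Gamma>. k \<odot> x0 = y")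
    case True
    then obtain x0 where x0: "x0 \<in> \<Gamma>" "k \<odot> x0 = y" by blast
    have "{x \<in> \<Gamma>. k \<odot> x = y} \<subseteq> (\<lambda>t. x0 + t) ` {x \<in> \<Gamma>. k \<odot> x = 0}"
    proof
      fix x assume "x \<in> {x \<in> \<Gamma>. k \<odot> x = y}"
      then have x: "x \<in> \<Gamma>" "k \<odot> x = y" by auto
      then have "k \<odot> (- x0 + x) = 0" using x0 unfolding zmul_add_right by simp
      moreover have "- x0 + x \<in> \<Gamma>" using x0(1) x(1) \<Gamma> unfolding add_subgroup_def by blast
      ultimately show "x \<in> (\<lambda>t. x0 + t) ` {x \<in> \<Gamma>. k \<odot> x = 0}"
        by (intro image_eqI[of _ _ "- x0 + x"]) auto
    qed
    from countable_subset[OF this countable_image[OF T]] show ?thesis .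
  next
    case False
    then have eq: "{x \<in> \<Gamma>. k \<odot> x = y} = {}" by blast
    show ?thesis unfolding eq by simp
  qed
  then have "countable (\<Union>y\<in>B. {x \<in> \<Gamma>. k \<odot> x = y})" using B by blast
  moreover have "{x \<in> \<Gamma>. k \<odot> x \<in> B} = (\<Union>y\<in>B. {x \<in> \<Gamma>. k \<odot> x = y})" by blast
  ultimately show ?thesis by simp
qed

text \<open>Multiplication by a prime factor \<open>p\<close> of \<open>m\<close> maps the \<open>m\<close>-torsion into the \<open>(m/p)\<close>-torsion, and its fibres
are cosets of the \<open>p\<close>-torsion.\<close>

lemma countable_torsion:
  fixes \<Gamma> :: "'g::ab_group_add set"
  assumes \<Gamma>: "add_subgroup \<Gamma>" and T: "\<And>p. prime p \<Longrightarrow> countable {x \<in> \<Gamma>. int p \<odot> x = 0}"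
  shows "0 < m \<Longrightarrow> countable {x \<in> \<Gamma>. int m \<odot> x = 0}"
proof (induction m rule: less_induct)
  case (less m)
  show ?case
  proof (cases "m = 1")
    case True
    then have "{x \<in> \<Gamma>. int m \<odot> x = 0} \<subseteq> {0}" by auto
    from countable_subset[OF this] show ?thesis by simp
  next
    case False
    then obtain p where p: "prime p" "p dvd m" using prime_factor_nat by blast
    then obtain n where n: "m = n * p" by (metis dvdE mult.commute)
    then have "0 < n" using less.prems by simp
    moreover have "n * 1 < n * p" using \<open>0 < n\<close> prime_gt_1_nat[OF p(1)] by simp
    ultimately have "0 < n" "n < m" unfolding n by simp_all
    note countable_zmul_preimage[OF \<Gamma> less.IH[OF this(2,1)] T[OF p(1)]]
    moreover have "{x \<in> \<Gamma>. int m \<odot> x = 0} \<subseteq> {x \<in> \<Gamma>. int p \<odot> x \<in> {x \<in> \<Gamma>. int n \<odot> x = 0}}"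
    proof
      fix x assume x: "x \<in> {x \<in> \<Gamma>. int m \<odot> x = 0}"
      then have "int p \<odot> x \<in> \<Gamma>" using zmul_hom[OF \<Gamma>, of "\<lambda>x. x" x "int p"] by simp
      moreover have "int n \<odot> int p \<odot> x = 0" unfolding zmul_assoc using x n by simp
      ultimately show "x \<in> {x \<in> \<Gamma>. int p \<odot> x \<in> {x \<in> \<Gamma>. int n \<odot> x = 0}}" using x by simp
    qed
    ultimately show ?thesis by (rule countable_subset[rotated])
  qed
qed

text \<open>If the \<open>p\<close>-torsion is uncountable for some prime \<open>p\<close>, a basis of it will do. Otherwise all torsion is
countable, so countably many elements account for only countably many others of which some nonzero
multiple lies in their span; hence a maximal family that is independent over the integers is uncountable.\<close>

lemma uncountable_indep:
  fixes \<Gamma> :: "'g::ab_group_add set"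
  assumes \<Gamma>: "add_subgroup \<Gamma>" and unc: "uncountable \<Gamma>"
  obtains p Y where "p = 0 \<or> prime p" "Y \<subseteq> \<Gamma>" "uncountable Y" "indep_mod p Y (\<lambda>x. x)"
    "\<And>y. y \<in> Y \<Longrightarrow> int p \<odot> y = 0"
proof (cases "\<exists>p. prime p \<and> uncountable {x \<in> \<Gamma>. int p \<odot> x = 0}")
  case True
  then obtain p where p: "prime p" "uncountable {x \<in> \<Gamma>. int p \<odot> x = 0}" by blast
  have "p \<noteq> 1" using p(1) by auto
  then obtain Y where Y: "Y \<subseteq> {x \<in> \<Gamma>. int p \<odot> x = 0}" "indep_mod p Y (\<lambda>x. x)"
    "\<And>x. x \<in> {x \<in> \<Gamma>. int p \<odot> x = 0} \<Longrightarrow> \<exists>m. \<not> int p dvd m \<and> m \<odot> x \<in> Z.span ((\<lambda>x. x) ` Y)"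
    by (rule maximal_indep[of p "{x \<in> \<Gamma>. int p \<odot> x = 0}" "\<lambda>x. x"]) (simp, blast intro: that)
  have "{x \<in> \<Gamma>. int p \<odot> x = 0} \<subseteq> Z.span Y"
  proof
    fix x assume x: "x \<in> {x \<in> \<Gamma>. int p \<odot> x = 0}"
    obtain m where "\<not> int p dvd m" "m \<odot> x \<in> Z.span Y" using Y(3)[OF x] by auto
    with x show "x \<in> Z.span Y" using zmul_cancel_prime[OF p(1), of m x Y] by simp
  qed
  then have "uncountable Y" using p(2) countable_subset[OF _ countable_span] by metis
  then show ?thesis using Y p by (intro that[of p Y]) auto
next
  case False
  have "(0::nat) \<noteq> 1" by simp
  then obtain Y where Y: "Y \<subseteq> \<Gamma>" "indep_mod 0 Y (\<lambda>x. x)"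
    "\<And>x. x \<in> \<Gamma> \<Longrightarrow> \<exists>m. \<not> int 0 dvd m \<and> m \<odot> x \<in> Z.span ((\<lambda>x. x) ` Y)"
    by (rule maximal_indep[of 0 \<Gamma> "\<lambda>x. x"]) (simp, blast intro: that)
  have "uncountable Y"
  proof
    assume "countable Y"
    then have span: "countable (Z.span Y)" by (rule countable_span)
    have "countable {x \<in> \<Gamma>. m \<odot> x \<in> Z.span Y}" if "m \<noteq> 0" for m
    proof (rule countable_zmul_preimage[OF \<Gamma> span])
      have "countable {x \<in> \<Gamma>. int (nat \<bar>m\<bar>) \<odot> x = 0}"
      proof (rule countable_torsion[OF \<Gamma>])
        show "countable {x \<in> \<Gamma>. int q \<odot> x = 0}" if "prime q" for q using False that by blast
        show "0 < nat \<bar>m\<bar>" using that by simp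
      qed
      moreover have "int (nat \<bar>m\<bar>) \<odot> x = 0 \<longleftrightarrow> m \<odot> x = 0" for x :: 'g
        by (cases "0 \<le> m") auto
      ultimately show "countable {x \<in> \<Gamma>. m \<odot> x = 0}" by simp
    qed
    then have "countable (\<Union>m\<in>{m. m \<noteq> 0}. {x \<in> \<Gamma>. m \<odot> x \<in> Z.span Y})" by blast
    moreover have "\<Gamma> \<subseteq> (\<Union>m\<in>{m. m \<noteq> 0}. {x \<in> \<Gamma>. m \<odot> x \<in> Z.span Y})"
    proof
      fix x assume x: "x \<in> \<Gamma>"
      obtain m where "\<not> int 0 dvd m" "m \<odot> x \<in> Z.span Y" using Y(3)[OF x] by auto
      with x show "x \<in> (\<Union>m\<in>{m. m \<noteq> 0}. {x \<in> \<Gamma>. m \<odot> x \<in> Z.span Y})" by auto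
    qed
    ultimately have "countable \<Gamma>" by (rule countable_subset[rotated])
    with unc show False by simp
  qed
  then show ?thesis using Y by (intro that[of 0 Y]) auto
qed

section \<open>Simultaneous approximation by independent homomorphisms\<close>

text \<open>The average of a nontrivial character over a long arithmetic progression is small, and averaging
over further progressions does not undo what has been achieved for other characters. The finite
averages replace an invariant mean on \<open>A\<close>.\<close>

lemma small_averages:
  fixes A :: "'g::ab_group_add set" and \<Theta> :: "('g \<Rightarrow> circle) set" and \<epsilon> :: real
  assumes A: "add_subgroup A" and "finite \<Theta>" "0 < \<epsilon>"
    and hom: "\<And>\<theta> x y. \<theta> \<in> \<Theta> \<Longrightarrow> x \<in> A \<Longrightarrow> y \<in> A \<Longrightarrow> \<theta> (x + y) = \<theta> x + \<theta> y"
    and nontriv: "\<And>\<theta>. \<theta> \<in> \<Theta> \<Longrightarrow> \<exists>a\<in>A. \<theta> a \<noteq> 0"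
  shows "\<exists>L. L \<noteq> [] \<and> set L \<subseteq> A \<and> (\<forall>\<theta>\<in>\<Theta>. norm (\<Sum>a\<leftarrow>L. e_circle (\<theta> a)) \<le> \<epsilon> * length L)"
  using assms(2) hom nontriv
proof (induction \<Theta> rule: finite_induct)
  case empty
  show ?case using A by (intro exI[of _ "[0]"]) (auto simp: add_subgroup_def)
next
  case (insert \<theta> \<Theta>)
  have "\<exists>L. L \<noteq> [] \<and> set L \<subseteq> A \<and> (\<forall>\<theta>\<in>\<Theta>. norm (\<Sum>a\<leftarrow>L. e_circle (\<theta> a)) \<le> \<epsilon> * length L)"
    by (rule insert.IH) (use insert.prems in auto)
  then obtain L where L: "L \<noteq> []" "set L \<subseteq> A" "\<And>\<theta>. \<theta> \<in> \<Theta> \<Longrightarrow> norm (\<Sum>a\<leftarrow>L. e_circle (\<theta> a)) \<le> \<epsilon> * length L"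
    by blast
  obtain a where a: "a \<in> A" "\<theta> a \<noteq> 0" using insert.prems(2)[of \<theta>] by auto
  define z where "z = e_circle (\<theta> a)"
  have z: "z \<noteq> 1" "norm z = 1" using a by (simp_all add: z_def e_eq_1_iff)
  obtain J where J: "2 / norm (z - 1) / \<epsilon> < real J" using reals_Archimedean2 by blast
  have J0: "0 < J"
  proof -
    have "0 < 2 / norm (z - 1) / \<epsilon>" using z \<open>0 < \<epsilon>\<close> by simp
    with J have "0 < real J" by linarith
    then show ?thesis by simp
  qed
  define L' where "L' = concat (map (\<lambda>j. map (\<lambda>l. l + int j \<odot> a) L) [0..<J])"
  have len: "length L' = J * length L"
    by (simp add: L'_def length_concat comp_def sum_list_triv)
  have sub: "set L' \<subseteq> A"
    using L(2) a(1) A zmul_hom[OF A, of "\<lambda>x. x"] by (auto simp: L'_def add_subgroup_def)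
  have fact: "(\<Sum>x\<leftarrow>L'. e_circle (\<eta> x)) = (\<Sum>l\<leftarrow>L. e_circle (\<eta> l)) * (\<Sum>j<J. e_circle (\<eta> a) ^ j)"
    if \<eta>: "\<And>x y. x \<in> A \<Longrightarrow> y \<in> A \<Longrightarrow> \<eta> (x + y) = \<eta> x + \<eta> y" for \<eta> :: "'g \<Rightarrow> circle"
  proof -
    have "e_circle (\<eta> (l + int j \<odot> a)) = e_circle (\<eta> l) * e_circle (\<eta> a) ^ j" if "l \<in> A" for l j
      using that \<eta> zmul_hom[OF A \<eta> a(1), of "int j"] by (simp add: e_add e_of_nat)
    then have inner: "(\<Sum>l\<leftarrow>L. e_circle (\<eta> (l + int j \<odot> a))) = (\<Sum>l\<leftarrow>L. e_circle (\<eta> l)) * e_circle (\<eta> a) ^ j" for j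
      using L(2) by (induction L) (auto simp: distrib_right)
    have "(\<Sum>x\<leftarrow>concat (map (\<lambda>j. map (\<lambda>l. l + int j \<odot> a) L) [0..<k]). e_circle (\<eta> x)) =
        (\<Sum>l\<leftarrow>L. e_circle (\<eta> l)) * (\<Sum>j<k. e_circle (\<eta> a) ^ j)" for k
      by (induction k) (simp_all add: comp_def inner distrib_left)
    then show ?thesis by (simp add: L'_def)
  qed
  show ?case
  proof (intro exI[of _ L'] conjI ballI)
    show "L' \<noteq> []" using len J0 L(1) by auto
    show "set L' \<subseteq> A" by (rule sub)
    fix \<eta> assume "\<eta> \<in> insert \<theta> \<Theta>"
    then consider "\<eta> = \<theta>" | "\<eta> \<in> \<Theta>" by blast
    then show "norm (\<Sum>x\<leftarrow>L'. e_circle (\<eta> x)) \<le> \<epsilon> * length L'"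
    proof cases
      case 1
      have triv: "norm (\<Sum>l\<leftarrow>L. e_circle (\<eta> l)) \<le> length L"
      proof (induction L)
        case (Cons l L)
        then show ?case using norm_triangle_ineq[of "e_circle (\<eta> l)" "\<Sum>l\<leftarrow>L. e_circle (\<eta> l)"] by simp
      qed simp
      have "norm (\<Sum>j<J. z ^ j) = norm (z ^ J - 1) / norm (z - 1)"
        using z by (simp add: geometric_sum norm_divide)
      also have "\<dots> \<le> 2 / norm (z - 1)"
        using norm_triangle_ineq4[of "z ^ J" 1] z by (intro divide_right_mono) (simp_all add: norm_power)
      also have "\<dots> \<le> \<epsilon> * J"
        using J unfolding pos_divide_less_eq[OF \<open>0 < \<epsilon>\<close>] by (simp add: mult.commute)
      finally have "norm (\<Sum>l\<leftarrow>L. e_circle (\<eta> l)) * norm (\<Sum>j<J. z ^ j) \<le> length L * (\<epsilon> * J)"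
        using triv by (intro mult_mono) auto
      moreover have "norm (\<Sum>x\<leftarrow>L'. e_circle (\<eta> x)) = norm (\<Sum>l\<leftarrow>L. e_circle (\<eta> l)) * norm (\<Sum>j<J. z ^ j)"
        using fact[of \<eta>] insert.prems(1) 1 by (simp add: norm_mult z_def)
      ultimately show ?thesis by (simp add: len mult_ac)
    next
      case 2
      have "norm (\<Sum>j<J. e_circle (\<eta> a) ^ j) \<le> J"
        using norm_sum[of "\<lambda>j. e_circle (\<eta> a) ^ j" "{..<J}"] by (simp add: norm_power)
      then have "norm (\<Sum>l\<leftarrow>L. e_circle (\<eta> l)) * norm (\<Sum>j<J. e_circle (\<eta> a) ^ j) \<le> \<epsilon> * length L * J"
        using L(3)[OF 2] \<open>0 < \<epsilon>\<close> by (intro mult_mono) auto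
      moreover have "norm (\<Sum>x\<leftarrow>L'. e_circle (\<eta> x)) =
          norm (\<Sum>l\<leftarrow>L. e_circle (\<eta> l)) * norm (\<Sum>j<J. e_circle (\<eta> a) ^ j)"
        using fact[of \<eta>] insert.prems(1) 2 by (simp add: norm_mult)
      ultimately show ?thesis by (simp add: len mult_ac)
    qed
  qed
qed

lemma power_beats_polynomial:
  fixes r :: real
  assumes "0 \<le> r" "r < 1" "0 < n"
  shows "\<exists>N. 2 * (real N + 1) ^ n * r ^ N < 1"
proof -
  define \<rho> where "\<rho> = root n r"
  have \<rho>: "0 \<le> \<rho>" "\<rho> < 1" "\<rho> ^ n = r"
    using assms real_root_lt_1_iff[of n r] by (auto simp: \<rho>_def)
  have "(\<lambda>N. of_nat N * \<rho> ^ N) \<longlonglongrightarrow> 0"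
    using \<rho> by (intro powser_times_n_limit_0) auto
  then have "\<forall>\<^sub>F N in sequentially. real N * \<rho> ^ N < 1 / 8"
    by (rule order_tendstoD) simp
  then have "\<forall>\<^sub>F N in sequentially. 0 < N \<and> real N * \<rho> ^ N < 1 / 8"
    using eventually_gt_at_top[of 0] by eventually_elim simp
  then obtain N where N: "0 < N" "real N * \<rho> ^ N < 1 / 8" by (auto simp: eventually_sequentially)
  have "(real N + 1) * \<rho> ^ N \<le> (2 * real N) * \<rho> ^ N"
    using N(1) \<rho>(1) by (intro mult_right_mono) auto
  then have "(real N + 1) * \<rho> ^ N \<le> 1 / 4" using N(2) by simp
  then have "((real N + 1) * \<rho> ^ N) ^ n \<le> (1 / 4) ^ n" using \<rho>(1) by (intro power_mono) auto
  also have "\<dots> \<le> (1 / 4) ^ 1" using assms(3) by (intro power_decreasing) auto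
  finally have "(real N + 1) ^ n * (\<rho> ^ n) ^ N \<le> 1 / 4"
    by (simp add: power_mult_distrib power_mult[symmetric] mult.commute)
  then show ?thesis using \<rho>(3) by (intro exI[of _ N]) simp
qed

lemma e_plus_1_bound:
  assumes "0 < \<epsilon>"
  obtains r where "0 \<le> r" "r < 1" "\<And>x. \<epsilon> \<le> dist x 0 \<Longrightarrow> (norm ((1 + e_circle x) / 2))\<^sup>2 \<le> r"
    "\<And>x. (norm ((1 + e_circle x) / 2))\<^sup>2 \<le> 1"
proof -
  obtain \<delta> where \<delta>: "0 < \<delta>" "\<And>x. norm (e_circle x - 1) < \<delta> \<Longrightarrow> dist x 0 < \<epsilon>"
    using assms by (rule dist_0_small) (blast intro: that)
  have par: "(norm ((1 + e_circle x) / 2))\<^sup>2 = 1 - (norm (e_circle x - 1))\<^sup>2 / 4" for x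
  proof -
    have "(norm (1 + e_circle x))\<^sup>2 + (norm (e_circle x - 1))\<^sup>2 = 4"
    proof -
      define t where "t = 2 * pi * rep_circle x"
      have "(norm (1 + cis t))\<^sup>2 = (1 + cos t)\<^sup>2 + (sin t)\<^sup>2"
        and "(norm (cis t - 1))\<^sup>2 = (cos t - 1)\<^sup>2 + (sin t)\<^sup>2" by (simp_all add: cmod_power2)
      then have "(norm (1 + cis t))\<^sup>2 + (norm (cis t - 1))\<^sup>2 = 4"
        using sin_cos_squared_add[of t] by (simp add: power2_eq_square algebra_simps)
      then show ?thesis by (simp add: e_circle_def t_def)
    qed
    then show ?thesis by (simp add: norm_divide power_divide field_simps)
  qed
  show ?thesis
  proof (rule that[of "max 0 (1 - \<delta>\<^sup>2 / 4)"])
    show "max 0 (1 - \<delta>\<^sup>2 / 4) < 1" using \<delta>(1) by simp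
    fix x :: circle
    show "(norm ((1 + e_circle x) / 2))\<^sup>2 \<le> 1" unfolding par by simp
    assume "\<epsilon> \<le> dist x 0"
    then have "\<delta> \<le> norm (e_circle x - 1)" using \<delta>(2)[of x] by linarith
    then have "\<delta>\<^sup>2 \<le> (norm (e_circle x - 1))\<^sup>2" using \<delta>(1) by (intro power_mono) auto
    then show "(norm ((1 + e_circle x) / 2))\<^sup>2 \<le> max 0 (1 - \<delta>\<^sup>2 / 4)" unfolding par by simp
  qed simp
qed

text \<open>If no \<open>a\<close> works, then \<open>Q a = (\<Prod>i\<in>I. ((1 + e_circle (h i a - f i)) / 2) ^ N)\<close> satisfies
\<open>norm (Q a)\<^sup>2 \<le> r ^ N\<close> with a fixed \<open>r < 1\<close>. On the other hand, expanding \<open>Q\<close> gives convex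
coefficients \<open>c k\<close> for \<open>(N + 1) ^ card I\<close> characters. Up to a small error, a suitable average over \<open>A\<close>
kills the characters that are nontrivial on \<open>A\<close>, and by independence all others contribute a nonnegative
amount. So the average of \<open>norm (Q a)\<^sup>2\<close> is nearly at least the sum of the squares of the \<open>c k\<close>, and hence at
least a constant times \<open>(N + 1) ^ (- card I)\<close>. This decays more slowly than \<open>r ^ N\<close>.\<close>

lemma Kronecker_independent:
  fixes A :: "'g::ab_group_add set" and h :: "'i \<Rightarrow> 'g \<Rightarrow> circle" and \<epsilon> :: real
  assumes A: "add_subgroup A" and I: "finite I" and \<epsilon>: "0 < \<epsilon>"
    and hom: "\<And>i x y. i \<in> I \<Longrightarrow> x \<in> A \<Longrightarrow> y \<in> A \<Longrightarrow> h i (x + y) = h i x + h i y"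
    and f: "\<And>i. i \<in> I \<Longrightarrow> int p \<odot> f i = 0"
    and indep: "\<And>k. (\<And>a. a \<in> A \<Longrightarrow> (\<Sum>i\<in>I. k i \<odot> h i a) = 0) \<Longrightarrow> \<forall>i\<in>I. int p dvd k i"
  shows "\<exists>a\<in>A. \<forall>i\<in>I. dist (h i a) (f i) < \<epsilon>"
proof (rule ccontr)
  assume "\<not> ?thesis"
  then have far: "\<exists>i\<in>I. \<epsilon> \<le> dist (h i a - f i) 0" if "a \<in> A" for a
    using that by (metis dist_circle_diff not_le)
  have "I \<noteq> {}" using far[of 0] A by (auto simp: add_subgroup_def)
  then have n: "0 < card I" using I by (simp add: card_gt_0_iff)
  obtain r where r: "0 \<le> r" "r < 1" "\<And>x. \<epsilon> \<le> dist x 0 \<Longrightarrow> (norm ((1 + e_circle x) / 2))\<^sup>2 \<le> r"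
    "\<And>x. (norm ((1 + e_circle x) / 2))\<^sup>2 \<le> 1"
    using \<epsilon> by (rule e_plus_1_bound) (blast intro: that)
  obtain N where N: "2 * (real N + 1) ^ card I * r ^ N < 1"
    using power_beats_polynomial[OF r(1,2) n] by blast
  define B where "B = (\<Pi>\<^sub>E i\<in>I. {..N})"
  have B: "finite B" "real (card B) = (real N + 1) ^ card I"
    unfolding B_def using I by (auto intro!: finite_PiE simp: card_PiE add.commute)
  define b where "b j = real (N choose j) / 2 ^ N" for j
  define c where "c k = (\<Prod>i\<in>I. b (k i))" for k :: "'i \<Rightarrow> nat"
  have c_nonneg: "0 \<le> c k" for k unfolding c_def b_def by (intro prod_nonneg) auto
  have binom: "((1 + z) / 2) ^ N = (\<Sum>j\<le>N. of_real (b j) * z ^ j)" for z :: complex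
  proof -
    have "((1 + z) / 2) ^ N = (z + 1) ^ N / 2 ^ N" by (simp add: power_divide add.commute)
    also have "\<dots> = (\<Sum>j\<le>N. of_real (b j) * z ^ j)"
      by (simp add: binomial_ring sum_divide_distrib b_def)
    finally show ?thesis .
  qed
  have c_sum: "(\<Sum>k\<in>B. c k) = 1"
  proof -
    have "complex_of_real (\<Sum>j\<le>N. b j) = 1" using binom[of 1] by simp
    then have "(\<Sum>j\<le>N. b j) = 1" by (metis of_real_eq_1_iff)
    moreover have "(\<Prod>i\<in>I. \<Sum>j\<le>N. b j) = (\<Sum>k\<in>B. c k)"
      unfolding c_def B_def using I by (intro prod_sum_PiE) auto
    ultimately show ?thesis by simp
  qed
  define Q where "Q a = (\<Prod>i\<in>I. ((1 + e_circle (h i a - f i)) / 2) ^ N)" for a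
  define \<psi> where "\<psi> k l a = (\<Sum>i\<in>I. (int (k i) - int (l i)) \<odot> h i a)" for k l :: "'i \<Rightarrow> nat" and a
  define \<phi> where "\<phi> k l = (\<Sum>i\<in>I. (int (k i) - int (l i)) \<odot> f i)" for k l :: "'i \<Rightarrow> nat"
  have Q_small: "(norm (Q a))\<^sup>2 \<le> r ^ N" if a: "a \<in> A" for a
  proof -
    obtain i where i: "i \<in> I" "\<epsilon> \<le> dist (h i a - f i) 0" using far[OF a] by blast
    define w where "w i = (norm ((1 + e_circle (h i a - f i)) / 2))\<^sup>2" for i
    have w_nonneg: "0 \<le> w j" and w_le: "w j \<le> 1" for j unfolding w_def by (simp, rule r(4))
    have "(norm (Q a))\<^sup>2 = (\<Prod>i\<in>I. w i ^ N)"
      by (simp add: Q_def w_def prod_norm[symmetric] norm_power prod_power_distrib power_mult[symmetric] mult.commute)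
    also have "\<dots> = w i ^ N * (\<Prod>i\<in>I - {i}. w i ^ N)" by (rule prod.remove[OF I i(1)])
    also have "\<dots> \<le> r ^ N * 1"
    proof (intro mult_mono power_mono prod_le_1)
      show "w i \<le> r" unfolding w_def by (rule r(3)[OF i(2)])
    qed (auto simp: w_nonneg r intro!: power_le_one w_le prod_nonneg)
    finally show ?thesis by simp
  qed
  have Q_expand: "complex_of_real ((norm (Q a))\<^sup>2) =
      (\<Sum>k\<in>B. \<Sum>l\<in>B. of_real (c k * c l) * (cnj (e_circle (\<phi> k l)) * e_circle (\<psi> k l a)))" for a
  proof -
    have "Q a = (\<Prod>i\<in>I. \<Sum>j\<le>N. of_real (b j) * e_circle (h i a - f i) ^ j)"
      by (simp add: Q_def binom)
    also have "\<dots> = (\<Sum>k\<in>B. \<Prod>i\<in>I. of_real (b (k i)) * e_circle (h i a - f i) ^ k i)"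
      unfolding B_def using I by (intro prod_sum_PiE) auto
    also have "\<dots> = (\<Sum>k\<in>B. of_real (c k) * e_circle (\<Sum>i\<in>I. int (k i) \<odot> (h i a - f i)))"
      by (simp add: c_def prod.distrib e_sum e_of_nat)
    finally have Q: "Q a = (\<Sum>k\<in>B. of_real (c k) * e_circle (\<Sum>i\<in>I. int (k i) \<odot> (h i a - f i)))" .
    have diff: "e_circle (\<Sum>i\<in>I. int (k i) \<odot> (h i a - f i)) * cnj (e_circle (\<Sum>i\<in>I. int (l i) \<odot> (h i a - f i))) =
        cnj (e_circle (\<phi> k l)) * e_circle (\<psi> k l a)" for k l
    proof -
      have "(\<Sum>i\<in>I. int (k i) \<odot> (h i a - f i)) - (\<Sum>i\<in>I. int (l i) \<odot> (h i a - f i)) = \<psi> k l a - \<phi> k l"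
        unfolding \<psi>_def \<phi>_def sum_subtractf[symmetric]
        by (intro sum.cong refl) (simp add: Z.scale_left_diff_distrib Z.scale_right_diff_distrib)
      then show ?thesis by (metis e_diff mult.commute)
    qed
    have "complex_of_real ((norm (Q a))\<^sup>2) = Q a * cnj (Q a)" by (rule complex_norm_square)
    also have "\<dots> = (\<Sum>k\<in>B. \<Sum>l\<in>B. of_real (c k * c l) *
        (e_circle (\<Sum>i\<in>I. int (k i) \<odot> (h i a - f i)) * cnj (e_circle (\<Sum>i\<in>I. int (l i) \<odot> (h i a - f i)))))"
      unfolding Q cnj_sum sum_product by (intro sum.cong refl) (simp add: mult_ac)
    finally show ?thesis by (simp only: diff)
  qed
  define \<eta> where "\<eta> = 1 / (2 * real (card B))"
  have card_B: "0 < real (card B)" using B(2) by simp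
  then have \<eta>: "0 < \<eta>" by (simp add: \<eta>_def)
  \<comment> \<open>The characters occurring in the expansion of \<open>norm (Q a)\<^sup>2\<close> that have to be averaged out.\<close>
  define \<Theta> where "\<Theta> = {\<theta> \<in> (\<lambda>(k, l). \<psi> k l) ` (B \<times> B). \<exists>a\<in>A. \<theta> a \<noteq> 0}"
  have \<psi>_hom: "\<psi> k l (x + y) = \<psi> k l x + \<psi> k l y" if "x \<in> A" "y \<in> A" for k l x y
    unfolding \<psi>_def sum.distrib[symmetric] using that by (intro sum.cong refl) (simp add: hom zmul_add_right)
  have "\<exists>L. L \<noteq> [] \<and> set L \<subseteq> A \<and> (\<forall>\<theta>\<in>\<Theta>. norm (\<Sum>a\<leftarrow>L. e_circle (\<theta> a)) \<le> \<eta> * length L)"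
  proof (rule small_averages[OF A _ \<eta>])
    show "finite \<Theta>" unfolding \<Theta>_def using B(1) by simp
  qed (auto simp: \<Theta>_def \<psi>_hom)
  then obtain L where L: "L \<noteq> []" "set L \<subseteq> A"
    "\<And>\<theta>. \<theta> \<in> \<Theta> \<Longrightarrow> norm (\<Sum>a\<leftarrow>L. e_circle (\<theta> a)) \<le> \<eta> * length L" by blast
  define M where "M = real (length L)"
  have M: "0 < M" using L(1) by (simp add: M_def)
  define S where "S k l = cnj (e_circle (\<phi> k l)) * (\<Sum>a\<leftarrow>L. e_circle (\<psi> k l a))" for k l
  have term_ge: "M * ((if k = l then 1 else 0) - \<eta>) \<le> Re (S k l)" if kl: "k \<in> B" "l \<in> B" for k l
  proof (cases "\<exists>a\<in>A. \<psi> k l a \<noteq> 0")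
    case True
    then have "\<psi> k l \<in> \<Theta>" using kl by (auto simp: \<Theta>_def)
    then have "norm (S k l) \<le> \<eta> * M" using L(3) by (simp add: S_def norm_mult M_def)
    moreover have "k \<noteq> l" using True by (auto simp: \<psi>_def)
    ultimately show ?thesis using abs_Re_le_cmod[of "S k l"] by (simp add: algebra_simps abs_le_iff)
  next
    case False
    then have "\<forall>i\<in>I. int p dvd int (k i) - int (l i)"
      using indep[of "\<lambda>i. int (k i) - int (l i)"] by (auto simp: \<psi>_def)
    have "\<phi> k l = 0"
      unfolding \<phi>_def
    proof (rule sum.neutral, rule ballI)
      fix i assume i: "i \<in> I"
      then obtain j where "int (k i) - int (l i) = j * int p"
        using \<open>\<forall>i\<in>I. int p dvd int (k i) - int (l i)\<close> by (metis dvdE mult.commute)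
      then show "(int (k i) - int (l i)) \<odot> f i = 0" using f[OF i] by (simp add: zmul_assoc[symmetric] del: Z.scale_scale)
    qed
    moreover have "(\<Sum>a\<leftarrow>L. e_circle (\<psi> k l a)) = M"
    proof -
      have "(\<Sum>a\<leftarrow>L. e_circle (\<psi> k l a)) = (\<Sum>a\<leftarrow>L. 1)"
        using False L(2) by (intro arg_cong[where f = sum_list] map_cong refl) auto
      then show ?thesis by (simp add: M_def sum_list_triv)
    qed
    ultimately have "S k l = M" by (simp add: S_def)
    then show ?thesis using M \<eta> by (auto simp: algebra_simps)
  qed
  have "M * \<eta> \<le> M * ((\<Sum>k\<in>B. (c k)\<^sup>2) - \<eta>)"
  proof -
    have "(\<Sum>k\<in>B. c k)\<^sup>2 \<le> real (card B) * (\<Sum>k\<in>B. (c k)\<^sup>2)"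
      using sum_squared_le_sum_of_squares[of c B] by (simp add: mult.commute)
    then have "2 * \<eta> \<le> (\<Sum>k\<in>B. (c k)\<^sup>2)" using card_B by (simp add: c_sum \<eta>_def field_simps)
    then show ?thesis using M by (intro mult_left_mono) auto
  qed
  also have "\<dots> = (\<Sum>k\<in>B. \<Sum>l\<in>B. c k * c l * (M * ((if k = l then 1 else 0) - \<eta>)))"
  proof -
    have "(\<Sum>l\<in>B. c k * c l * (M * ((if k = l then 1 else 0) - \<eta>))) = M * (c k)\<^sup>2 - M * \<eta> * c k" if "k \<in> B" for k
    proof -
      have "(\<Sum>l\<in>B. c k * c l * (M * ((if k = l then 1 else 0) - \<eta>))) =
          (\<Sum>l\<in>B. (if k = l then M * (c k)\<^sup>2 else 0) - M * \<eta> * c k * c l)"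
        by (intro sum.cong refl) (auto simp: algebra_simps power2_eq_square)
      also have "\<dots> = M * (c k)\<^sup>2 - M * \<eta> * c k * (\<Sum>l\<in>B. c l)"
        using B(1) that by (simp add: sum_subtractf sum_distrib_left)
      finally show ?thesis by (simp add: c_sum)
    qed
    then have "(\<Sum>k\<in>B. \<Sum>l\<in>B. c k * c l * (M * ((if k = l then 1 else 0) - \<eta>))) =
        M * (\<Sum>k\<in>B. (c k)\<^sup>2) - M * \<eta> * (\<Sum>k\<in>B. c k)"
      by (simp add: sum_subtractf sum_distrib_left)
    then show ?thesis by (simp add: c_sum algebra_simps)
  qed
  also have "\<dots> \<le> (\<Sum>k\<in>B. \<Sum>l\<in>B. c k * c l * Re (S k l))"
    using c_nonneg by (intro sum_mono mult_left_mono term_ge) auto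
  also have "\<dots> = Re (\<Sum>k\<in>B. \<Sum>l\<in>B. of_real (c k * c l) * S k l)" by simp
  also have "(\<Sum>k\<in>B. \<Sum>l\<in>B. of_real (c k * c l) * S k l) = (\<Sum>a\<leftarrow>L. complex_of_real ((norm (Q a))\<^sup>2))"
    unfolding Q_expand S_def
  proof (induction L)
    case (Cons a L)
    then show ?case by (simp only: list.map sum_list.Cons sum.distrib[symmetric] distrib_left[symmetric]
        Cons[symmetric]) 
  qed simp
  also have "Re \<dots> \<le> M * r ^ N"
  proof -
    have "Re (\<Sum>a\<leftarrow>L. complex_of_real ((norm (Q a))\<^sup>2)) \<le> real (length L) * r ^ N"
      using L(2)
    proof (induction L)
      case (Cons a L)
      then show ?case using Q_small[of a] by (simp add: distrib_right)
    qed simp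
    then show ?thesis by (simp add: M_def)
  qed
  finally have "\<eta> \<le> r ^ N" using M by simp
  then have "1 \<le> 2 * real (card B) * r ^ N" using card_B by (simp add: \<eta>_def field_simps)
  with N B(2) show False by simp
qed

section \<open>Test groups on the circle\<close>

text \<open>A countable group of measurable functions of period \<open>1\<close>, written as functions on the reals. The
condition \<open>shift\<close> forces every nonzero \<open>e_circle \<circ> \<psi>\<close> to have integral \<open>0\<close> over a period, which makes the
functions \<open>e_circle \<circ> \<psi>\<close> for \<open>\<psi> \<in> D\<close> orthonormal.\<close>

locale test_group =
  fixes p :: nat and D :: "(real \<Rightarrow> circle) set"
  assumes p: "p = 0 \<or> prime p"
    and subgroup: "add_subgroup D" and countable: "countable D" and infinite: "infinite D"
    and torsion: "\<And>\<psi>. \<psi> \<in> D \<Longrightarrow> int p \<odot> \<psi> = 0"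
    and cancel: "\<And>\<psi> m. \<psi> \<in> D \<Longrightarrow> \<not> int p dvd m \<Longrightarrow> m \<odot> \<psi> = 0 \<Longrightarrow> \<psi> = 0"
    and measurable: "\<And>\<psi>. \<psi> \<in> D \<Longrightarrow> (\<lambda>t. e_circle (\<psi> t)) \<in> borel_measurable borel"
    and periodic: "\<And>\<psi> t. \<psi> \<in> D \<Longrightarrow> \<psi> (t + 1) = \<psi> t"
    and shift: "\<And>\<psi>. \<psi> \<in> D \<Longrightarrow> \<psi> \<noteq> 0 \<Longrightarrow>
      \<exists>\<delta> \<theta>. 0 \<le> \<delta> \<and> \<delta> \<le> 1 \<and> \<theta> \<noteq> 0 \<and> (\<forall>t. \<psi> (t + \<delta>) = \<psi> t + \<theta>)"

lemma e_to_circle_measurable: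
  assumes "g \<in> borel_measurable borel"
  shows "(\<lambda>t. e_circle (to_circle (g t))) \<in> borel_measurable borel"
  unfolding e_to_circle
  by (rule measurable_compose[OF assms]) (intro borel_measurable_continuous_onI continuous_intros)

lemma ex_test_group_0: "test_group 0 (range (\<lambda>k::int. \<lambda>t. to_circle (of_int k * t)))"
proof
  let ?\<phi> = "\<lambda>k::int. \<lambda>t. to_circle (of_int k * t)"
  have nz: "to_circle (of_int k * (1 / (2 * \<bar>of_int k\<bar>))) \<noteq> 0" if "k \<noteq> 0" for k :: int
  proof
    assume "to_circle (of_int k * (1 / (2 * \<bar>of_int k\<bar>))) = 0"
    then obtain n where n: "of_int k * (1 / (2 * \<bar>of_int k\<bar>)) = real_of_int n"
      by (auto simp: to_circle_eq_0_iff elim: Ints_cases)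
    then have "\<bar>real_of_int n\<bar> = 1 / 2" using that by (simp add: n[symmetric] abs_mult)
    moreover have "n = 0 \<or> 1 \<le> \<bar>real_of_int n\<bar>" by linarith
    ultimately show False by auto
  qed
  have add: "?\<phi> k + ?\<phi> l = ?\<phi> (k + l)" for k l
    by (simp add: fun_eq_iff to_circle_add[symmetric] distrib_right)
  have neg: "- ?\<phi> k = ?\<phi> (- k)" for k
    by (simp add: fun_eq_iff to_circle_minus)
  have scale: "m \<odot> ?\<phi> k = ?\<phi> (m * k)" for m k
    by (simp add: fun_eq_iff to_circle_zmul[symmetric] mult.assoc)
  have inj: "inj ?\<phi>"
  proof (rule injI, rule ccontr)
    fix k l assume eq: "?\<phi> k = ?\<phi> l" and "k \<noteq> l"
    then have "?\<phi> k t - ?\<phi> l t = 0" for t by (simp add: fun_eq_iff)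
    then have "to_circle (of_int (k - l) * t) = 0" for t
      by (simp add: to_circle_diff[symmetric] left_diff_distrib)
    with nz[of "k - l"] \<open>k \<noteq> l\<close> show False by (metis eq_iff_diff_eq_0)
  qed
  show "(0::nat) = 0 \<or> prime (0::nat)" by simp
  have zero: "0 = ?\<phi> 0" by (simp add: fun_eq_iff)
  show "add_subgroup (range ?\<phi>)"
    unfolding add_subgroup_def
  proof (intro conjI ballI)
    show "0 \<in> range ?\<phi>" by (subst zero) (rule rangeI)
    fix x assume "x \<in> range ?\<phi>"
    then obtain k where k: "x = ?\<phi> k" by blast
    show "- x \<in> range ?\<phi>" unfolding k neg by (rule rangeI)
    fix y assume "y \<in> range ?\<phi>"
    then obtain l where l: "y = ?\<phi> l" by blast
    show "x + y \<in> range ?\<phi>" unfolding k l add by (rule rangeI)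
  qed
  show "countable (range ?\<phi>)" by simp
  show "infinite (range ?\<phi>)" using inj finite_imageD infinite_UNIV_int by blast
  show "int 0 \<odot> \<psi> = 0" for \<psi> :: "real \<Rightarrow> circle" by simp
  show "\<psi> = 0" if \<psi>: "\<psi> \<in> range ?\<phi>" "\<not> int 0 dvd m" "m \<odot> \<psi> = 0" for \<psi> m
  proof -
    obtain k where k: "\<psi> = ?\<phi> k" using \<psi>(1) by blast
    have "?\<phi> (m * k) = ?\<phi> 0" using \<psi>(3) unfolding k scale zero .
    from injD[OF inj this] have "m * k = 0" .
    then have "k = 0" using \<psi>(2) by simp
    then show ?thesis unfolding k zero by simp
  qed
  show "(\<lambda>t. e_circle (\<psi> t)) \<in> borel_measurable borel" if "\<psi> \<in> range ?\<phi>" for \<psi>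
    using that by (auto intro!: e_to_circle_measurable)
  show "\<psi> (t + 1) = \<psi> t" if "\<psi> \<in> range ?\<phi>" for \<psi> t
    using that by (auto simp: distrib_left)
  show "\<exists>\<delta> \<theta>. 0 \<le> \<delta> \<and> \<delta> \<le> 1 \<and> \<theta> \<noteq> 0 \<and> (\<forall>t. \<psi> (t + \<delta>) = \<psi> t + \<theta>)"
    if \<psi>: "\<psi> \<in> range ?\<phi>" "\<psi> \<noteq> 0" for \<psi>
  proof -
    obtain k where k: "\<psi> = ?\<phi> k" using \<psi>(1) by blast
    then have "k \<noteq> 0" using \<psi>(2) zero by auto
    have "1 \<le> \<bar>real_of_int k\<bar>" using \<open>k \<noteq> 0\<close> by linarith
    then have "1 / (2 * \<bar>real_of_int k\<bar>) \<le> 1" by simp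
    moreover have "\<psi> (t + 1 / (2 * \<bar>of_int k\<bar>)) = \<psi> t + to_circle (of_int k * (1 / (2 * \<bar>of_int k\<bar>)))" for t
      by (simp only: k distrib_left to_circle_add)
    ultimately show ?thesis using nz[OF \<open>k \<noteq> 0\<close>]
      by (intro exI[of _ "1 / (2 * \<bar>real_of_int k\<bar>)"]
          exI[of _ "to_circle (of_int k * (1 / (2 * \<bar>of_int k\<bar>)))"]) auto
  qed
qed

text \<open>The digit of \<open>t\<close> at position \<open>n + 1\<close> after the point in base \<open>p\<close>, embedded into the circle as a
multiple of \<open>1/p\<close>. Higher digits contribute integers, which vanish modulo \<open>1\<close>.\<close>

definition digit :: "nat \<Rightarrow> nat \<Rightarrow> real \<Rightarrow> circle" where
  "digit p n t = to_circle (of_int \<lfloor>real p ^ Suc n * t\<rfloor> / real p)"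

text \<open>Given a nonzero combination of digits, let \<open>m\<close> be the first position whose coefficient is not divisible
by \<open>p\<close>. Adding \<open>1 / p ^ Suc m\<close> to \<open>t\<close> increases the digit \<open>m\<close> by one and keeps the later ones; a carry
affects only earlier digits, which do not occur modulo \<open>p\<close>. So this translation changes the combination
by a nonzero constant.\<close>

lemma ex_test_group_prime:
  assumes p: "prime p"
  shows "test_group p (Z.span (range (digit p)))"
proof
  let ?D = "Z.span (range (digit p))"
  have p0: "0 < p" "1 < p" using p prime_gt_0_nat prime_gt_1_nat by auto
  have tors: "to_circle (of_int (int p * k) / real p) = 0" for k
    using p0 by (simp add: to_circle_eq_0_iff)
  have shift_digit: "digit p n (t + 1 / real p ^ Suc m) = digit p n t + (if n = m then to_circle (1 / real p) else 0)"
    if "m \<le> n" for n m t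
  proof -
    have eq: "real p ^ Suc n * (t + 1 / real p ^ Suc m) = real p ^ Suc n * t + of_int (int p ^ (n - m))"
    proof -
      have "real p ^ Suc n = real p ^ (n - m) * real p ^ Suc m"
        using that by (simp add: power_add[symmetric] mult.left_commute)
      then show ?thesis using p0 by (simp add: distrib_left)
    qed
    have "digit p n (t + 1 / real p ^ Suc m) = to_circle ((of_int \<lfloor>real p ^ Suc n * t\<rfloor> + of_int (int p ^ (n - m))) / real p)"
      unfolding digit_def eq floor_add_int[symmetric] of_int_add ..
    also have "\<dots> = digit p n t + to_circle (of_int (int p ^ (n - m)) / real p)"
      by (simp only: add_divide_distrib to_circle_add digit_def)
    also have "to_circle (of_int (int p ^ (n - m)) / real p) = (if n = m then to_circle (1 / real p) else 0)"
    proof (cases "n = m")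
      case False
      then have "int p ^ (n - m) = int p * int p ^ (n - m - 1)"
        using that by (simp add: power_eq_if)
      then have "to_circle (of_int (int p ^ (n - m)) / real p) = 0" by (simp only: tors)
      with False show ?thesis by simp
    qed simp
    finally show ?thesis .
  qed
  show "p = 0 \<or> prime p" using p ..
  have sub: "add_subgroup ?D" by (rule add_subgroup_span)
  have torsion: "int p \<odot> \<psi> = 0" if "\<psi> \<in> ?D" for \<psi>
    using that
  proof (induction rule: Z.span_induct_alt)
    case (step c x y)
    then obtain n where n: "x = digit p n" by blast
    have "int p \<odot> digit p n = 0"
    proof
      fix t show "(int p \<odot> digit p n) t = 0 t"
        using tors[of "\<lfloor>real p ^ Suc n * t\<rfloor>"]
        by (simp add: digit_def to_circle_zmul[symmetric])
    qed
    then have "int p \<odot> c \<odot> digit p n = 0"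
      by (metis zmul_assoc mult.commute zmul_0_right)
    then show ?case using step.IH unfolding n zmul_add_right by simp
  qed simp
  show "add_subgroup (?D)"
    by (rule add_subgroup_span)
  show "countable (?D)"
    by (intro countable_span) simp
  have one_p: "to_circle (of_int c / real p) \<noteq> 0" if "\<not> int p dvd c" for c
  proof
    assume "to_circle (of_int c / real p) = 0"
    then obtain n where "of_int c / real p = of_int n" by (auto simp: to_circle_eq_0_iff elim: Ints_cases)
    then have "real_of_int c = of_int (int p * n)" using p0 by (simp add: field_simps)
    then have "c = int p * n" by (simp only: of_int_eq_iff)
    with that show False by simp
  qed
  have "inj (digit p)"
  proof (rule linorder_injI)
    fix m n :: nat assume "m < n"
    have "digit p m (1 / real p ^ Suc n) = 0"
    proof -
      have eq: "real p ^ Suc m * (1 / real p ^ Suc n) = 1 / real p ^ (n - m)"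
        using p0 \<open>m < n\<close> by (simp add: power_diff)
      have "1 / x < 1" if "1 < x" for x :: real using that by simp
      moreover have "1 < real p ^ (n - m)" using p0 \<open>m < n\<close> by (intro one_less_power) auto
      ultimately have "1 / real p ^ (n - m) < 1" by blast
      moreover have "0 \<le> 1 / real p ^ (n - m)" by simp
      ultimately have "0 \<le> real p ^ Suc m * (1 / real p ^ Suc n)" "real p ^ Suc m * (1 / real p ^ Suc n) < 1"
        unfolding eq by simp_all
      then have "\<lfloor>real p ^ Suc m * (1 / real p ^ Suc n)\<rfloor> = 0" by (simp only: floor_eq_iff) simp
      then show ?thesis by (simp only: digit_def) simp
    qed
    moreover have "digit p n (1 / real p ^ Suc n) = to_circle (of_int 1 / real p)"
      using p0 by (simp add: digit_def)
    moreover have "\<not> int p dvd 1" using p0 by simp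
    ultimately show "digit p m \<noteq> digit p n" using one_p by metis
  qed
  then have "infinite (range (digit p))" using finite_imageD infinite_UNIV_nat by blast
  then show "infinite (?D)"
    using Z.span_superset by (metis finite_subset)
  show "int p \<odot> \<psi> = 0"
    if "\<psi> \<in> ?D" for \<psi>
    using that by (rule torsion)
  show "\<psi> = 0"
    if "\<psi> \<in> ?D"
      "\<not> int p dvd m" "m \<odot> \<psi> = 0" for \<psi> m
    using zmul_cancel_prime[OF p that(2) torsion, of \<psi> "{}"] that by simp
  show "(\<lambda>t. e_circle (\<psi> t)) \<in> borel_measurable borel"
    if "\<psi> \<in> ?D" for \<psi>
  proof -
    define M where "M = {\<psi> :: real \<Rightarrow> circle. (\<lambda>t. e_circle (\<psi> t)) \<in> borel_measurable borel}"
    have "add_subgroup M"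
      unfolding add_subgroup_def M_def
      by (auto simp: e_add e_minus intro!: borel_measurable_times
          measurable_compose[OF _ borel_measurable_continuous_onI[OF continuous_on_cnj[OF continuous_on_id]]])
    moreover have "range (digit p) \<subseteq> M"
      unfolding M_def digit_def[abs_def] by (auto intro!: e_to_circle_measurable)
    ultimately show ?thesis using span_subset_subgroup that unfolding M_def by blast
  qed
  show "\<psi> (t + 1) = \<psi> t"
    if "\<psi> \<in> ?D" for \<psi> t
  proof -
    have "digit p n (t + 1) = digit p n t" for n t
    proof -
      have eq: "real p ^ Suc n * (t + 1) = real p ^ Suc n * t + of_int (int p * int p ^ n)"
        by (simp add: distrib_left)
      have "digit p n (t + 1) = to_circle ((of_int \<lfloor>real p ^ Suc n * t\<rfloor> + of_int (int p * int p ^ n)) / real p)"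
        unfolding digit_def eq floor_add_int[symmetric] of_int_add ..
      also have "\<dots> = digit p n t" by (simp only: add_divide_distrib to_circle_add tors digit_def) simp
      finally show ?thesis .
    qed
    then have "range (digit p) \<subseteq> {\<psi>. \<psi> (t + 1) = \<psi> t}" by auto
    moreover have "add_subgroup {\<psi> :: real \<Rightarrow> circle. \<psi> (t + 1) = \<psi> t}" by (auto simp: add_subgroup_def)
    ultimately show ?thesis using span_subset_subgroup that by blast
  qed
  show "\<exists>\<delta> \<theta>. 0 \<le> \<delta> \<and> \<delta> \<le> 1 \<and> \<theta> \<noteq> 0 \<and> (\<forall>t. \<psi> (t + \<delta>) = \<psi> t + \<theta>)"
    if \<psi>: "\<psi> \<in> ?D" "\<psi> \<noteq> 0" for \<psi>
  proof -
    have "\<exists>N c. \<psi> = (\<Sum>n<N. c n \<odot> digit p n)"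
      using \<psi>(1)
    proof (induction rule: Z.span_induct_alt)
      case base
      show ?case by (intro exI[of _ 0]) simp
    next
      case (step a x y)
      then obtain m N c where x: "x = digit p m" and y: "y = (\<Sum>n<N. c n \<odot> digit p n)" by blast
      \<comment> \<open>Adding a multiple of one more digit to a combination of the first \<open>N\<close> digits.\<close>
      define K where "K = max N (Suc m)"
      define d where "d n = (if n < N then c n else 0) + (if n = m then a else 0)" for n
      have "(\<Sum>n<K. d n \<odot> digit p n) = (\<Sum>n<K. (if n < N then c n else 0) \<odot> digit p n) + (\<Sum>n<K. (if n = m then a else 0) \<odot> digit p n)"
        by (simp only: d_def zmul_add_left sum.distrib)
      also have "(\<Sum>n<K. (if n < N then c n else 0) \<odot> digit p n) = (\<Sum>n<N. c n \<odot> digit p n)"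
        by (rule sum.mono_neutral_cong_right) (auto simp: K_def)
      also have "(\<Sum>n<K. (if n = m then a else 0) \<odot> digit p n) = (\<Sum>n\<in>{m}. a \<odot> digit p n)"
        by (rule sum.mono_neutral_cong_right) (auto simp: K_def)
      also have "(\<Sum>n\<in>{m}. a \<odot> digit p n) = a \<odot> digit p m" by (simp only: sum.insert[OF finite.emptyI] empty_iff not_False_eq_True sum.empty add_0_right)
      finally have eq: "(\<Sum>n<K. d n \<odot> digit p n) = (\<Sum>n<N. c n \<odot> digit p n) + a \<odot> digit p m" .
      have "a \<odot> x + y = (\<Sum>n<K. d n \<odot> digit p n)" unfolding x y eq by (rule add.commute)
      then show ?case by blast
    qed
    then obtain N c where \<psi>_eq: "\<psi> = (\<Sum>n<N. c n \<odot> digit p n)" by blast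
    have drop: "c n \<odot> digit p n = 0" if dvd: "int p dvd c n" for n
    proof -
      obtain j where "c n = j * int p" using dvd by (metis dvdE mult.commute)
      then have "c n \<odot> digit p n = j \<odot> int p \<odot> digit p n" by (simp only: zmul_assoc)
      also have "int p \<odot> digit p n = 0" by (rule torsion) (rule Z.span_base, rule rangeI)
      finally show ?thesis by (simp only: zmul_0_right)
    qed
    define m where "m = (LEAST n. n < N \<and> \<not> int p dvd c n)"
    have "\<exists>n. n < N \<and> \<not> int p dvd c n"
    proof (rule ccontr)
      assume "\<not> ?thesis"
      then have "\<psi> = 0" unfolding \<psi>_eq using drop by (intro sum.neutral) auto
      with \<psi>(2) show False ..
    qed
    from LeastI_ex[OF this] have m: "m < N" "\<not> int p dvd c m" unfolding m_def by blast+
    have least: "int p dvd c n" if "n < m" for n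
      using not_less_Least[of n "\<lambda>n. n < N \<and> \<not> int p dvd c n"] that m(1) by (simp add: m_def[symmetric])
    have sum_apply: "(\<Sum>n\<in>S. f n) t = (\<Sum>n\<in>S. f n t)" for f :: "nat \<Rightarrow> real \<Rightarrow> circle" and S t
      by (induction S rule: infinite_finite_induct) simp_all
    have "\<psi> (t + 1 / real p ^ Suc m) = \<psi> t + to_circle (of_int (c m) / real p)" for t
    proof -
      have "c n \<odot> digit p n (t + 1 / real p ^ Suc m) = c n \<odot> digit p n t + (if n = m then to_circle (of_int (c m) / real p) else 0)" for n
      proof (cases "n < m")
        case True
        have "c n \<odot> digit p n x = 0" for x
          using fun_cong[OF drop[OF least[OF True]], of x] by simp
        with True show ?thesis by simp
      next
        case False
        then show ?thesis
          using shift_digit[of m n t] to_circle_zmul[of "c m" "1 / real p"] by (simp add: zmul_add_right)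
      qed
      then have "\<psi> (t + 1 / real p ^ Suc m) =
          (\<Sum>n<N. c n \<odot> digit p n t + (if n = m then to_circle (of_int (c m) / real p) else 0))"
        by (simp add: \<psi>_eq sum_apply)
      also have "\<dots> = \<psi> t + to_circle (of_int (c m) / real p)"
        using m(1) by (simp add: \<psi>_eq sum_apply sum.distrib)
      finally show ?thesis .
    qed
    moreover have "1 / real p ^ Suc m \<le> 1"
    proof -
      have "1 \<le> real p ^ Suc m" using p0 by (intro one_le_power) auto
      then show ?thesis by simp
    qed
    ultimately show ?thesis using one_p[OF m(2)]
      by (intro exI[of _ "1 / real p ^ Suc m"] exI[of _ "to_circle (of_int (c m) / real p)"]) auto
  qed
qed

lemma ex_test_group:
  assumes "p = 0 \<or> prime p" shows "\<exists>D. test_group p D"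
  using assms ex_test_group_0 ex_test_group_prime by metis

subsection \<open>Sequences of test functions rarely converge\<close>

lemma bounded_set_integrable:
  fixes f :: "real \<Rightarrow> complex"
  assumes "f \<in> borel_measurable borel" "\<And>t. norm (f t) \<le> B" "bounded A" "A \<in> sets borel"
  shows "set_integrable lborel A f"
  unfolding set_integrable_def
  using assms emeasure_bounded_finite[OF assms(3)]
  by (intro integrableI_bounded_set_indicator[where B = B]) auto

lemma periodic_integral_shift:
  fixes f :: "real \<Rightarrow> complex"
  assumes f[measurable]: "f \<in> borel_measurable borel" and bound: "\<And>t. norm (f t) \<le> B"
    and per: "\<And>t. f (t + 1) = f t" and \<delta>: "0 \<le> \<delta>" "\<delta> \<le> 1"
  shows "(LINT t:{a<..a + 1}|lborel. f (t + \<delta>)) = (LINT t:{a<..a + 1}|lborel. f t)"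
proof -
  have int: "set_integrable lborel {c<..d} f" for c d
    by (rule bounded_set_integrable[OF f bound]) (auto intro: bounded_subset[of "{c..d}"])
  have tr: "(LINT t:{c<..d}|lborel. f (t + s)) = (LINT t:{c + s<..d + s}|lborel. f t)" for c d s
  proof -
    have "(LINT t:{c + s<..d + s}|lborel. f t) =
        (LINT x|lborel. indicator {c + s<..d + s} (s + 1 * x) *\<^sub>R f (s + 1 * x))"
      unfolding set_lebesgue_integral_def
      by (subst lborel_integral_real_affine[where c = 1 and t = s]) simp_all
    also have "\<dots> = (LINT t:{c<..d}|lborel. f (t + s))"
      unfolding set_lebesgue_integral_def
      by (intro Bochner_Integration.integral_cong refl) (auto simp: indicator_def add.commute)
    finally show ?thesis by simp
  qed
  have split: "(LINT t:{b<..d}|lborel. f t) = (LINT t:{b<..c}|lborel. f t) + (LINT t:{c<..d}|lborel. f t)"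
    if "b \<le> c" "c \<le> d" for b c d
  proof -
    have "{b<..d} = {b<..c} \<union> {c<..d}" using that by auto
    then show ?thesis using set_integral_Un[of "{b<..c}" "{c<..d}" lborel f] int by (auto simp: Int_def)
  qed
  have "(LINT t:{a<..a + 1}|lborel. f (t + \<delta>)) = (LINT t:{a + \<delta><..a + 1 + \<delta>}|lborel. f t)"
    by (rule tr)
  also have "\<dots> = (LINT t:{a + \<delta><..a + 1}|lborel. f t) + (LINT t:{a + 1<..a + \<delta> + 1}|lborel. f t)"
    using split[of "a + \<delta>" "a + 1" "a + 1 + \<delta>"] \<delta> by (simp add: ac_simps)
  also have "(LINT t:{a + 1<..a + \<delta> + 1}|lborel. f t) = (LINT t:{a<..a + \<delta>}|lborel. f t)"
    using tr[of a "a + \<delta>" 1] by (simp add: per)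
  also have "(LINT t:{a + \<delta><..a + 1}|lborel. f t) + (LINT t:{a<..a + \<delta>}|lborel. f t) = (LINT t:{a<..a + 1}|lborel. f t)"
    using split[of a "a + \<delta>" "a + 1"] \<delta> by simp
  finally show ?thesis .
qed

context test_group
begin

lemma diff_in: "\<psi> \<in> D \<Longrightarrow> \<psi>' \<in> D \<Longrightarrow> \<psi> - \<psi>' \<in> D"
  using subgroup unfolding add_subgroup_def by (metis diff_conv_add_uminus)

text \<open>Translation multiplies the integral by \<open>e_circle \<theta> \<noteq> 1\<close> and, by periodicity, leaves it unchanged.\<close>

lemma integral_test:
  assumes "\<psi> \<in> D"
  shows "(LINT t:{-(1/2)<..1/2}|lborel. e_circle (\<psi> t)) = (if \<psi> = 0 then 1 else 0)"
proof (cases "\<psi> = 0")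
  case True
  then show ?thesis by (simp add: set_lebesgue_integral_def)
next
  case False
  then obtain \<delta> \<theta> where \<delta>: "0 \<le> \<delta>" "\<delta> \<le> 1" "\<theta> \<noteq> 0" "\<And>t. \<psi> (t + \<delta>) = \<psi> t + \<theta>"
    using shift[OF assms] by blast
  let ?I = "LINT t:{-(1/2)<..1/2}|lborel. e_circle (\<psi> t)"
  have "(LINT t:{-(1/2)<..-(1/2) + 1}|lborel. e_circle (\<psi> (t + \<delta>))) =
      (LINT t:{-(1/2)<..-(1/2) + 1}|lborel. e_circle (\<psi> t))"
    by (rule periodic_integral_shift[where B = 1]) (use measurable[OF assms] periodic[OF assms] \<delta> in auto)
  then have "e_circle \<theta> * ?I = ?I" by (simp add: \<delta>(4) e_add mult.commute)
  then have "(e_circle \<theta> - 1) * ?I = 0" by (simp add: left_diff_distrib)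
  with \<delta>(3) False show ?thesis by (simp add: e_eq_1_iff)
qed

text \<open>If \<open>f k t\<close> tends to \<open>0\<close>, then from some \<open>k0\<close> on all \<open>e_circle (f k t)\<close> have real part at least
\<open>1/2\<close>. On the set \<open>E k0\<close> where this happens, a sum of \<open>N\<close> of these functions is at least \<open>N/2\<close>, while by
orthonormality its square has integral \<open>N\<close> over a period. So the measure of \<open>E k0\<close> is at most
\<open>4 / N\<close> for every \<open>N\<close>.\<close>

lemma convergence_set_null:
  fixes f :: "nat \<Rightarrow> real \<Rightarrow> circle"
  assumes f: "inj f" "range f \<subseteq> D"
  shows "{t \<in> {-(1/2)<..1/2}. (\<lambda>k. f k t) \<longlonglongrightarrow> 0} \<in> null_sets lebesgue"
proof -
  define J :: "real set" where "J = {-(1/2)<..1/2}"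
  define g where "g k t = e_circle (f k t)" for k t
  have g[measurable]: "g k \<in> borel_measurable borel" for k
    unfolding g_def using measurable[of "f k"] f by auto
  have J[measurable]: "J \<in> sets borel" "bounded J" "measure lborel J = 1"
    by (auto simp: J_def intro: bounded_subset[of "{-(1/2)..1/2}"])
  define E where "E k0 = {t \<in> space lborel. t \<in> J \<and> (\<forall>k. k0 \<le> k \<longrightarrow> 1 / 2 \<le> Re (g k t))}" for k0
  have E_sets[measurable]: "E k0 \<in> sets lborel" for k0
    unfolding E_def by measurable
  have EJ: "E k0 \<subseteq> J" for k0 by (auto simp: E_def)
  have small: "measure lborel (E k0) \<le> 4 / real N" if N: "0 < N" for k0 N
  proof -
    define K where "K = {k0..<k0 + N}"
    define S where "S t = (\<Sum>k\<in>K. g k t)" for t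
    have S_meas[measurable]: "S \<in> borel_measurable borel" unfolding S_def by measurable
    have S_le: "norm (S t) \<le> N" for t
      unfolding S_def by (rule order_trans[OF norm_sum]) (simp add: g_def K_def)
    have int2: "set_integrable lborel J (\<lambda>t. complex_of_real ((norm (S t))\<^sup>2))"
      by (rule bounded_set_integrable[where B = "(real N)\<^sup>2"])
        (use J S_le in \<open>auto simp: norm_power intro: power_mono\<close>)
    have "(LINT t:J|lborel. complex_of_real ((norm (S t))\<^sup>2)) =
        (LINT t|lborel. (\<Sum>k\<in>K. \<Sum>l\<in>K. indicator J t *\<^sub>R e_circle ((f k - f l) t)))"
      unfolding set_lebesgue_integral_def S_def complex_norm_square cnj_sum sum_product scaleR_sum_right g_def
      by (simp add: e_diff)
    also have "\<dots> = (\<Sum>k\<in>K. \<Sum>l\<in>K. LINT t:J|lborel. e_circle ((f k - f l) t))"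
    proof -
      have int: "integrable lborel (\<lambda>t. indicator J t *\<^sub>R e_circle ((f k - f l) t))" for k l
        using bounded_set_integrable[OF measurable[OF diff_in, of "f k" "f l"], of 1 J] J f
        by (auto simp: set_integrable_def)
      show ?thesis unfolding set_lebesgue_integral_def
        using int by (subst Bochner_Integration.integral_sum) (auto intro!: Bochner_Integration.integrable_sum
            sum.cong Bochner_Integration.integral_sum)
    qed
    also have "\<dots> = (\<Sum>k\<in>K. \<Sum>l\<in>K. if l = k then 1 else 0)"
    proof (intro sum.cong refl)
      fix k l
      have "f k - f l \<in> D" using f by (intro diff_in) auto
      moreover have "f k - f l = 0 \<longleftrightarrow> l = k" using f(1) by (auto simp: inj_eq)
      ultimately show "(LINT t:J|lborel. e_circle ((f k - f l) t)) = (if l = k then 1 else 0)"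
        unfolding J_def by (simp only: integral_test)
    qed
    also have "\<dots> = of_nat N" by (simp add: K_def)
    finally have "complex_of_real (LINT t|lborel. indicator J t * (norm (S t))\<^sup>2) = of_real (real N)"
      unfolding set_lebesgue_integral_def by (simp add: scaleR_conv_of_real flip: of_real_mult of_real_power)
    then have total: "(LINT t|lborel. indicator J t * (norm (S t))\<^sup>2) = real N" by (simp only: of_real_eq_iff)
    have "(real N / 2)\<^sup>2 * measure lborel (E k0) = (LINT t|lborel. indicator (E k0) t * (real N / 2)\<^sup>2)"
      by simp
    also have "\<dots> \<le> (LINT t|lborel. indicator J t * (norm (S t))\<^sup>2)"
    proof (rule integral_mono)
      have "emeasure lborel (E k0) < \<infinity>"
        using emeasure_bounded_finite[OF bounded_subset[OF J(2) EJ]] by simp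
      then show "integrable lborel (\<lambda>t. indicator (E k0) t * (real N / 2)\<^sup>2)"
        by (intro integrable_mult_left integrable_real_indicator E_sets)
      have "integrable lborel (\<lambda>t. Re (indicator J t *\<^sub>R complex_of_real ((norm (S t))\<^sup>2)))"
        using int2 unfolding set_integrable_def by (rule integrable_Re)
      then show "integrable lborel (\<lambda>t. indicator J t * (norm (S t))\<^sup>2)" by simp
    next
      fix t
      show "indicator (E k0) t * (real N / 2)\<^sup>2 \<le> indicator J t * (norm (S t))\<^sup>2"
      proof (cases "t \<in> E k0")
        case True
        then have "(\<Sum>k\<in>K. 1 / 2) \<le> (\<Sum>k\<in>K. Re (g k t))"
          by (intro sum_mono) (auto simp: E_def K_def)
        also have "\<dots> \<le> norm (S t)" using complex_Re_le_cmod[of "S t"] by (simp add: S_def)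
        finally have "(real N / 2)\<^sup>2 \<le> (norm (S t))\<^sup>2" by (intro power_mono) (auto simp: K_def)
        moreover have "t \<in> J" using True EJ by blast
        ultimately show ?thesis using True by simp
      qed simp
    qed
    also note total
    finally have "(real N / 2)\<^sup>2 * measure lborel (E k0) \<le> real N" .
    then show ?thesis using N by (simp add: field_simps power2_eq_square)
  qed
  have "E k0 \<in> null_sets lborel" for k0
  proof -
    have "(\<lambda>N. 4 / real N) \<longlonglongrightarrow> 0" by (rule lim_const_over_n)
    then have "measure lborel (E k0) \<le> 0"
      by (rule LIMSEQ_le_const) (use small in \<open>auto intro!: exI[of _ 1]\<close>)
    then have "measure lborel (E k0) = 0" using measure_nonneg[of lborel "E k0"] by linarith
    moreover have "emeasure lborel (E k0) < \<infinity>"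
      using emeasure_bounded_finite[OF bounded_subset[OF J(2) EJ]] by simp
    ultimately have "emeasure lborel (E k0) = 0"
      by (simp add: emeasure_eq_ennreal_measure)
    then show ?thesis using E_sets by (intro null_setsI)
  qed
  then have "(\<Union>k0. E k0) \<in> null_sets lebesgue" by (intro null_sets_completionI null_sets_UN)
  moreover have "{t \<in> {-(1/2)<..1/2}. (\<lambda>k. f k t) \<longlonglongrightarrow> 0} \<subseteq> (\<Union>k0. E k0)"
  proof
    fix t assume t: "t \<in> {t \<in> {-(1/2)<..1/2}. (\<lambda>k. f k t) \<longlonglongrightarrow> 0}"
    then have "(\<lambda>k. Re (e_circle (f k t))) \<longlonglongrightarrow> Re (e_circle 0)"
      by (intro tendsto_Re continuous_on_tendsto_compose[OF continuous_e[of UNIV]]) auto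
    then have "\<forall>\<^sub>F k in sequentially. 1 / 2 < Re (e_circle (f k t))"
      by (rule order_tendstoD) simp
    then obtain k0 where "\<forall>k\<ge>k0. 1 / 2 < Re (e_circle (f k t))" by (auto simp: eventually_sequentially)
    then have "t \<in> E k0" using t by (auto simp: E_def J_def g_def less_imp_le)
    then show "t \<in> (\<Union>k0. E k0)" by blast
  qed
  ultimately show ?thesis by (rule null_sets_completion_subset[rotated])
qed

text \<open>Let \<open>Y\<close> be a maximal subset of \<open>X\<close> for which the evaluations are independent. If \<open>f\<close> tends to \<open>0\<close>
on \<open>Y\<close>, then at each \<open>x \<in> X\<close> some multiple \<open>m \<odot> f\<close> with \<open>p\<close> not dividing \<open>m\<close> tends to \<open>0\<close>. For each of
the countably many \<open>m\<close> this happens on a null set only, because \<open>m \<odot> f\<close> is again injective.\<close>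

lemma nonnull_selection:
  assumes X: "X \<subseteq> {-(1/2)<..1/2}" "X \<notin> null_sets lebesgue"
  obtains Y where "Y \<subseteq> X" "indep_mod p Y (\<lambda>x \<psi>. if \<psi> \<in> D then \<psi> x else 0)"
    "\<And>f :: nat \<Rightarrow> real \<Rightarrow> circle. inj f \<Longrightarrow> range f \<subseteq> D \<Longrightarrow> \<exists>y\<in>Y. \<not> (\<lambda>k. f k y) \<longlonglongrightarrow> 0"
proof -
  define ev :: "real \<Rightarrow> (real \<Rightarrow> circle) \<Rightarrow> circle" where "ev x \<psi> = (if \<psi> \<in> D then \<psi> x else 0)" for x \<psi>
  have p1: "p \<noteq> 1" using p by auto
  have tors: "int p \<odot> ev x = 0" for x
  proof
    fix \<psi> show "(int p \<odot> ev x) \<psi> = 0 \<psi>"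
    proof (cases "\<psi> \<in> D")
      case True
      then have "(int p \<odot> \<psi>) x = 0" using torsion by simp
      with True show ?thesis by (simp add: ev_def)
    qed (simp add: ev_def)
  qed
  obtain Y where Y: "Y \<subseteq> X" "indep_mod p Y ev"
    "\<And>x. x \<in> X \<Longrightarrow> \<exists>m. \<not> int p dvd m \<and> m \<odot> ev x \<in> Z.span (ev ` Y)"
    by (rule maximal_indep[OF p1, where X = X and v = ev, OF tors]) (blast intro: that)
  show ?thesis
  proof (rule that[OF Y(1)])
    show "indep_mod p Y (\<lambda>x \<psi>. if \<psi> \<in> D then \<psi> x else 0)" 
    proof -
      have "ev = (\<lambda>x \<psi>. if \<psi> \<in> D then \<psi> x else 0)" by (intro ext) (simp add: ev_def)
      with Y(2) show ?thesis by simp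
    qed
    fix f :: "nat \<Rightarrow> real \<Rightarrow> circle" assume f: "inj f" "range f \<subseteq> D"
    show "\<exists>y\<in>Y. \<not> (\<lambda>k. f k y) \<longlonglongrightarrow> 0"
    proof (rule ccontr)
      assume "\<not> ?thesis"
      then have conv: "(\<lambda>k. f k y) \<longlonglongrightarrow> 0" if "y \<in> Y" for y using that by blast
      define C where "C = {a :: (real \<Rightarrow> circle) \<Rightarrow> circle. (\<lambda>k. a (f k)) \<longlonglongrightarrow> 0}"
      have "add_subgroup C"
        unfolding add_subgroup_def C_def using tendsto_add[of _ "0 :: circle" _ _ "0"] tendsto_minus[of _ "0 :: circle"]
        by auto
      moreover have "ev ` Y \<subseteq> C"
      proof -
        have "f k \<in> D" for k using f(2) by blast
        then have "(\<lambda>k. ev y (f k)) = (\<lambda>k. f k y)" for y by (simp add: ev_def)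
        then show ?thesis using conv by (auto simp: C_def)
      qed
      ultimately have span: "Z.span (ev ` Y) \<subseteq> C" by (rule span_subset_subgroup)
      define T where "T m = {t \<in> {-(1/2)<..1/2}. (\<lambda>k. (m \<odot> f k) t) \<longlonglongrightarrow> 0}" for m
      have null: "T m \<in> null_sets lebesgue" if m: "\<not> int p dvd m" for m
        unfolding T_def
      proof (rule convergence_set_null)
        have fD: "f k \<in> D" for k using f(2) by blast
        show "range (\<lambda>k. m \<odot> f k) \<subseteq> D"
          using zmul_hom[OF subgroup, of "\<lambda>x. x"] fD by blast
        show "inj (\<lambda>k. m \<odot> f k)"
        proof (rule injI)
          fix k l assume "m \<odot> f k = m \<odot> f l"
          then have "m \<odot> (f k - f l) = 0" by (simp add: Z.scale_right_diff_distrib)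
          then have "f k - f l = 0" using cancel[OF diff_in[OF fD fD] m] by blast
          then show "k = l" using f(1) by (simp add: inj_eq)
        qed
      qed
      have "X \<subseteq> (\<Union>m\<in>{m. \<not> int p dvd m}. T m)"
      proof
        fix x assume x: "x \<in> X"
        obtain m where m: "\<not> int p dvd m" "m \<odot> ev x \<in> Z.span (ev ` Y)" using Y(3)[OF x] by blast
        then have "(\<lambda>k. (m \<odot> ev x) (f k)) \<longlonglongrightarrow> 0" using span by (auto simp: C_def)
        moreover have "(m \<odot> ev x) (f k) = (m \<odot> f k) x" for k using f(2) by (auto simp: ev_def)
        ultimately have "x \<in> T m" using x X(1) by (auto simp: T_def)
        with m(1) show "x \<in> (\<Union>m\<in>{m. \<not> int p dvd m}. T m)" by blast
      qed
      moreover have "(\<Union>m\<in>{m. \<not> int p dvd m}. T m) \<in> null_sets lebesgue"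
        by (intro null_sets_UN') (auto intro: null)
      ultimately have "X \<in> null_sets lebesgue" by (rule null_sets_completion_subset)
      with X(2) show False ..
    qed
  qed
qed

end

section \<open>Neighbourhoods in the dual group\<close>

lemma zero_character: "restrict (\<lambda>_. 0) H \<in> characters H" if "add_subgroup H"
  using that by (auto simp: characters_def add_subgroup_def cong: continuous_on_cong)

lemma restrict_character:
  assumes "h \<in> characters UNIV" "add_subgroup D" shows "restrict h D \<in> characters D"
proof -
  have "continuous_on D (restrict h D) \<longleftrightarrow> continuous_on D h" by (rule continuous_on_cong) auto
  then show ?thesis using assms
    by (auto simp: characters_def add_subgroup_def intro: continuous_on_subset)
qed

lemma dual_nbhd_0:
  assumes "openin (dual H) W" "restrict (\<lambda>_. 0) H \<in> W"
  shows "\<exists>K \<epsilon>. K \<subseteq> H \<and> compact K \<and> 0 < \<epsilon> \<and> {h \<in> characters H. \<forall>x\<in>K. dist (h x) 0 < \<epsilon>} \<subseteq> W"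
proof -
  have "generate_topology_on {{h \<in> characters H. h ` K \<subseteq> U} | K U. K \<subseteq> H \<and> compact K \<and> open U} W"
    using assms(1) unfolding dual_def by (rule openin_topology_generated_by)
  then show ?thesis using assms(2)
  proof (induction rule: generate_topology_on.induct)
    case (Int a b)
    then obtain K1 \<epsilon>1 K2 \<epsilon>2 where
      1: "K1 \<subseteq> H" "compact K1" "0 < \<epsilon>1" "{h \<in> characters H. \<forall>x\<in>K1. dist (h x) 0 < \<epsilon>1} \<subseteq> a" and
      2: "K2 \<subseteq> H" "compact K2" "0 < \<epsilon>2" "{h \<in> characters H. \<forall>x\<in>K2. dist (h x) 0 < \<epsilon>2} \<subseteq> b"
      by auto
    then have "{h \<in> characters H. \<forall>x\<in>K1 \<union> K2. dist (h x) 0 < min \<epsilon>1 \<epsilon>2} \<subseteq> a \<inter> b"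
      by fastforce
    with 1 2 show ?case by (intro exI[of _ "K1 \<union> K2"] exI[of _ "min \<epsilon>1 \<epsilon>2"]) auto
  next
    case (UN \<K>)
    then obtain k where k: "k \<in> \<K>" "restrict (\<lambda>_. 0) H \<in> k" by blast
    from UN.IH[OF this] show ?case using k(1) by blast
  next
    case (Basis s)
    then obtain K U where s: "s = {h \<in> characters H. h ` K \<subseteq> U}" "K \<subseteq> H" "compact K" "open U" by blast
    show ?case
    proof (cases "K = {}")
      case True
      then show ?thesis using s by (intro exI[of _ "{}"] exI[of _ 1]) auto
    next
      case False
      then obtain x where "x \<in> K" by blast
      then have "restrict (\<lambda>_. 0) H x \<in> U" "x \<in> H" using Basis.prems s by blast+
      then have "0 \<in> U" by simp
      then obtain \<epsilon> where \<epsilon>: "0 < \<epsilon>" "\<And>y. dist y 0 < \<epsilon> \<Longrightarrow> y \<in> U" using s(4) unfolding open_dist by blast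
      then show ?thesis using s by (intro exI[of _ K] exI[of _ \<epsilon>]) auto
    qed
  qed simp
qed

lemma double_dist:
  assumes "dist x (0 :: circle) \<le> 1 / 4" shows "dist (x + x) 0 = 2 * dist x 0"
proof -
  define r where "r = rep_circle x"
  have r: "\<bar>r\<bar> \<le> 1 / 4" using assms by (simp add: dist_circle_0 r_def)
  have "\<bar>red (r + r)\<bar> = 2 * \<bar>r\<bar>"
  proof (cases "r + r \<in> {- (1 / 2) <.. 1 / 2}")
    case True
    then show ?thesis by (simp add: red_id abs_if)
  next
    case False
    then have "r = - (1 / 4)" using r by (auto simp: abs_le_iff)
    moreover have "red (- (1 / 2)) = 1 / 2" using red_add_int[of "1 / 2" "-1"] by (simp add: red_id)
    ultimately show ?thesis by simp
  qed
  then show ?thesis by (simp add: dist_circle_0 plus_circle.rep_eq r_def)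
qed

text \<open>A nonzero value at distance at most \<open>1/4\<close> from \<open>0\<close> can be doubled until it leaves this neighbourhood.\<close>

lemma small_hom_zero:
  assumes A: "add_subgroup A" and hom: "\<And>x y. x \<in> A \<Longrightarrow> y \<in> A \<Longrightarrow> h (x + y) = h x + h y"
    and small: "\<And>x. x \<in> A \<Longrightarrow> dist (h x) (0 :: circle) \<le> 1 / 4" and x: "x \<in> A"
  shows "h x = 0"
proof -
  have "\<exists>y\<in>A. dist (h y) 0 = 2 ^ n * dist (h x) 0" for n
  proof (induction n)
    case (Suc n)
    then obtain y where y: "y \<in> A" "dist (h y) 0 = 2 ^ n * dist (h x) 0" by blast
    then have "dist (h (y + y)) 0 = 2 ^ Suc n * dist (h x) 0" using double_dist[OF small] hom by simp
    moreover have "y + y \<in> A" using y A by (simp add: add_subgroup_def)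
    ultimately show ?case by blast
  qed (use x in auto)
  then have le: "2 ^ n * dist (h x) 0 \<le> 1 / 4" for n using small by metis
  show ?thesis
  proof (rule ccontr)
    assume "h x \<noteq> 0"
    then have pos: "0 < dist (h x) 0" by simp
    obtain n where "1 / dist (h x) 0 < 2 ^ n" using real_arch_pow[of 2 "1 / dist (h x) 0"] by auto
    then have "1 < 2 ^ n * dist (h x) 0" using pos by (simp add: field_simps)
    with le[of n] show False by linarith
  qed
qed

text \<open>The dual of a compact group is discrete, since only the zero character stays in a small ball. If
the restriction map were open, the dual of \<open>D\<close> would have an isolated zero, that is, a compact set \<open>K\<close> on
which no nonzero character is small.\<close>

lemma not_determines:
  assumes cpt: "compact (UNIV :: 'a::topological_ab_group_add set)"
    and D: "add_subgroup (D :: 'a set)" "closure D = UNIV"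
    and small: "\<And>K \<epsilon>. K \<subseteq> D \<Longrightarrow> compact K \<Longrightarrow> 0 < \<epsilon> \<Longrightarrow>
      \<exists>h\<in>characters UNIV. h \<noteq> 0 \<and> (\<forall>x\<in>K. dist (h x) 0 < \<epsilon>)"
  shows "\<not> determines D UNIV"
proof
  assume "determines D UNIV"
  then have "open_map (dual UNIV) (dual D) (\<lambda>h. restrict h D)"
    unfolding determines_def by (rule homeomorphic_imp_open_map)
  moreover have UNIV: "add_subgroup (UNIV :: 'a set)" by (simp add: add_subgroup_def)
  have "openin (dual UNIV) {h \<in> characters (UNIV :: 'a set). h ` UNIV \<subseteq> ball 0 (1 / 4)}"
    unfolding dual_def by (rule topology_generated_by_Basis) (use cpt in blast)
  moreover have "{h \<in> characters (UNIV :: 'a set). h ` UNIV \<subseteq> ball 0 (1 / 4)} = {\<lambda>_. 0}"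
  proof -
    have "h = (\<lambda>_. 0)" if h: "h \<in> characters UNIV" "h ` UNIV \<subseteq> ball 0 (1 / 4)" for h :: "'a \<Rightarrow> circle"
    proof
      fix x
      have "dist (h y) 0 \<le> 1 / 4" for y using h(2) by (auto simp: image_subset_iff dist_commute intro: less_imp_le)
      with h(1) show "h x = 0" by (intro small_hom_zero[OF UNIV]) (auto simp: characters_def)
    qed
    then have "{h \<in> characters (UNIV :: 'a set). h ` UNIV \<subseteq> ball 0 (1 / 4)} \<subseteq> {\<lambda>_. 0}" by blast
    moreover have "(\<lambda>_. 0) \<in> characters (UNIV :: 'a set)" using zero_character[OF UNIV] unfolding restrict_def by simp
    then have "{\<lambda>_. 0} \<subseteq> {h \<in> characters (UNIV :: 'a set). h ` UNIV \<subseteq> ball 0 (1 / 4)}" by simp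
    ultimately show ?thesis by (rule equalityI)
  qed
  ultimately have "openin (dual D) ((\<lambda>h. restrict h D) ` {\<lambda>_. 0})"
    unfolding open_map_def by metis
  then have "openin (dual D) {restrict (\<lambda>_. 0) D}" by (simp only: image_insert image_empty)
  from dual_nbhd_0[OF this] obtain K \<epsilon> where K: "K \<subseteq> D" "compact K" "0 < \<epsilon>"
    "{h \<in> characters D. \<forall>x\<in>K. dist (h x) 0 < \<epsilon>} \<subseteq> {restrict (\<lambda>_. 0) D}" by auto
  obtain h where h: "h \<in> characters UNIV" "h \<noteq> 0" "\<And>x. x \<in> K \<Longrightarrow> dist (h x) 0 < \<epsilon>"
    using small[OF K(1-3)] by blast
  have "restrict h D \<in> {h \<in> characters D. \<forall>x\<in>K. dist (h x) 0 < \<epsilon>}"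
    using restrict_character[OF h(1) D(1)] h(3) K(1) by auto
  then have eq: "restrict h D = restrict (\<lambda>_. 0) D" using K(4) by blast
  have "h x = 0" if "x \<in> D" for x using fun_cong[OF eq, of x] that by simp
  then have "D \<subseteq> {x. h x = 0}" by blast
  moreover have "closed {x. h x = 0}"
    using h(1) by (intro closed_Collect_eq) (auto simp: characters_def)
  ultimately have "closure D \<subseteq> {x. h x = 0}" by (rule closure_minimal)
  with D(2) h(2) show False by (auto simp: fun_eq_iff)
qed

section \<open>Selection principles\<close>

lemma fun_sum_apply: "(\<Sum>i\<in>I. f i) x = (\<Sum>i\<in>I. (f i x :: 'b::comm_monoid_add))"
  by (induction I rule: infinite_finite_induct) simp_all

lemma infinite_close_subfamily:
  fixes f :: "'q \<Rightarrow> 'x \<Rightarrow> circle"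
  assumes P: "finite P" and Q: "infinite Q" and \<epsilon>: "0 < \<epsilon>"
  obtains Q' where "Q' \<subseteq> Q" "infinite Q'"
    "\<And>q q' x. q \<in> Q' \<Longrightarrow> q' \<in> Q' \<Longrightarrow> x \<in> P \<Longrightarrow> dist (f q x) (f q' x) < \<epsilon>"
proof -
  obtain N where N: "0 < N" "inverse (real (Suc (N - 1))) < \<epsilon>"
    using reals_Archimedean[OF \<epsilon>] by (metis diff_Suc_1 zero_less_Suc)
  then have N': "1 / real N < \<epsilon>" by (simp add: inverse_eq_divide)
  define c where "c q = (\<lambda>x\<in>P. \<lfloor>real N * rep_circle (f q x)\<rfloor>)" for q
  have "c ` Q \<subseteq> (\<Pi>\<^sub>E x\<in>P. {- int N..int N})"
  proof (rule image_subsetI)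
    fix q
    have "- int N \<le> \<lfloor>real N * rep_circle y\<rfloor> \<and> \<lfloor>real N * rep_circle y\<rfloor> \<le> int N" for y
    proof -
      have "\<bar>rep_circle y\<bar> \<le> 1" using rep_circle_bounds[of y] by linarith
      then have "real N * \<bar>rep_circle y\<bar> \<le> real N * 1" by (intro mult_left_mono) auto
      then have "\<bar>real N * rep_circle y\<bar> \<le> real N" by (simp add: abs_mult)
      then show ?thesis by linarith
    qed
    then show "c q \<in> (\<Pi>\<^sub>E x\<in>P. {- int N..int N})" by (auto simp: c_def)
  qed
  then have "finite (c ` Q)" using P by (rule finite_subset[OF _ finite_PiE]) auto
  then obtain q0 where q0: "infinite {q \<in> Q. c q = c q0}" using pigeonhole_infinite[OF Q] by blast
  show ?thesis
  proof (rule that[OF _ q0])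
    fix q q' x assume q: "q \<in> {q \<in> Q. c q = c q0}" "q' \<in> {q \<in> Q. c q = c q0}" and x: "x \<in> P"
    then have "c q x = c q' x" by simp
    then have "\<lfloor>real N * rep_circle (f q x)\<rfloor> = \<lfloor>real N * rep_circle (f q' x)\<rfloor>" using x by (simp add: c_def)
    then have "\<bar>real N * rep_circle (f q x) - real N * rep_circle (f q' x)\<bar> < 1" by linarith
    then have "real N * \<bar>rep_circle (f q x) - rep_circle (f q' x)\<bar> < 1"
      by (simp add: abs_mult right_diff_distrib[symmetric])
    then have "\<bar>rep_circle (f q x) - rep_circle (f q' x)\<bar> < 1 / real N" using N(1) by (simp add: field_simps)
    then show "dist (f q x) (f q' x) < \<epsilon>"
      using N' dist_to_circle[of "rep_circle (f q x)" "rep_circle (f q' x)"] by simp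
  qed auto
qed

text \<open>Turns an accumulation property into a sequence of distinct elements.\<close>

lemma inj_choice:
  fixes A :: "nat \<Rightarrow> 'b set"
  assumes "\<And>n. infinite (A n)"
  obtains f where "inj f" "\<And>n. f n \<in> A n"
proof -
  have "\<exists>f. \<forall>n. f n \<in> A n \<and> f n \<notin> f ` {..<n}"
  proof (rule dependent_wellorder_choice)
    fix r :: 'b and f g :: "nat \<Rightarrow> 'b" and n :: nat
    assume "\<And>m. m < n \<Longrightarrow> f m = g m"
    then have "f ` {..<n} = g ` {..<n}" by auto
    then show "(r \<in> A n \<and> r \<notin> f ` {..<n}) = (r \<in> A n \<and> r \<notin> g ` {..<n})" by simp
  next
    fix n and f :: "nat \<Rightarrow> 'b"
    have "infinite (A n - f ` {..<n})" using assms by (intro Diff_infinite_finite) auto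
    then show "\<exists>r. r \<in> A n \<and> r \<notin> f ` {..<n}" using infinite_imp_nonempty by blast
  qed
  then obtain f where f: "\<And>n. f n \<in> A n" "\<And>n. f n \<notin> f ` {..<n}" by blast
  have "inj f"
  proof (rule linorder_injI)
    fix m n :: nat assume "m < n"
    then have "f m \<in> f ` {..<n}" by simp
    with f(2)[of n] show "f m \<noteq> f n" by metis
  qed
  then show ?thesis using f(1) by (rule that)
qed

text \<open>Approximate solutions of finite subsystems suffice, by the finite intersection property.\<close>

lemma compact_solve:
  fixes h :: "'y \<Rightarrow> 'a::topological_space \<Rightarrow> circle"
  assumes cpt: "compact (UNIV :: 'a set)" and S: "closed S"
    and h: "\<And>y. y \<in> Y \<Longrightarrow> continuous_on UNIV (h y)"
    and approx: "\<And>F \<epsilon>. finite F \<Longrightarrow> F \<subseteq> Y \<Longrightarrow> 0 < \<epsilon> \<Longrightarrow> \<exists>g\<in>S. \<forall>y\<in>F. dist (h y g) (f y) < \<epsilon>"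
  obtains g where "g \<in> S" "\<And>y. y \<in> Y \<Longrightarrow> h y g = f y"
proof -
  define C :: "'y \<times> real \<Rightarrow> 'a set" where "C i = {g. dist (h (fst i) g) (f (fst i)) \<le> snd i}" for i
  have "S \<inter> (\<Inter>i\<in>Y \<times> {0<..}. C i) \<noteq> {}"
  proof (rule compact_imp_fip_image)
    show "compact S" using compact_Int_closed[OF cpt S] by simp
    show "closed (C i)" if "i \<in> Y \<times> {0<..}" for i
      unfolding C_def using that by (intro closed_Collect_le continuous_intros h) auto
    fix I :: "('y \<times> real) set" assume I: "finite I" "I \<subseteq> Y \<times> {0<..}"
    define \<epsilon> where "\<epsilon> = Min (insert 1 (snd ` I))"
    have "0 < \<epsilon>" unfolding \<epsilon>_def using I by (subst Min_gr_iff) auto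
    moreover have "finite (fst ` I)" "fst ` I \<subseteq> Y" using I by auto
    ultimately obtain g where g: "g \<in> S" "\<And>y. y \<in> fst ` I \<Longrightarrow> dist (h y g) (f y) < \<epsilon>"
      using approx by metis
    have "g \<in> C i" if "i \<in> I" for i
    proof -
      have "\<epsilon> \<le> snd i" unfolding \<epsilon>_def using I that by (intro Min_le) auto
      with g(2)[of "fst i"] that show ?thesis by (auto simp: C_def)
    qed
    with g(1) show "S \<inter> (\<Inter>i\<in>I. C i) \<noteq> {}" by blast
  qed
  then obtain g where g: "g \<in> S" "\<And>i. i \<in> Y \<times> {0<..} \<Longrightarrow> g \<in> C i" by blast
  show ?thesis
  proof (rule that[OF g(1)])
    fix y assume y: "y \<in> Y"
    have "dist (h y g) (f y) \<le> 0"
      by (rule field_le_epsilon) (use g(2)[of "(y, _)"] y in \<open>auto simp: C_def\<close>)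
    then show "h y g = f y" by simp
  qed
qed

section \<open>A dense subgroup that does not determine\<close>

text \<open>The family \<open>\<alpha>\<close> describes a homomorphism \<open>G \<rightarrow> T\<^sup>Y\<close>, and \<open>E\<close> below is the preimage of the restrictions
to \<open>Y\<close> of the functions in \<open>D\<close>.\<close>

locale test_embedding = test_group p D for p D +
  fixes Y :: "real set" and \<alpha> :: "real \<Rightarrow> 'a::topological_ab_group_add \<Rightarrow> circle"
  assumes cpt: "compact (UNIV :: 'a set)"
    and ev_indep: "indep_mod p Y (\<lambda>x \<psi>. if \<psi> \<in> D then \<psi> x else 0)"
    and no_seq: "\<And>f :: nat \<Rightarrow> real \<Rightarrow> circle. inj f \<Longrightarrow> range f \<subseteq> D \<Longrightarrow> \<exists>y\<in>Y. \<not> (\<lambda>k. f k y) \<longlonglongrightarrow> 0"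
    and \<alpha>: "\<And>y. y \<in> Y \<Longrightarrow> \<alpha> y \<in> characters UNIV" "\<And>y. y \<in> Y \<Longrightarrow> int p \<odot> \<alpha> y = 0"
    and \<alpha>_indep: "indep_mod p Y \<alpha>"
begin

definition E :: "'a set" where
  "E = {g. \<exists>\<psi>\<in>D. \<forall>y\<in>Y. \<alpha> y g = \<psi> y}"

lemma \<alpha>_cont: "y \<in> Y \<Longrightarrow> continuous_on UNIV (\<alpha> y)"
  and \<alpha>_add: "y \<in> Y \<Longrightarrow> \<alpha> y (g + g') = \<alpha> y g + \<alpha> y g'"
  using \<alpha>(1) by (auto simp: characters_def)

lemma \<alpha>_0: "y \<in> Y \<Longrightarrow> \<alpha> y 0 = 0"
  using \<alpha>_add[of y 0 0] by simp

lemma \<alpha>_minus: "y \<in> Y \<Longrightarrow> \<alpha> y (- g) = - \<alpha> y g"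
  using \<alpha>_add[of y g "- g"] \<alpha>_0[of y] by (simp add: eq_neg_iff_add_eq_0 add.commute)

lemma E_subgroup: "add_subgroup E"
  unfolding add_subgroup_def
proof (intro conjI ballI)
  show "0 \<in> E" using subgroup unfolding E_def add_subgroup_def by (auto simp: \<alpha>_0 intro!: bexI[of _ 0])
  fix x assume "x \<in> E"
  then obtain \<psi> where \<psi>: "\<psi> \<in> D" "\<And>y. y \<in> Y \<Longrightarrow> \<alpha> y x = \<psi> y" by (auto simp: E_def)
  then show "- x \<in> E" using subgroup unfolding E_def add_subgroup_def
    by (auto simp: \<alpha>_minus intro!: bexI[of _ "- \<psi>"])
  fix x' assume "x' \<in> E"
  then obtain \<psi>' where "\<psi>' \<in> D" "\<And>y. y \<in> Y \<Longrightarrow> \<alpha> y x' = \<psi>' y" by (auto simp: E_def)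
  with \<psi> show "x + x' \<in> E" using subgroup unfolding E_def add_subgroup_def
    by (auto simp: \<alpha>_add intro!: bexI[of _ "\<psi> + \<psi>'"])
qed

lemma p_\<alpha>: "y \<in> Y \<Longrightarrow> int p \<odot> \<alpha> y g = 0"
  using fun_cong[OF \<alpha>(2), of y g] by simp

lemma p_\<psi>: "\<psi> \<in> D \<Longrightarrow> int p \<odot> \<psi> y = 0"
  using fun_cong[OF torsion, of \<psi> y] by simp

lemma realise:
  assumes \<psi>: "\<psi> \<in> D" obtains g where "\<And>y. y \<in> Y \<Longrightarrow> \<alpha> y g = \<psi> y"
proof -
  obtain g where "g \<in> UNIV" "\<And>y. y \<in> Y \<Longrightarrow> \<alpha> y g = \<psi> y"
  proof (rule compact_solve[OF cpt closed_UNIV \<alpha>_cont])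
    fix F and \<epsilon> :: real assume F: "finite F" "F \<subseteq> Y" "0 < \<epsilon>"
    show "\<exists>g\<in>UNIV. \<forall>y\<in>F. dist (\<alpha> y g) (\<psi> y) < \<epsilon>"
    proof (rule Kronecker_independent[where p = p])
      show "add_subgroup (UNIV :: 'a set)" by (simp add: add_subgroup_def)
      show "finite F" "0 < \<epsilon>" by (fact F)+
      show "\<alpha> y (g + g') = \<alpha> y g + \<alpha> y g'" if "y \<in> F" for y g g' using F(2) that by (auto simp: \<alpha>_add)
      show "int p \<odot> \<psi> y = 0" for y by (rule p_\<psi>[OF \<psi>])
      fix k assume "\<And>a. a \<in> UNIV \<Longrightarrow> (\<Sum>y\<in>F. k y \<odot> \<alpha> y a) = 0"
      then have "(\<Sum>y\<in>F. k y \<odot> \<alpha> y) = 0" by (simp add: fun_eq_iff fun_sum_apply)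
      then show "\<forall>y\<in>F. int p dvd k y" using indep_modD[OF \<alpha>_indep F(1,2)] by blast
    qed
  qed (blast intro: that)+
  then show ?thesis using that by blast
qed

text \<open>Every \<open>g0\<close> agrees on all \<open>\<alpha> y\<close> with some point \<open>g\<close> of the closure: by Kronecker approximation inside \<open>D\<close>
the values \<open>\<alpha> y g0\<close> are approximated by functions of \<open>D\<close>, and these are values of elements of \<open>E\<close>. The
difference \<open>g0 - g\<close> lies in the common kernel of the \<open>\<alpha> y\<close>, which is part of \<open>E\<close>.\<close>

lemma E_dense: "closure E = UNIV"
proof -
  have "g0 \<in> closure E" for g0
  proof -
    obtain g where g: "g \<in> closure E" "\<And>y. y \<in> Y \<Longrightarrow> \<alpha> y g = \<alpha> y g0"
    proof (rule compact_solve[OF cpt closed_closure \<alpha>_cont])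
      fix F and \<epsilon> :: real assume F: "finite F" "F \<subseteq> Y" "0 < \<epsilon>"
      have "\<exists>\<psi>\<in>D. \<forall>y\<in>F. dist (\<psi> y) (\<alpha> y g0) < \<epsilon>"
      proof (rule Kronecker_independent[where p = p and h = "\<lambda>y \<psi>. \<psi> y"])
        show "int p \<odot> \<alpha> y g0 = 0" if "y \<in> F" for y using that F(2) by (auto simp: p_\<alpha>)
        fix k assume k: "\<And>\<psi>. \<psi> \<in> D \<Longrightarrow> (\<Sum>y\<in>F. k y \<odot> \<psi> y) = 0"
        have "(\<Sum>y\<in>F. k y \<odot> (\<lambda>\<psi>. if \<psi> \<in> D then \<psi> y else 0)) = 0"
        proof
          fix \<psi> :: "real \<Rightarrow> circle"
          show "(\<Sum>y\<in>F. k y \<odot> (\<lambda>\<psi>. if \<psi> \<in> D then \<psi> y else 0)) \<psi> = 0 \<psi>"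
            using k[of \<psi>] by (cases "\<psi> \<in> D") (simp_all add: fun_sum_apply)
        qed
        then show "\<forall>y\<in>F. int p dvd k y" using indep_modD[OF ev_indep F(1,2)] by blast
      qed (use subgroup F in auto)
      then obtain \<psi> where \<psi>: "\<psi> \<in> D" "\<And>y. y \<in> F \<Longrightarrow> dist (\<psi> y) (\<alpha> y g0) < \<epsilon>" by blast
      obtain g where g: "\<And>y. y \<in> Y \<Longrightarrow> \<alpha> y g = \<psi> y" using realise[OF \<psi>(1)] by blast
      then have "g \<in> E" using \<psi>(1) by (auto simp: E_def)
      then have "g \<in> closure E" using closure_subset by blast
      moreover have "\<forall>y\<in>F. dist (\<alpha> y g) (\<alpha> y g0) < \<epsilon>" using \<psi>(2) g F(2) by auto
      ultimately show "\<exists>g\<in>closure E. \<forall>y\<in>F. dist (\<alpha> y g) (\<alpha> y g0) < \<epsilon>" by blast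
    qed (blast intro: that)+
    define d where "d = g0 - g"
    have "\<alpha> y d = 0" if "y \<in> Y" for y
      using \<alpha>_add[OF that, of g0 "- g"] \<alpha>_minus[OF that, of g] g(2)[OF that] by (simp add: d_def)
    then have "d \<in> E" using subgroup by (auto simp: E_def add_subgroup_def intro!: bexI[of _ 0])
    then have "(\<lambda>x. x + d) ` E \<subseteq> closure E"
      using E_subgroup closure_subset[of E] by (auto simp: add_subgroup_def)
    then have "(\<lambda>x. x + d) ` closure E \<subseteq> closure E"
      by (intro image_closure_subset) (auto intro!: continuous_intros)
    then have "g + d \<in> closure E" using g(1) by blast
    then show ?thesis by (simp add: d_def)
  qed
  then show ?thesis by blast
qed

text \<open>On a finite set \<open>Y\<close>, infinitely many functions of \<open>D\<close> would be pairwise close, and their differences would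
give an injective sequence tending to \<open>0\<close> on \<open>Y\<close>.\<close>

lemma Y_infinite: "infinite Y"
proof
  assume Y: "finite Y"
  define A where "A n = {\<psi> \<in> D. \<forall>y\<in>Y. dist (\<psi> y) 0 < 1 / real (Suc n)}" for n
  have "infinite (A n)" for n
  proof -
    have "0 < 1 / real (Suc n)" by simp
    from infinite_close_subfamily[OF Y infinite this, of "\<lambda>\<psi>. \<psi>"]
    obtain Q where Q: "Q \<subseteq> D" "infinite Q"
      "\<And>q q' y. q \<in> Q \<Longrightarrow> q' \<in> Q \<Longrightarrow> y \<in> Y \<Longrightarrow> dist (q y) (q' y) < 1 / real (Suc n)" by blast
    obtain q0 where q0: "q0 \<in> Q" using Q(2) by fastforce
    have "(\<lambda>q. q - q0) ` Q \<subseteq> A n"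
      using Q q0 by (auto simp: A_def dist_circle_diff[symmetric] intro!: diff_in)
    moreover have "infinite ((\<lambda>q. q - q0) ` Q)"
      using Q(2) by (subst finite_image_iff) (auto intro: inj_onI)
    ultimately show ?thesis using finite_subset by blast
  qed
  then obtain f where f: "inj f" "\<And>n. f n \<in> A n" by (rule inj_choice[of A]) (blast intro: that)
  have "(\<lambda>k. f k y) \<longlonglongrightarrow> 0" if "y \<in> Y" for y
    unfolding lim_sequentially
  proof (intro allI impI)
    fix \<epsilon> :: real assume "0 < \<epsilon>"
    then obtain n0 where n0: "1 / real (Suc n0) < \<epsilon>" by (metis nat_approx_posE)
    have "dist (f n y) 0 < \<epsilon>" if n: "n0 \<le> n" for n
    proof -
      have "dist (f n y) 0 < 1 / real (Suc n)" using f(2)[of n] \<open>y \<in> Y\<close> by (auto simp: A_def)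
      also have "\<dots> \<le> 1 / real (Suc n0)" using n by (intro divide_left_mono) auto
      finally show ?thesis using n0 by simp
    qed
    then show "\<exists>n0. \<forall>n\<ge>n0. dist (f n y) 0 < \<epsilon>" by blast
  qed
  then show False using no_seq[OF f(1)] f(2) by (auto simp: A_def)
qed

text \<open>An infinite set of functions arising from \<open>K\<close> has an accumulation point \<open>\<psi>1\<close> that again arises from
\<open>K\<close>. As \<open>D\<close> is countable, countably many points \<open>Y0\<close> of \<open>Y\<close> distinguish all restrictions to \<open>Y\<close> of its
members. A sequence can be chosen that tends to \<open>\<psi>1\<close> on \<open>Y0\<close>; it then tends to
\<open>\<psi>1\<close> on all of \<open>Y\<close>, since a further accumulation point \<open>\<psi>2\<close> agrees with \<open>\<psi>1\<close> on \<open>Y0\<close>. Subtracting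
\<open>\<psi>1\<close> contradicts \<open>no_seq\<close>.\<close>

lemma compact_finite:
  assumes K: "compact K" "K \<subseteq> E"
  shows "finite {\<psi> \<in> D. \<exists>k\<in>K. \<forall>y\<in>Y. \<alpha> y k = \<psi> y}" (is "finite ?K'")
proof (rule ccontr)
  assume inf: "infinite ?K'"
  have acc: "\<exists>\<psi>'\<in>?K'. \<forall>F \<epsilon>. finite F \<longrightarrow> F \<subseteq> Y \<longrightarrow> 0 < \<epsilon> \<longrightarrow> infinite {\<psi> \<in> S. \<forall>y\<in>F. dist (\<psi> y) (\<psi>' y) < \<epsilon>}"
    if S: "infinite S" "S \<subseteq> ?K'" for S
  proof -
    have "\<forall>\<psi>\<in>S. \<exists>k. k \<in> K \<and> (\<forall>y\<in>Y. \<alpha> y k = \<psi> y)" using S(2) by blast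
    then obtain kk where kk: "\<And>\<psi>. \<psi> \<in> S \<Longrightarrow> kk \<psi> \<in> K" "\<And>\<psi> y. \<psi> \<in> S \<Longrightarrow> y \<in> Y \<Longrightarrow> \<alpha> y (kk \<psi>) = \<psi> y"
      by metis
    have "\<exists>k\<in>K. \<forall>N. open N \<longrightarrow> k \<in> N \<longrightarrow> infinite {\<psi> \<in> S. kk \<psi> \<in> N}"
    proof (rule ccontr)
      assume "\<not> ?thesis"
      then have "\<forall>k\<in>K. \<exists>N. open N \<and> k \<in> N \<and> finite {\<psi> \<in> S. kk \<psi> \<in> N}" by simp
      from bchoice[OF this] obtain N
        where N: "\<forall>k\<in>K. open (N k) \<and> k \<in> N k \<and> finite {\<psi> \<in> S. kk \<psi> \<in> N k}" ..
      obtain K0 where K0: "K0 \<subseteq> K" "finite K0" "K \<subseteq> (\<Union>k\<in>K0. N k)"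
        using compactE_image[OF K(1), of K N] N by blast
      have "S \<subseteq> (\<Union>k\<in>K0. {\<psi> \<in> S. kk \<psi> \<in> N k})" using K0(3) kk(1) by blast
      moreover have "finite (\<Union>k\<in>K0. {\<psi> \<in> S. kk \<psi> \<in> N k})" using K0 N by blast
      ultimately show False using S(1) finite_subset by blast
    qed
    then obtain k where k: "k \<in> K" "\<And>N. open N \<Longrightarrow> k \<in> N \<Longrightarrow> infinite {\<psi> \<in> S. kk \<psi> \<in> N}" by blast
    obtain \<psi>' where \<psi>': "\<psi>' \<in> D" "\<And>y. y \<in> Y \<Longrightarrow> \<alpha> y k = \<psi>' y" using k(1) K(2) by (auto simp: E_def)
    show ?thesis
    proof (intro bexI[of _ \<psi>'] allI impI)
      show "\<psi>' \<in> ?K'" using \<psi>' k(1) by blast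
      fix F and \<epsilon> :: real assume F: "finite F" "F \<subseteq> Y" "0 < \<epsilon>"
      define N where "N = (\<Inter>y\<in>F. {g. dist (\<alpha> y g) (\<psi>' y) < \<epsilon>})"
      have "open {g. dist (\<alpha> y g) (\<psi>' y) < \<epsilon>}" if "y \<in> F" for y
        using that F(2) by (intro open_Collect_less continuous_intros \<alpha>_cont) auto
      then have "open N" unfolding N_def using F(1) by blast
      moreover have "k \<in> N" using F \<psi>'(2) by (auto simp: N_def)
      ultimately have "infinite {\<psi> \<in> S. kk \<psi> \<in> N}" by (rule k(2))
      moreover have "{\<psi> \<in> S. kk \<psi> \<in> N} \<subseteq> {\<psi> \<in> S. \<forall>y\<in>F. dist (\<psi> y) (\<psi>' y) < \<epsilon>}"
        using kk(2) F(2) by (auto simp: N_def subset_iff)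
      ultimately show "infinite {\<psi> \<in> S. \<forall>y\<in>F. dist (\<psi> y) (\<psi>' y) < \<epsilon>}" using finite_subset by blast
    qed
  qed
  \<comment> \<open>A point of \<open>Y\<close> at which two given functions differ, if there is one.\<close>
  define differ where "differ = (\<lambda>(\<psi>, \<psi>'). SOME y. y \<in> Y \<and> \<psi> y \<noteq> (\<psi>' y :: circle))"
  have differ: "differ (\<psi>, \<psi>') \<in> Y \<and> \<psi> (differ (\<psi>, \<psi>')) \<noteq> \<psi>' (differ (\<psi>, \<psi>'))"
    if "y \<in> Y" "\<psi> y \<noteq> \<psi>' y" for \<psi> \<psi>' y
    unfolding differ_def prod.case by (rule someI[of _ y]) (use that in simp)
  define Y0 where "Y0 = differ ` (D \<times> D) \<inter> Y"
  have Y0: "countable Y0" unfolding Y0_def using countable by (intro countable_Int1 countable_image countable_SIGMA) auto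
  obtain \<psi>1 where \<psi>1: "\<psi>1 \<in> ?K'"
    "\<And>F \<epsilon>. finite F \<Longrightarrow> F \<subseteq> Y \<Longrightarrow> 0 < \<epsilon> \<Longrightarrow> infinite {\<psi> \<in> ?K'. \<forall>y\<in>F. dist (\<psi> y) (\<psi>1 y) < \<epsilon>}"
    using acc[OF inf subset_refl] by blast
  define A where "A n = {\<psi> \<in> ?K'. \<forall>y\<in>{y \<in> Y0. to_nat_on Y0 y \<le> n}. dist (\<psi> y) (\<psi>1 y) < 1 / real (Suc n)}" for n
  have "infinite (A n)" for n
    unfolding A_def
  proof (rule \<psi>1(2))
    have "{y \<in> Y0. to_nat_on Y0 y \<le> n} \<subseteq> from_nat_into Y0 ` {..n}"
      using Y0 by (auto intro!: rev_image_eqI)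
    then show "finite {y \<in> Y0. to_nat_on Y0 y \<le> n}" by (rule finite_subset) simp
  qed (auto simp: Y0_def)
  then obtain f where f: "inj f" "\<And>n. f n \<in> A n" by (rule inj_choice[of A]) (blast intro: that)
  have fD: "f n \<in> D" for n using f(2)[of n] by (auto simp: A_def)
  have Y0_close: "\<exists>n0. \<forall>n\<ge>n0. dist (f n y) (\<psi>1 y) < \<epsilon>" if y: "y \<in> Y0" and \<epsilon>: "0 < \<epsilon>" for y \<epsilon>
  proof -
    obtain n1 where n1: "1 / real (Suc n1) < \<epsilon>" using \<epsilon> by (metis nat_approx_posE)
    have "dist (f n y) (\<psi>1 y) < \<epsilon>" if n: "max n1 (to_nat_on Y0 y) \<le> n" for n
    proof -
      have "dist (f n y) (\<psi>1 y) < 1 / real (Suc n)" using f(2)[of n] y n by (auto simp: A_def)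
      also have "\<dots> \<le> 1 / real (Suc n1)" using n by (intro divide_left_mono) auto
      finally show ?thesis using n1 by simp
    qed
    then show ?thesis by blast
  qed
  have "inj (\<lambda>n. f n - \<psi>1)" using f(1) by (auto simp: inj_def)
  moreover have "range (\<lambda>n. f n - \<psi>1) \<subseteq> D" using fD \<psi>1(1) by (auto intro: diff_in)
  ultimately obtain y where y: "y \<in> Y" "\<not> (\<lambda>n. (f n - \<psi>1) y) \<longlonglongrightarrow> 0" using no_seq by blast
  then obtain \<epsilon> where \<epsilon>: "0 < \<epsilon>" "\<And>n0. \<exists>n\<ge>n0. \<epsilon> \<le> dist (f n y) (\<psi>1 y)"
  proof -
    have "dist ((f n - \<psi>1) y) 0 = dist (f n y) (\<psi>1 y)" for n
      using dist_circle_diff[of "f n y" "\<psi>1 y"] by simp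
    then have "\<exists>\<epsilon>>0. \<forall>n0. \<exists>n\<ge>n0. \<epsilon> \<le> dist (f n y) (\<psi>1 y)"
      using y(2) unfolding lim_sequentially by (simp add: not_less)
    then show ?thesis using that by blast
  qed
  define I where "I = {n. \<epsilon> \<le> dist (f n y) (\<psi>1 y)}"
  have "infinite I" using \<epsilon>(2) by (auto simp: I_def infinite_nat_iff_unbounded_le)
  then have "infinite (f ` I)" using f(1) by (subst finite_image_iff) (auto intro: inj_on_subset)
  moreover have "f ` I \<subseteq> ?K'" using f(2) by (auto simp: A_def)
  ultimately have "\<exists>\<psi>'\<in>?K'. \<forall>F \<epsilon>. finite F \<longrightarrow> F \<subseteq> Y \<longrightarrow> 0 < \<epsilon> \<longrightarrow>
      infinite {\<psi> \<in> f ` I. \<forall>y\<in>F. dist (\<psi> y) (\<psi>' y) < \<epsilon>}" by (rule acc)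
  then obtain \<psi>2 where \<psi>2_in: "\<psi>2 \<in> ?K'"
    and \<psi>2_acc: "\<forall>F \<epsilon>. finite F \<longrightarrow> F \<subseteq> Y \<longrightarrow> 0 < \<epsilon> \<longrightarrow> infinite {\<psi> \<in> f ` I. \<forall>y\<in>F. dist (\<psi> y) (\<psi>2 y) < \<epsilon>}"
    by (rule bexE)
  note \<psi>2 = \<psi>2_in \<psi>2_acc[rule_format]
  have "\<psi>2 y \<noteq> \<psi>1 y"
  proof -
    have "infinite {\<psi> \<in> f ` I. \<forall>y\<in>{y}. dist (\<psi> y) (\<psi>2 y) < \<epsilon>}" using y(1) \<epsilon>(1) by (intro \<psi>2(2)) auto
    from infinite_imp_nonempty[OF this] obtain \<psi> where "\<psi> \<in> f ` I" "dist (\<psi> y) (\<psi>2 y) < \<epsilon>"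
      by auto
    then show ?thesis by (auto simp: I_def)
  qed
  define y' where "y' = differ (\<psi>2, \<psi>1)"
  have y': "y' \<in> Y0" "\<psi>2 y' \<noteq> \<psi>1 y'"
    using differ[where \<psi> = \<psi>2 and \<psi>' = \<psi>1, OF y(1) \<open>\<psi>2 y \<noteq> \<psi>1 y\<close>] \<psi>1(1) \<psi>2(1) by (auto simp: Y0_def y'_def)
  define \<eta> where "\<eta> = dist (\<psi>2 y') (\<psi>1 y') / 2"
  have \<eta>: "0 < \<eta>" using y'(2) by (simp add: \<eta>_def)
  obtain n0 where n0: "\<And>n. n0 \<le> n \<Longrightarrow> dist (f n y') (\<psi>1 y') < \<eta>" using Y0_close[OF y'(1) \<eta>] by blast
  have "infinite {\<psi> \<in> f ` I. \<forall>y\<in>{y'}. dist (\<psi> y) (\<psi>2 y) < \<eta>}"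
    using y'(1) \<eta> by (intro \<psi>2(2)) (auto simp: Y0_def)
  then have "infinite ({\<psi> \<in> f ` I. \<forall>y\<in>{y'}. dist (\<psi> y) (\<psi>2 y) < \<eta>} - f ` {..<n0})"
    by (rule Diff_infinite_finite[rotated]) simp
  from infinite_imp_nonempty[OF this]
  obtain \<psi> where "\<psi> \<in> {\<psi> \<in> f ` I. \<forall>y\<in>{y'}. dist (\<psi> y) (\<psi>2 y) < \<eta>} - f ` {..<n0}" by blast
  then obtain n where n: "f n \<notin> f ` {..<n0}" "dist (f n y') (\<psi>2 y') < \<eta>" by auto
  have "n0 \<le> n" using n(1) by (metis imageI lessThan_iff not_le)
  with n0[of n] n(2) have "dist (\<psi>2 y') (\<psi>1 y') < \<eta> + \<eta>"
    by (intro order_le_less_trans[OF dist_triangle2[of _ _ "f n y'"] add_strict_mono]) (auto simp: dist_commute)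
  then show False by (simp add: \<eta>_def)
qed

text \<open>Infinitely many \<open>\<alpha> y\<close> and finitely many \<open>\<psi>\<close> leave two indices at which all \<open>\<psi>\<close> are close.\<close>

lemma not_determined: "\<not> determined (UNIV :: 'a set)"
proof -
  have "\<not> determines E UNIV"
  proof (rule not_determines[OF cpt E_subgroup E_dense])
    fix K and \<epsilon> :: real assume K: "K \<subseteq> E" "compact K" "0 < \<epsilon>"
    define K' where "K' = {\<psi> \<in> D. \<exists>k\<in>K. \<forall>y\<in>Y. \<alpha> y k = \<psi> y}"
    have "finite K'" unfolding K'_def by (rule compact_finite[OF K(2,1)])
    from infinite_close_subfamily[OF this Y_infinite K(3), of "\<lambda>y \<psi>. \<psi> y"]
    obtain Q where Q: "Q \<subseteq> Y" "infinite Q"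
      "\<And>q q' \<psi>. q \<in> Q \<Longrightarrow> q' \<in> Q \<Longrightarrow> \<psi> \<in> K' \<Longrightarrow> dist (\<psi> q) (\<psi> q') < \<epsilon>" by blast
    obtain q where q: "q \<in> Q" using Q(2) by fastforce
    have "infinite (Q - {q})" using Q(2) by simp
    then obtain q' where q': "q' \<in> Q" "q' \<noteq> q" by (metis Diff_iff infinite_imp_nonempty ex_in_conv singletonI)
    show "\<exists>h\<in>characters UNIV. h \<noteq> 0 \<and> (\<forall>x\<in>K. dist (h x) 0 < \<epsilon>)"
    proof (intro bexI[of _ "\<alpha> q - \<alpha> q'"] conjI ballI)
      have qY: "q \<in> Y" "q' \<in> Y" using q q' Q(1) by auto
      show "\<alpha> q - \<alpha> q' \<in> characters UNIV"
        using qY \<alpha>_cont by (auto simp: characters_def \<alpha>_add fun_diff_def intro!: continuous_intros)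
      show "\<alpha> q - \<alpha> q' \<noteq> 0"
      proof
        assume "\<alpha> q - \<alpha> q' = 0"
        then have "(\<Sum>y\<in>{q, q'}. (if y = q then 1 else - 1) \<odot> \<alpha> y) = 0" using q'(2) by simp
        from indep_modD[OF \<alpha>_indep _ _ this, of q] have "int p dvd 1" using qY by simp
        then show False using p by auto
      qed
      fix x assume x: "x \<in> K"
      then obtain \<psi> where \<psi>: "\<psi> \<in> D" "\<And>y. y \<in> Y \<Longrightarrow> \<alpha> y x = \<psi> y" using K(1) by (auto simp: E_def)
      then have "\<psi> \<in> K'" using x by (auto simp: K'_def)
      from Q(3)[OF q q'(1) this] show "dist ((\<alpha> q - \<alpha> q') x) 0 < \<epsilon>"
        using \<psi>(2) qY by (simp add: dist_circle_diff[symmetric])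
    qed
  qed
  then show ?thesis unfolding determined_def using E_subgroup E_dense by auto
qed

end

section \<open>Countable weight\<close>

lemma countable_iff_natLeq: "countable A \<longleftrightarrow> |A| \<le>o natLeq"
proof -
  have "countable A \<longleftrightarrow> |A| \<le>o |UNIV :: nat set|"
    unfolding countable_def card_of_ordLeq[symmetric] by simp
  also have "\<dots> \<longleftrightarrow> |A| \<le>o natLeq"
    using card_of_nat ordLeq_ordIso_trans ordIso_symmetric by blast
  finally show ?thesis .
qed

lemma weight_countable_iff:
  assumes inf: "infinite (UNIV :: 'a::t2_space set)"
  shows "weight TYPE('a::t2_space) =o natLeq \<longleftrightarrow> (\<exists>B :: 'a set set. countable B \<and> topological_basis B)"
proof -
  have "{B :: 'a set set. topological_basis B} \<noteq> {}" using topological_basis_trivial by blast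
  from least_card[OF this] obtain A :: "'a set set" where A_in: "A \<in> {B. topological_basis B}"
    and A_min: "least_card {B :: 'a set set. topological_basis B} = |A| \<and> (\<forall>B\<in>{B :: 'a set set. topological_basis B}. |A| \<le>o |B| )"
    by (rule bexE)
  have A: "topological_basis A" "weight TYPE('a) = |A|" "\<And>B :: 'a set set. topological_basis B \<Longrightarrow> |A| \<le>o |B|"
    using A_in A_min by (simp_all add: weight_def)
  have "infinite A"
  proof
    assume fin: "finite A"
    have "(\<lambda>x :: 'a. - {x}) ` UNIV \<subseteq> Union ` Pow A"
    proof
      fix U assume "U \<in> (\<lambda>x :: 'a. - {x}) ` UNIV"
      then have "open U" by auto
      then obtain B' where "B' \<subseteq> A" "\<Union>B' = U" using A(1) unfolding topological_basis_def by metis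
      then show "U \<in> Union ` Pow A" by blast
    qed
    then have "finite ((\<lambda>x :: 'a. - {x}) ` UNIV)" by (rule finite_subset) (use fin in simp)
    moreover have "inj (\<lambda>x :: 'a. - {x})" by (rule injI) simp
    ultimately show False using inf finite_imageD by blast
  qed
  then have ge: "natLeq \<le>o |A|" 
    unfolding infinite_iff_card_of_nat by (rule ordIso_ordLeq_trans[OF ordIso_symmetric[OF card_of_nat]])
  show ?thesis
  proof
    assume "weight TYPE('a) =o natLeq"
    then have "countable A" unfolding A(2) countable_iff_natLeq by (rule ordIso_imp_ordLeq)
    then show "\<exists>B :: 'a set set. countable B \<and> topological_basis B" using A(1) by blast
  next
    assume "\<exists>B :: 'a set set. countable B \<and> topological_basis B"
    then obtain B :: "'a set set" where "countable B" "topological_basis B" by blast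
    then have "|A| \<le>o natLeq"
      using A(3) unfolding countable_iff_natLeq by (blast intro: ordLeq_transitive)
    with ge show "weight TYPE('a) =o natLeq" unfolding A(2) by (simp add: ordIso_iff_ordLeq)
  qed
qed

lemma countable_dense_circle:
  obtains Q :: "circle set" where "countable Q" "\<And>x r. 0 < r \<Longrightarrow> \<exists>q\<in>Q. dist x q < r"
proof (rule that[of "to_circle ` \<rat>"])
  show "countable (to_circle ` \<rat>)" using countable_rat by (rule countable_image)
  fix x :: circle and r :: real assume "0 < r"
  then obtain q where q: "q \<in> \<rat>" "rep_circle x < q" "q < rep_circle x + r"
    using Rats_dense_in_real[of "rep_circle x" "rep_circle x + r"] by auto
  then have "dist x (to_circle q) < r" using dist_to_circle[of "rep_circle x" q] by simp
  with q(1) show "\<exists>q\<in>to_circle ` \<rat>. dist x q < r" by blast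
qed

text \<open>The sets \<open>{g. dist (h g) q < r}\<close> form a subbase: separation of points and compactness of the
complement of an open set \<open>U\<close> around \<open>x\<close> give finitely many of them whose intersection contains \<open>x\<close> and
lies in \<open>U\<close>.\<close>

lemma countable_basis_if_countable_characters:
  assumes cpt: "compact (UNIV :: 'a::{topological_ab_group_add, t2_space} set)"
    and ctbl: "countable (characters (UNIV :: 'a set))"
  shows "\<exists>B :: 'a set set. countable B \<and> topological_basis B"
proof -
  obtain Q :: "circle set" where Q: "countable Q" "\<And>x r. 0 < r \<Longrightarrow> \<exists>q\<in>Q. dist x q < r"
    by (rule countable_dense_circle) (blast intro: that)
  define s :: "('a \<Rightarrow> circle) \<times> circle \<times> real \<Rightarrow> 'a set" where "s = (\<lambda>(h, q, r). {g :: 'a. dist (h g) q < (r :: real)})"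
  define S where "S = s ` (characters (UNIV :: 'a set) \<times> Q \<times> \<rat>)"
  define B where "B = Inter ` {T. finite T \<and> T \<subseteq> S}"
  have "countable S" unfolding S_def using ctbl Q(1) countable_rat by (intro countable_image countable_SIGMA) auto
  then have "countable B" unfolding B_def by (intro countable_image countable_Collect_finite_subset)
  have S_open: "open U" if "U \<in> S" for U
  proof -
    obtain h q r where "h \<in> characters (UNIV :: 'a set)" "U = {g. dist (h g) q < r}"
      using \<open>U \<in> S\<close> by (auto simp: S_def s_def)
    then show ?thesis by (auto simp: characters_def intro!: open_Collect_less continuous_intros)
  qed
  have "topological_basis B"
  proof (rule topological_basisI)
    show "open U" if "U \<in> B" for U
      using that S_open unfolding B_def by (auto intro!: open_Inter)
    fix U x assume U: "open U" "(x :: 'a) \<in> U"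
    have "\<exists>N. open (snd N) \<and> y \<in> snd N \<and> fst N \<in> S \<and> x \<in> fst N \<and> fst N \<inter> snd N = {}" if "y \<in> - U" for y
    proof -
      have "x - y \<noteq> 0" using that U(2) by auto
      then obtain h where h: "h \<in> characters (UNIV :: 'a set)" "h (x - y) \<noteq> 0"
        by (rule characters_separate_0[OF cpt]) (blast intro: that)
      have "\<forall>x y. h (x + y) = h x + h y" using h(1) by (simp add: characters_def)
      then have "h (x - y + y) = h (x - y) + h y" by blast
      then have "h x \<noteq> h y" using h(2) by simp
      then have "0 < dist (h x) (h y) / 2" by simp
      then obtain r where r: "r \<in> \<rat>" "0 < r" "r < dist (h x) (h y) / 2" using Rats_dense_in_real by blast
      obtain q where q: "q \<in> Q" "dist (h x) q < r" using Q(2)[OF r(2)] by blast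
      have "r < dist (h y) q" using r(3) q(2) dist_triangle2[of "h x" "h y" q] by linarith
      moreover have "s (h, q, r) \<in> S" using h(1) q(1) r(1) unfolding S_def by blast
      moreover have "open {g. r < dist (h g) q}"
        using h(1) by (intro open_Collect_less continuous_intros) (auto simp: characters_def)
      ultimately show ?thesis using q(2)
        by (intro exI[of _ "(s (h, q, r), {g. r < dist (h g) q})"]) (auto simp: s_def)
    qed
    then obtain N where N: "\<And>y. y \<in> - U \<Longrightarrow> open (snd (N y)) \<and> y \<in> snd (N y) \<and> fst (N y) \<in> S \<and>
        x \<in> fst (N y) \<and> fst (N y) \<inter> snd (N y) = {}" by metis
    have "compact (- U)" using compact_Int_closed[OF cpt, of "- U"] U(1) by (simp add: closed_Compl)
    then obtain Y where Y: "Y \<subseteq> - U" "finite Y" "- U \<subseteq> (\<Union>y\<in>Y. snd (N y))"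
      using compactE_image[of "- U" "- U" "\<lambda>y. snd (N y)"] N by blast
    define T where "T = (\<lambda>y. fst (N y)) ` Y"
    have "\<Inter>T \<in> B" unfolding B_def T_def using Y N by blast
    moreover have "x \<in> \<Inter>T" unfolding T_def using Y N by blast
    moreover have "\<Inter>T \<subseteq> U" unfolding T_def using Y N by blast
    ultimately show "\<exists>U'\<in>B. x \<in> U' \<and> U' \<subseteq> U" by blast
  qed
  with \<open>countable B\<close> show ?thesis by blast
qed

section \<open>Compact groups of countable weight are determined\<close>

text \<open>The closure of the graph of \<open>h\<close> is a compact subgroup of \<open>G \<times> T\<close>. It projects onto \<open>G\<close> because \<open>D\<close> is
dense, and continuity of \<open>h\<close> at \<open>0\<close> makes it single-valued. So it is the graph of a homomorphism, which
is continuous because its graph is compact.\<close>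

lemma character_extends:
  assumes cpt: "compact (UNIV :: 'a::{topological_ab_group_add, t2_space} set)"
    and D: "add_subgroup (D :: 'a set)" "closure D = UNIV" and h: "h \<in> characters D"
  obtains H where "H \<in> characters UNIV" "restrict H D = h"
proof -
  have h_add: "h (x + y) = h x + h y" if "x \<in> D" "y \<in> D" for x y using h that by (auto simp: characters_def)
  have h0: "0 \<in> D" "h 0 = 0" using D(1) h_add[of 0 0] by (auto simp: add_subgroup_def)
  have D_diff: "x - y \<in> D" if "x \<in> D" "y \<in> D" for x y
    using D(1) that unfolding add_subgroup_def by (metis diff_conv_add_uminus)
  have h_diff: "h (x - y) = h x - h y" if "x \<in> D" "y \<in> D" for x y
    using h_add[OF D_diff[OF that] that(2)] by simp
  define R where "R = (\<lambda>x. (x, h x)) ` D"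
  define C where "C = closure R"
  have cptC: "compact (C \<inter> (UNIV \<times> F))" if "closed F" for F
    unfolding C_def using that compact_circle
    by (intro closed_Int_compact closed_closure) (auto intro!: compact_Times cpt compact_Int_closed[of UNIV F, simplified])
  have diff: "(x - y, t - u) \<in> C" if "(x, t) \<in> C" "(y, u) \<in> C" for x y t u
  proof -
    \<comment> \<open>Subtraction preserves the graph of \<open>h\<close>, hence also its closure.\<close>
    define m where "m = (\<lambda>((x :: 'a, t :: circle), (y, u)). (x - y, t - u))"
    have "continuous_on (closure (R \<times> R)) m"
      unfolding m_def split_beta by (intro continuous_intros)
    moreover have "m ` (R \<times> R) \<subseteq> C"
    proof
      fix z assume "z \<in> m ` (R \<times> R)"
      then obtain x y where "x \<in> D" "y \<in> D" "z = (x - y, h x - h y)" by (auto simp: R_def m_def)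
      then have "z \<in> R" using D_diff[of x y] h_diff[of x y] by (auto simp: R_def)
      then show "z \<in> C" using closure_subset by (auto simp: C_def)
    qed
    ultimately have "m ` closure (R \<times> R) \<subseteq> C"
      by (intro image_closure_subset) (auto simp: C_def)
    moreover have "((x, t), (y, u)) \<in> closure (R \<times> R)" using that by (simp add: closure_Times C_def)
    ultimately have "m ((x, t), (y, u)) \<in> C" by blast
    then show ?thesis by (simp add: m_def)
  qed
  have zero: "t = 0" if t: "(0, t) \<in> C" for t
  proof -
    have le: "dist t 0 \<le> \<epsilon>" if "0 < \<epsilon>" for \<epsilon>
    proof -
      have "open (ball (0 :: circle) (\<epsilon> / 2))" "h 0 \<in> ball 0 (\<epsilon> / 2)" using \<open>0 < \<epsilon>\<close> h0 by auto
      moreover have "continuous_on D h" using h by (simp add: characters_def)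
      ultimately obtain U where U: "open U" "0 \<in> U" "\<And>y. y \<in> D \<Longrightarrow> y \<in> U \<Longrightarrow> h y \<in> ball 0 (\<epsilon> / 2)"
        using h0(1) unfolding continuous_on_topological by metis
      have "open (U \<times> ball t (\<epsilon> / 2))" "(0, t) \<in> U \<times> ball t (\<epsilon> / 2)" using U \<open>0 < \<epsilon>\<close> by (auto intro: open_Times)
      then have "(U \<times> ball t (\<epsilon> / 2)) \<inter> R \<noteq> {}" using t unfolding C_def by (metis closure_iff_nhds_not_empty open_Int_closure_eq_empty disjoint_iff)
      then obtain x where x: "x \<in> U" "x \<in> D" "h x \<in> ball t (\<epsilon> / 2)" by (auto simp: R_def)
      then have "dist 0 (h x) < \<epsilon> / 2" "dist t (h x) < \<epsilon> / 2" using U(3)[of x] by auto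
      then show ?thesis using dist_triangle2[of t 0 "h x"] by linarith
    qed
    have "dist t 0 \<le> 0" by (rule field_le_epsilon) (unfold add_0, rule le)
    then show ?thesis by simp
  qed
  have "closed (fst ` C)"
    using cptC[OF closed_UNIV] by (intro compact_imp_closed compact_continuous_image continuous_intros) auto
  moreover have "D \<subseteq> fst ` C"
  proof
    fix x assume "x \<in> D"
    then have "(x, h x) \<in> C" using closure_subset[of R] by (auto simp: C_def R_def)
    then show "x \<in> fst ` C" by force
  qed
  ultimately have "fst ` C = UNIV" using D(2) closure_minimal by blast
  then have "\<exists>t. (x, t) \<in> C" for x by (metis UNIV_I imageE prod.collapse)
  then obtain H where H: "\<And>x. (x, H x) \<in> C" by metis
  have unique: "t = H x" if "(x, t) \<in> C" for x t
  proof -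
    have "(0, t - H x) \<in> C" using diff[OF that H[of x]] by simp
    then have "t - H x = 0" by (rule zero)
    then show ?thesis by simp
  qed
  have "H (x + y) = H x + H y" for x y
  proof -
    have "(x + y - y, H (x + y) - H y) \<in> C" by (intro diff H)
    then have "H (x + y) - H y = H x" by (intro unique) simp
    then show ?thesis by (simp add: diff_eq_eq)
  qed
  moreover have "continuous_on UNIV H"
    unfolding continuous_on_closed_vimage[OF closed_UNIV]
  proof (intro allI impI)
    fix F :: "circle set" assume F: "closed F"
    have "H -` F \<inter> UNIV = fst ` (C \<inter> (UNIV \<times> F))"
      using H unique by force
    moreover have "closed (fst ` (C \<inter> (UNIV \<times> F)))"
      using cptC[OF F] by (intro compact_imp_closed compact_continuous_image continuous_intros)
    ultimately show "closed (H -` F \<inter> UNIV)" by simp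
  qed
  ultimately have "H \<in> characters UNIV" by (simp add: characters_def)
  moreover have "restrict H D = h"
  proof
    fix x show "restrict H D x = h x"
    proof (cases "x \<in> D")
      case True
      then have "(x, h x) \<in> C" using closure_subset[of R] by (auto simp: C_def R_def)
      from unique[OF this] True show ?thesis by simp
    next
      case False
      then show ?thesis using h by (auto simp: characters_def extensional_def)
    qed
  qed
  ultimately show ?thesis by (rule that)
qed

text \<open>On a smaller neighbourhood \<open>W\<close> these characters are bounded by \<open>1/16\<close>, so their values on finitely many
points \<open>X\<close> with \<open>G = X + W\<close> determine them up to an error below \<open>1/4\<close>. Two characters this close are equal,
and infinitely many would contain two that are close on \<open>X\<close>.\<close>

lemma finite_equicontinuous_characters:
  assumes cpt: "compact (UNIV :: 'a::topological_ab_group_add set)" and V: "open V" "(0 :: 'a) \<in> V"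
  shows "finite {h \<in> characters UNIV. \<forall>v\<in>V. dist (h v) 0 \<le> 1 / 4}" (is "finite ?A")
proof (rule ccontr)
  assume inf: "infinite ?A"
  \<comment> \<open>If \<open>x\<close>, \<open>2 x\<close> and \<open>4 x\<close> are within \<open>1/4\<close> of \<open>0\<close> in the circle, then \<open>x\<close> is within \<open>1/16\<close>.\<close>
  define W where "W = V \<inter> (\<lambda>w. w + w) -` V \<inter> (\<lambda>w. (w + w) + (w + w)) -` V"
  have "open W" unfolding W_def
    by (intro open_Int V(1) open_vimage continuous_intros)
  have W0: "0 \<in> W" using V(2) by (simp add: W_def)
  have W_small: "dist (h w) 0 \<le> 1 / 16" if "h \<in> ?A" "w \<in> W" for h w
  proof -
    have add: "h (x + y) = h x + h y" for x y using \<open>h \<in> ?A\<close> by (simp add: characters_def)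
    have small: "dist (h w) 0 \<le> 1 / 4" "dist (h w + h w) 0 \<le> 1 / 4" "dist (h w + h w + (h w + h w)) 0 \<le> 1 / 4"
      using that add[symmetric] by (auto simp: W_def)
    from double_dist[OF small(1)] double_dist[OF small(2)] small(3) show ?thesis by linarith
  qed
  have "open ((\<lambda>g. g - x) -` W)" for x
    by (intro open_vimage \<open>open W\<close> continuous_intros)
  moreover have "UNIV \<subseteq> (\<Union>x\<in>UNIV. (\<lambda>g. g - x) -` W)" using W0 by auto
  ultimately obtain X where X: "finite X" "UNIV \<subseteq> (\<Union>x\<in>X. (\<lambda>g. g - x) -` W)"
    using compactE_image[OF cpt, of UNIV "\<lambda>x. (\<lambda>g. g - x) -` W"] by metis
  have "(0::real) < 1 / 16" by simp
  from infinite_close_subfamily[OF X(1) inf this, of "\<lambda>h. h"] obtain Q where Q: "Q \<subseteq> ?A" "infinite Q"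
    "\<And>h h' x. h \<in> Q \<Longrightarrow> h' \<in> Q \<Longrightarrow> x \<in> X \<Longrightarrow> dist (h x) (h' x) < 1 / 16" by blast
  from infinite_imp_nonempty[OF Q(2)] obtain h where h: "h \<in> Q" by blast
  have "infinite (Q - {h})" using Q(2) by simp
  from infinite_imp_nonempty[OF this] obtain h' where h': "h' \<in> Q" "h' \<noteq> h" by blast
  have hA: "h \<in> ?A" "h' \<in> ?A" using h h'(1) Q(1) by auto
  have add: "h (x + y) = h x + h y" "h' (x + y) = h' x + h' y" for x y
    using hA by (auto simp: characters_def)
  have "(h - h') g = 0" for g
  proof (rule small_hom_zero[of UNIV "h - h'"])
    fix g
    obtain x where x: "x \<in> X" "g - x \<in> W" using X(2) by blast
    have "h g = h x + h (g - x)" "h' g = h' x + h' (g - x)"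
      using add(1)[of x "g - x"] add(2)[of x "g - x"] by simp_all
    then have "dist (h g) (h' g) \<le> dist (h x) (h' x) + dist (h (g - x)) (h' (g - x))"
      by (metis dist_circle_add)
    also have "dist (h (g - x)) (h' (g - x)) \<le> dist (h (g - x)) 0 + dist (h' (g - x)) 0"
      by (rule dist_triangle2)
    also have "\<dots> \<le> 1 / 16 + 1 / 16" by (intro add_mono W_small hA x(2))
    also have "dist (h x) (h' x) \<le> 1 / 16" using Q(3)[OF h h'(1) x(1)] by simp
    finally show "dist ((h - h') g) 0 \<le> 1 / 4" by (simp add: dist_circle_diff[symmetric])
  qed (auto simp: add_subgroup_def add)
  then have "h = h'" by (simp add: fun_eq_iff)
  with h'(2) show False by simp
qed

lemma neighbourhood_sequence:
  fixes B :: "'a::topological_space set set"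
  assumes "countable B" "topological_basis B"
  obtains V :: "nat \<Rightarrow> 'a set" where "\<And>n. open (V n)" "\<And>n. x \<in> V n" "V 0 = UNIV"
    "\<And>U. open U \<Longrightarrow> x \<in> U \<Longrightarrow> \<exists>n0. \<forall>n\<ge>n0. V n \<subseteq> U"
proof -
  define B' where "B' = {b \<in> B. x \<in> b}"
  have B': "countable B'" using assms(1) by (simp add: B'_def)
  have "B' \<noteq> {}" using topological_basisE[OF assms(2) open_UNIV UNIV_I, of x] by (auto simp: B'_def)
  define V where "V n = (\<Inter>i<n. from_nat_into B' i)" for n
  have mem: "from_nat_into B' i \<in> B'" for i using \<open>B' \<noteq> {}\<close> by (rule from_nat_into)
  show ?thesis
  proof (rule that[of V])
    show "open (V n)" for n unfolding V_def
      using mem topological_basis_open[OF assms(2)] by (intro open_INT) (auto simp: B'_def)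
    show "x \<in> V n" for n using mem by (auto simp: V_def B'_def)
    show "V 0 = UNIV" by (simp add: V_def)
    fix U assume "open U" "x \<in> U"
    then obtain b where b: "b \<in> B" "x \<in> b" "b \<subseteq> U" by (rule topological_basisE[OF assms(2)])
    then have "b \<in> B'" by (simp add: B'_def)
    then obtain i where i: "from_nat_into B' i = b" using from_nat_into_surj[OF B'] by blast
    have "V n \<subseteq> U" if "Suc i \<le> n" for n
    proof -
      have "V n \<subseteq> from_nat_into B' i" unfolding V_def using that by (intro INF_lower) auto
      then show ?thesis using i b(3) by simp
    qed
    then show "\<exists>n0. \<forall>n\<ge>n0. V n \<subseteq> U" by blast
  qed
qed

text \<open>Let \<open>A n\<close> be the set of characters that are small on \<open>V n\<close>. Each of the finitely many members of
\<open>A (Suc n) - A n\<close> receives a witness in \<open>V n \<inter> D\<close>. Every character belongs to some \<open>A n\<close>, and one that is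
small at all witnesses descends to \<open>A 0\<close>, where \<open>V 0\<close> is the whole group.\<close>

lemma compact_test_set:
  assumes cpt: "compact (UNIV :: 'a::{topological_ab_group_add, t2_space} set)"
    and B: "countable (B :: 'a set set)" "topological_basis B"
    and D: "add_subgroup (D :: 'a set)" "closure D = UNIV"
  obtains K where "K \<subseteq> D" "compact K"
    "\<And>h. h \<in> characters UNIV \<Longrightarrow> (\<And>x. x \<in> K \<Longrightarrow> dist (h x) 0 \<le> 1 / 4) \<Longrightarrow> h = (\<lambda>_. 0)"
proof -
  obtain V :: "nat \<Rightarrow> 'a set" where V: "\<And>n. open (V n)" "\<And>n. 0 \<in> V n" "V 0 = UNIV"
    "\<And>U. open U \<Longrightarrow> 0 \<in> U \<Longrightarrow> \<exists>n0. \<forall>n\<ge>n0. V n \<subseteq> U"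
    by (rule neighbourhood_sequence[OF B]) (blast intro: that)
  define A where "A n = {h \<in> characters UNIV. \<forall>v\<in>V n. dist (h v) 0 \<le> 1 / 4}" for n
  have A_fin: "finite (A n)" for n
    unfolding A_def by (rule finite_equicontinuous_characters[OF cpt V(1,2)])
  have ex: "\<exists>d. d \<in> V n \<inter> D \<and> 1 / 4 < dist (h d) 0" if h: "h \<in> A (Suc n) - A n" for n h
  proof -
    define O' where "O' = V n \<inter> {v. 1 / 4 < dist (h v) 0}"
    have "continuous_on UNIV h" using h by (simp add: A_def characters_def)
    then have "open O'" unfolding O'_def
      by (intro open_Int V(1) open_Collect_less continuous_intros)
    moreover have "O' \<noteq> {}" using h by (auto simp: O'_def A_def not_le)
    ultimately have "O' \<inter> D \<noteq> {}" using D(2) open_Int_closure_eq_empty[of O' D] by auto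
    then show ?thesis by (auto simp: O'_def)
  qed
  define d where "d n h = (SOME d. d \<in> V n \<inter> D \<and> 1 / 4 < dist (h d) 0)" for n and h :: "'a \<Rightarrow> circle"
  have d: "d n h \<in> V n \<inter> D \<and> 1 / 4 < dist (h (d n h)) 0" if "h \<in> A (Suc n) - A n" for n h
    unfolding d_def by (rule someI_ex[OF ex[OF that]])
  define F where "F n = d n ` (A (Suc n) - A n)" for n
  have F: "finite (F n)" "F n \<subseteq> V n \<inter> D" for n
    using A_fin d by (auto simp: F_def)
  define K where "K = insert 0 (\<Union>n. F n)"
  show ?thesis
  proof (rule that[of K])
    show "K \<subseteq> D" using F(2) D(1) by (auto simp: K_def add_subgroup_def)
    show "compact K"
    proof (rule compactI)
      fix C assume C: "\<forall>t\<in>C. open t" "K \<subseteq> \<Union>C"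
      then obtain U where U: "U \<in> C" "0 \<in> U" by (auto simp: K_def)
      then obtain n0 where n0: "\<And>n. n0 \<le> n \<Longrightarrow> V n \<subseteq> U" using V(4)[of U] C(1) by blast
      have "finite (\<Union>n<n0. F n)" using F(1) by blast
      then have "compact (\<Union>n<n0. F n)" by (rule finite_imp_compact)
      moreover have "(\<Union>n<n0. F n) \<subseteq> \<Union>C" using C(2) by (auto simp: K_def)
      ultimately obtain C' where C': "C' \<subseteq> C" "finite C'" "(\<Union>n<n0. F n) \<subseteq> \<Union>C'"
        using compactE C(1) by metis
      have "K \<subseteq> \<Union>(insert U C')"
      proof
        fix x assume "x \<in> K"
        then consider "x = 0" | n where "x \<in> F n" by (auto simp: K_def)
        then show "x \<in> \<Union>(insert U C')"
        proof cases
          case (2 n)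
          then show ?thesis using C'(3) F(2)[of n] n0[of n] by (cases "n < n0") auto
        qed (use U in auto)
      qed
      then show "\<exists>C'\<subseteq>C. finite C' \<and> K \<subseteq> \<Union>C'" using C' U(1) by (intro exI[of _ "insert U C'"]) auto
    qed
    fix h assume h: "h \<in> characters UNIV" and small: "\<And>x. x \<in> K \<Longrightarrow> dist (h x) 0 \<le> 1 / 4"
    have cont: "continuous_on UNIV h" and add: "h (x + y) = h x + h y" for x y
      using h by (auto simp: characters_def)
    have "open {v. dist (h v) 0 < 1 / 4}" by (intro open_Collect_less continuous_intros cont)
    moreover have "0 \<in> {v. dist (h v) 0 < 1 / 4}" using add[of 0 0] by simp
    ultimately have "\<exists>n0. \<forall>n\<ge>n0. V n \<subseteq> {v. dist (h v) 0 < 1 / 4}" by (rule V(4))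
    then obtain n where "V n \<subseteq> {v. dist (h v) 0 < 1 / 4}" by blast
    then have "h \<in> A n" using h by (auto simp: A_def intro: less_imp_le)
    then have "h \<in> A 0"
    proof (induction n)
      case (Suc n)
      have "h \<in> A n"
      proof (rule ccontr)
        assume "h \<notin> A n"
        with Suc.prems have hA: "h \<in> A (Suc n) - A n" by simp
        then have "d n h \<in> K" by (auto simp: K_def F_def)
        with small d[OF hA] show False by force
      qed
      then show ?case by (rule Suc.IH)
    qed
    then have "dist (h v) 0 \<le> 1 / 4" for v by (simp add: A_def V(3))
    then show "h = (\<lambda>_. 0)"
      by (intro ext small_hom_zero[of UNIV]) (auto simp: add_subgroup_def add)
  qed
qed

text \<open>With \<open>K\<close> from \<open>compact_test_set\<close>, a character of \<open>D\<close> is isolated by its values on \<open>K\<close> up to \<open>1/4\<close>. To express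
this by the sets that generate the topology of the dual, \<open>K\<close> is divided into finitely many compact
pieces on which the given character is almost constant.\<close>

lemma determined_if_countable_basis:
  assumes cpt: "compact (UNIV :: 'a::{topological_ab_group_add, t2_space} set)"
    and B: "countable (B :: 'a set set)" "topological_basis B"
  shows "determined (UNIV :: 'a set)"
  unfolding determined_def
proof (intro allI impI)
  fix D :: "'a set" assume "add_subgroup D \<and> D \<subseteq> UNIV \<and> UNIV \<subseteq> closure D"
  then have D: "add_subgroup D" "closure D = UNIV" by auto
  obtain K where K: "K \<subseteq> D" "compact K"
    "\<And>h. h \<in> characters UNIV \<Longrightarrow> (\<And>x. x \<in> K \<Longrightarrow> dist (h x) 0 \<le> 1 / 4) \<Longrightarrow> h = (\<lambda>_. 0)"
    by (rule compact_test_set[OF cpt B D]) (blast intro: that)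
  have inj: "h = h'" if h: "h \<in> characters UNIV" "h' \<in> characters UNIV" and close: "\<And>x. x \<in> K \<Longrightarrow> dist (h x) (h' x) \<le> 1 / 4"
    for h h'
  proof -
    have "h - h' \<in> characters UNIV"
      using h by (auto simp: characters_def fun_diff_def intro!: continuous_intros)
    then have "h - h' = (\<lambda>_. 0)" using close by (intro K(3)) (auto simp: dist_circle_diff[symmetric])
    then show ?thesis by (simp add: fun_eq_iff)
  qed
  obtain Q where Q: "finite Q" "\<And>x :: circle. \<exists>q\<in>Q. dist x q < 1 / 16"
  proof -
    have "UNIV \<subseteq> (\<Union>q\<in>UNIV. ball (q :: circle) (1 / 16))" by (auto intro!: exI[of _ "_ :: circle"])
    then obtain Q where "finite Q" "UNIV \<subseteq> (\<Union>q\<in>Q. ball (q :: circle) (1 / 16))"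
      using compactE_image[OF compact_circle, of UNIV "\<lambda>q. ball q (1 / 16)"] by auto
    then show ?thesis by (intro that[of Q]) (auto simp: dist_commute subset_iff)
  qed
  have singleton: "openin (dual D) {h0}" if h0: "h0 \<in> characters D" for h0
  proof -
    define Kq where "Kq q = {x \<in> K. dist (h0 x) q \<le> 1 / 16}" for q
    have cont: "continuous_on K h0" using h0 K(1) by (auto simp: characters_def intro: continuous_on_subset)
    have "compact (Kq q)" for q
    proof -
      have "closedin (top_of_set K) (K \<inter> h0 -` cball q (1 / 16))"
        using cont by (intro continuous_closedin_preimage) auto
      moreover have "K \<inter> h0 -` cball q (1 / 16) = Kq q" by (auto simp: Kq_def dist_commute)
      ultimately show ?thesis using closedin_compact[OF K(2)] by simp
    qed
    then have "openin (dual D) {h \<in> characters D. h ` Kq q \<subseteq> ball q (1 / 8)}" for q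
      unfolding dual_def using K(1) by (intro topology_generated_by_Basis) (auto simp: Kq_def)
    then have "openin (dual D) ((\<Inter>q\<in>Q. {h \<in> characters D. h ` Kq q \<subseteq> ball q (1 / 8)}) \<inter> topspace (dual D))"
      by (intro openin_INT[OF Q(1)])
    then have "openin (dual D) (characters D \<inter> (\<Inter>q\<in>Q. {h \<in> characters D. h ` Kq q \<subseteq> ball q (1 / 8)}))"
      by (simp only: topspace_dual Int_commute)
    moreover have "characters D \<inter> (\<Inter>q\<in>Q. {h \<in> characters D. h ` Kq q \<subseteq> ball q (1 / 8)}) = {h0}"
    proof (intro equalityI subsetI)
      fix h assume h: "h \<in> characters D \<inter> (\<Inter>q\<in>Q. {h \<in> characters D. h ` Kq q \<subseteq> ball q (1 / 8)})"
      have close: "dist (h x) (h0 x) \<le> 1 / 4" if x: "x \<in> K" for x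
      proof -
        obtain q where q: "q \<in> Q" "dist (h0 x) q < 1 / 16" using Q(2) by blast
        then have "x \<in> Kq q" using x by (simp add: Kq_def)
        moreover have "h ` Kq q \<subseteq> ball q (1 / 8)" using h q(1) by blast
        ultimately have "h x \<in> ball q (1 / 8)" by blast
        then have "dist (h x) q < 1 / 8" by (simp add: dist_commute)
        with q(2) show ?thesis using dist_triangle2[of "h x" "h0 x" q] by linarith
      qed
      obtain H where H: "H \<in> characters UNIV" "restrict H D = h"
        by (rule character_extends[OF cpt D]) (use h in \<open>auto intro: that\<close>)
      obtain H0 where H0: "H0 \<in> characters UNIV" "restrict H0 D = h0"
        by (rule character_extends[OF cpt D h0]) (blast intro: that)
      have "H = H0"
      proof (rule inj[OF H(1) H0(1)])
        fix x assume x: "x \<in> K"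
        then have "x \<in> D" using K(1) by blast
        then have "H x = h x" "H0 x = h0 x" using fun_cong[OF H(2), of x] fun_cong[OF H0(2), of x] by auto
        with close[OF x] show "dist (H x) (H0 x) \<le> 1 / 4" by simp
      qed
      then show "h \<in> {h0}" using H(2) H0(2) by simp
    next
      fix h assume "h \<in> {h0}"
      then show "h \<in> characters D \<inter> (\<Inter>q\<in>Q. {h \<in> characters D. h ` Kq q \<subseteq> ball q (1 / 8)})"
        using h0 by (auto simp: Kq_def dist_commute)
    qed
    ultimately show ?thesis by simp
  qed
  show "determines D UNIV"
    unfolding determines_def
  proof (rule bijective_open_imp_homeomorphic_map)
    show "continuous_map (dual UNIV) (dual D) (\<lambda>h. restrict h D)"
      unfolding dual_def[of D]
    proof (rule continuous_on_generated_topo)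
      fix W assume "W \<in> {{h \<in> characters D. h ` K \<subseteq> U} | K U. K \<subseteq> D \<and> compact K \<and> open U}"
      then obtain K U where W: "W = {h \<in> characters D. h ` K \<subseteq> U}" "K \<subseteq> D" "compact K" "open U" by blast
      have "(\<lambda>h. restrict h D) -` W \<inter> topspace (dual UNIV) = {h \<in> characters UNIV. h ` K \<subseteq> U}"
        using W restrict_character[OF _ D(1)] by (auto simp: topspace_dual)
      moreover have "openin (dual UNIV) {h \<in> characters UNIV. h ` K \<subseteq> U}"
        unfolding dual_def using W by (intro topology_generated_by_Basis) auto
      ultimately show "openin (dual UNIV) ((\<lambda>h. restrict h D) -` W \<inter> topspace (dual UNIV))" by simp
    next
      have "(\<lambda>h. restrict h D) ` topspace (dual UNIV) \<subseteq> topspace (dual D)"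
        using restrict_character[OF _ D(1)] by (auto simp: topspace_dual)
      then show "(\<lambda>h. restrict h D) ` topspace (dual UNIV) \<subseteq>
          \<Union>{{h \<in> characters D. h ` K \<subseteq> U} | K U. K \<subseteq> D \<and> compact K \<and> open U}"
        unfolding dual_def[of D] topology_generated_by_topspace .
    qed
    show "open_map (dual UNIV) (dual D) (\<lambda>h. restrict h D)"
      unfolding open_map_def
    proof (intro allI impI)
      fix W assume "openin (dual (UNIV :: 'a set)) W"
      then have "W \<subseteq> characters UNIV" using openin_subset by (metis topspace_dual)
      then have "(\<lambda>h. restrict h D) ` W \<subseteq> characters D" using restrict_character[OF _ D(1)] by blast
      then have "openin (dual D) (\<Union>h\<in>(\<lambda>h. restrict h D) ` W. {h})" using singleton by (intro openin_Union) auto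
      then show "openin (dual D) ((\<lambda>h. restrict h D) ` W)" by simp
    qed
    show "(\<lambda>h. restrict h D) ` topspace (dual UNIV) = topspace (dual D)"
      unfolding topspace_dual
    proof (intro equalityI subsetI)
      fix h assume "h \<in> characters D"
      then obtain H where "H \<in> characters UNIV" "restrict H D = h"
        by (rule character_extends[OF cpt D]) (blast intro: that)
      then show "h \<in> (\<lambda>h. restrict h D) ` characters UNIV" by blast
    qed (use restrict_character[OF _ D(1)] in auto)
    show "inj_on (\<lambda>h. restrict h D) (topspace (dual UNIV))"
      unfolding topspace_dual
    proof (rule inj_onI)
      fix h h' assume h: "h \<in> characters UNIV" "h' \<in> characters (UNIV :: 'a set)" "restrict h D = restrict h' D"
      show "h = h'"
      proof (rule inj[OF h(1,2)])
        fix x assume "x \<in> K"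
        then have "x \<in> D" using K(1) by blast
        with fun_cong[OF h(3), of x] show "dist (h x) (h' x) \<le> 1 / 4" by simp
      qed
    qed
  qed
qed

section \<open>The theorem\<close>

lemma aleph1_le_uncountable: "uncountable Z \<Longrightarrow> aleph1 \<le>o |Z|"
  unfolding countable_iff_natLeq not_ordLeq_iff_ordLess[OF natLeq_Well_order card_of_Well_order]
  by (rule cardSuc_least[OF natLeq_Card_order card_of_Card_order])

lemma non_null_witness:
  obtains A where "rep_circle ` A \<notin> null_sets lebesgue" "non_null = |A|"
    "\<And>A'. rep_circle ` A' \<notin> null_sets lebesgue \<Longrightarrow> |A| \<le>o |A'|"
proof -
  have "rep_circle ` UNIV = {-(1/2)<..1/2}"
  proof (intro equalityI subsetI)
    fix t :: real assume "t \<in> {-(1/2)<..1/2}"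
    then show "t \<in> rep_circle ` UNIV" by (metis abs_circle_inverse rangeI minus_divide_left)
  qed (use rep_circle_bounds in auto)
  moreover have "{-(1/2)<..1/2} \<notin> null_sets (lebesgue :: real measure)"
  proof
    assume "{-(1/2)<..1/2} \<in> null_sets (lebesgue :: real measure)"
    then have "{-(1/2)<..1/2} \<in> null_sets (lborel :: real measure)" by (simp add: null_sets_completion_iff)
    then show False by auto
  qed
  ultimately have "{A :: circle set. rep_circle ` A \<notin> null_sets lebesgue} \<noteq> {}" by (metis (mono_tags) empty_iff mem_Collect_eq)
  from least_card[OF this] show ?thesis using that unfolding non_null_def by blast
qed

lemma countable_null: "countable A \<Longrightarrow> rep_circle ` A \<in> null_sets lebesgue"
  by (intro null_sets_completionI countable_imp_null_set_lborel countable_image)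

lemma non_null_CH:
  assumes "|UNIV :: real set| =o aleph1" shows "non_null =o aleph1"
proof -
  obtain A where A: "rep_circle ` A \<notin> null_sets lebesgue" "non_null = |A|"
    by (rule non_null_witness) (blast intro: that)
  have "uncountable A" using A(1) countable_null by blast
  then have "aleph1 \<le>o |A|" by (rule aleph1_le_uncountable)
  moreover have "|A| \<le>o |UNIV :: real set|"
    using rep_circle_inject by (intro card_of_ordLeq[THEN iffD1] exI[of _ rep_circle]) (auto intro: inj_onI)
  then have "|A| \<le>o aleph1" using assms by (rule ordLeq_ordIso_trans)
  ultimately show ?thesis unfolding A(2) by (simp add: ordIso_iff_ordLeq)
qed

text \<open>The hypothesis on \<open>non_null\<close> enters here: a non-null set of cardinality \<open>\<aleph>\<^sub>1\<close> can be indexed by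
members of any uncountable set of characters.\<close>

lemma not_determined_if_uncountable:
  assumes cpt: "compact (UNIV :: 'a::{topological_ab_group_add, t2_space} set)"
    and nn: "non_null =o aleph1" and unc: "uncountable (characters (UNIV :: 'a set))"
  shows "\<not> determined (UNIV :: 'a set)"
proof -
  have "add_subgroup (characters (UNIV :: 'a set))"
    unfolding add_subgroup_def characters_def
    by (auto simp: plus_fun_def fun_Compl_def zero_fun_def intro!: continuous_intros)
  then obtain p and Z :: "('a \<Rightarrow> circle) set" where p: "p = 0 \<or> prime p" and Z: "Z \<subseteq> characters UNIV" "uncountable Z"
    "indep_mod p Z (\<lambda>x. x)" "\<And>z. z \<in> Z \<Longrightarrow> int p \<odot> z = 0"
    using unc by (rule uncountable_indep) (blast intro: that)
  obtain D where "test_group p D" using ex_test_group[OF p] by blast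
  then interpret test_group p D .
  obtain A where A: "rep_circle ` A \<notin> null_sets lebesgue" "non_null = |A|"
    by (rule non_null_witness) (blast intro: that)
  have "rep_circle ` A \<subseteq> {-(1/2)<..1/2}" using rep_circle_bounds by auto
  then obtain Y where Y: "Y \<subseteq> rep_circle ` A" "indep_mod p Y (\<lambda>x \<psi>. if \<psi> \<in> D then \<psi> x else 0)"
    "\<And>f :: nat \<Rightarrow> real \<Rightarrow> circle. inj f \<Longrightarrow> range f \<subseteq> D \<Longrightarrow> \<exists>y\<in>Y. \<not> (\<lambda>k. f k y) \<longlonglongrightarrow> 0"
    using A(1) by (rule nonnull_selection) (blast intro: that)
  have "|Y| \<le>o |rep_circle ` A|" using Y(1) by (rule card_of_mono1)
  also have "|rep_circle ` A| \<le>o |A|" by (rule card_of_image)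
  also have "|A| =o aleph1" using nn unfolding A(2) .
  also have "aleph1 \<le>o |Z|" using Z(2) by (rule aleph1_le_uncountable)
  finally obtain \<alpha> where \<alpha>: "inj_on \<alpha> Y" "\<alpha> ` Y \<subseteq> Z" unfolding card_of_ordLeq[symmetric] by blast
  have "indep_mod p Y \<alpha>"
    unfolding indep_mod_def
  proof (intro allI impI)
    fix F k assume F: "finite F" "F \<subseteq> Y" "(\<Sum>y\<in>F. k y \<odot> \<alpha> y) = 0"
    have inj: "inj_on \<alpha> F" using \<alpha>(1) F(2) by (rule inj_on_subset)
    have "(\<Sum>z\<in>\<alpha> ` F. k (the_inv_into F \<alpha> z) \<odot> z) = (\<Sum>y\<in>F. k y \<odot> \<alpha> y)"
      by (simp add: sum.reindex[OF inj] the_inv_into_f_f[OF inj])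
    then have sum: "(\<Sum>z\<in>\<alpha> ` F. k (the_inv_into F \<alpha> z) \<odot> z) = 0" using F(3) by simp
    show "\<forall>y\<in>F. int p dvd k y"
    proof
      fix y assume y: "y \<in> F"
      have "int p dvd k (the_inv_into F \<alpha> (\<alpha> y))"
        using F \<alpha>(2) y by (intro indep_modD[OF Z(3) _ _ sum]) auto
      then show "int p dvd k y" by (simp add: the_inv_into_f_f[OF inj y])
    qed
  qed
  then have "test_embedding p D Y \<alpha>"
    using cpt Y(2,3) \<alpha>(2) Z(1,4) by unfold_locales auto
  then show ?thesis by (rule test_embedding.not_determined)
qed

theorem mainTheorem2:
  shows "( |UNIV :: real set| =o aleph1 \<longrightarrow> non_null =o aleph1) \<and>
    (non_null =o aleph1 \<longrightarrow>
      infinite (UNIV :: 'a::{topological_ab_group_add, t2_space} set) \<and> compact (UNIV :: 'a set) \<longrightarrow>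
      (determined (UNIV :: 'a set) \<longleftrightarrow> weight TYPE('a) =o natLeq))"
proof (intro conjI impI)
  show "non_null =o aleph1" if "|UNIV :: real set| =o aleph1" using that by (rule non_null_CH)
  assume nn: "non_null =o aleph1" and "infinite (UNIV :: 'a set) \<and> compact (UNIV :: 'a set)"
  then have inf: "infinite (UNIV :: 'a set)" and cpt: "compact (UNIV :: 'a set)" by auto
  show "determined (UNIV :: 'a set) \<longleftrightarrow> weight TYPE('a) =o natLeq"
    unfolding weight_countable_iff[OF inf]
    using determined_if_countable_basis[OF cpt] not_determined_if_uncountable[OF cpt nn]
      countable_basis_if_countable_characters[OF cpt] by blast
qed

end
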